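(* Let $\gamma_t(x)=\exp\big(\sum_{0<|\alpha|\le L}t^\alpha X_\alpha\big)x$, where the $X_\alpha$ are $C^\infty$ vector fields defined near $0\in\mathbb{R}^n$. If $\gamma$ is real analytic in $(t,x)$ near $(0,0)$ (equivalently, if each $X_\alpha$ is real analytic near $0$), then the finite-type condition (defined in the context) holds: there exist a neighborhood $U$ of $0\in\mathbb{R}^n$ and a finite subset $\mathcal{F}\subseteq\mathcal{S}$ such that for every $(X,d)\in\mathcal{S}$, $$X=\sum_{(Y,e)\in\mathcal{F},\ e\le d}c_X^Y\,Y\quad\text{on }U,\qquad c_X^Y\in C^\infty(U).$$
   Context: Fix $\nu\ge1$ and a decomposition $\mathbb{R}^N=\mathbb{R}^{N_1}\times\cdots\times\mathbb{R}^{N_\nu}$; write $t=(t_1,\ldots,t_\nu)$ and correspondingly $\alpha=(\alpha_1,\ldots,\alpha_\nu)\in\mathbb{N}^N$ with $\alpha_\mu\in\mathbb{N}^{N_\mu}$, $t^\alpha=\prod_\mu t_\mu^{\alpha_\mu}$. $\exp(Y)x$ is the time-one flow of $Y$ starting at $x$. All considerations are local near $(0,0)\in\mathbb{R}^N\times\mathbb{R}^n$. For $\alpha\in\mathbb{N}^N$ put $\deg(\alpha)=(|\alpha_1|,\ldots,|\alpha_\nu|)\in\mathbb{N}^\nu$. $\alpha$ is a pure power if $\deg(\alpha)$ is non-zero in precisely one component. With $\alpha$ ranging over $0<|\alpha|\le L$, let $\mathcal{P}=\{(X_\alpha,\deg(\alpha)):\alpha\text{ a pure power}\}$. Let $\mathcal{S}$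 be the smallest set of pairs (vector field, element of $\mathbb{N}^\nu$) with $\mathcal{P}\subseteq\mathcal{S}$ and such that $(X,d),(Y,e)\in\mathcal{S}$ implies $([X,Y],d+e)\in\mathcal{S}$. For $e,d\in\mathbb{N}^\nu$, $e\le d$ means $e_\mu\le d_\mu$ for every $\mu$. The finite-type condition is the property displayed in the claim: existence of a finite $\mathcal{F}\subseteq\mathcal{S}$ such that each $(X,d)\in\mathcal{S}$ satisfies $X=\sum_{(Y,e)\in\mathcal{F},\,e\le d}c_X^YY$ with $c_X^Y\in C^\infty$, near $0$. *)

theory Defs
  imports "HOL-Analysis.Analysis"
begin

section \<open>Smooth and real analytic functions of several variables\<close>

text \<open>Used for open \<open>S\<close> only, where it is the usual notion of \<open>k\<close>-fold continuous
  differentiability.\<close>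

fun Ck_on :: "nat \<Rightarrow> ('a::euclidean_space \<Rightarrow> 'b::real_normed_vector) \<Rightarrow> 'a set \<Rightarrow> bool" where
  "Ck_on 0 f S \<longleftrightarrow> continuous_on S f"
| "Ck_on (Suc k) f S \<longleftrightarrow>
     (\<forall>x\<in>S. f differentiable (at x)) \<and>
     (\<forall>v. Ck_on k (\<lambda>x. frechet_derivative f (at x) v) S)"

definition smooth_on :: "('a::euclidean_space \<Rightarrow> 'b::real_normed_vector) \<Rightarrow> 'a set \<Rightarrow> bool" where
  "smooth_on f S \<longleftrightarrow> (\<forall>k. Ck_on k f S)"

text \<open>A multi-index on a Euclidean space is a function \<open>\<beta>\<close> from its standard basis to \<open>nat\<close>
  (extensional, so that each multi-index occurs once in the sum).\<close>

definition real_analytic_at :: "('a::euclidean_space \<Rightarrow> 'b::real_normed_vector) \<Rightarrow> 'a \<Rightarrow> bool" where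
  "real_analytic_at f p \<longleftrightarrow>
     (\<exists>r>0. \<exists>c :: ('a \<Rightarrow> nat) \<Rightarrow> 'b. \<forall>y\<in>ball p r.
        ((\<lambda>\<beta>. (\<Prod>b\<in>Basis. ((y - p) \<bullet> b) ^ \<beta> b) *\<^sub>R c \<beta>) has_sum f y)
          (Basis \<rightarrow>\<^sub>E (UNIV :: nat set)))"

definition real_analytic_near :: "('a::euclidean_space \<Rightarrow> 'b::real_normed_vector) \<Rightarrow> 'a \<Rightarrow> bool" where
  "real_analytic_near f p \<longleftrightarrow> (\<exists>V. open V \<and> p \<in> V \<and> (\<forall>q\<in>V. real_analytic_at f q))"

section \<open>Vector fields\<close>

text \<open>A vector field on an open set \<open>W\<close> is a total function of which only the values on
  \<open>W\<close> matter; at points of \<open>W\<close> the bracket depends only on the values of its arguments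
  on \<open>W\<close>.\<close>

definition lie_bracket ::
  "('a::real_normed_vector \<Rightarrow> 'a) \<Rightarrow> ('a \<Rightarrow> 'a) \<Rightarrow> 'a \<Rightarrow> 'a" where
  "lie_bracket X Y = (\<lambda>x. frechet_derivative Y (at x) (X x) - frechet_derivative X (at x) (Y x))"

text \<open>\<open>exp_flow W Y x\<close> is \<open>exp(Y)x\<close> for a vector field \<open>Y\<close> on \<open>W\<close>. It is unspecified if
  the integral curve starting at \<open>x\<close> leaves \<open>W\<close> before time one; for smooth \<open>Y\<close> the value
  is unique whenever the curve exists.\<close>

definition exp_flow ::
  "('a::real_normed_vector) set \<Rightarrow> ('a \<Rightarrow> 'a) \<Rightarrow> 'a \<Rightarrow> 'a" where
  "exp_flow W Y x = (THE y. \<exists>\<phi> :: real \<Rightarrow> 'a.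
     \<phi> 0 = x \<and> \<phi> 1 = y \<and>
     (\<forall>s\<in>{0..1}. \<phi> s \<in> W \<and> (\<phi> has_vector_derivative Y (\<phi> s)) (at s within {0..1})))"

section \<open>Multi-indices and multi-parameter degrees\<close>

text \<open>The decomposition of \<open>\<real>\<^sup>N\<close> into factors is given by a map \<open>blk\<close>: the coordinate \<open>i\<close> of
  \<open>\<real>\<^sup>N = real ^ 'm\<close> belongs to the factor with index \<open>blk i :: 'v\<close>, so \<open>\<nu> = CARD('v)\<close> and
  \<open>N\<^sub>\<mu> = card {i. blk i = \<mu>}\<close>. Factors of dimension \<open>0\<close> are permitted.\<close>

definition mi_length :: "nat ^ 'm \<Rightarrow> nat" where
  "mi_length \<alpha> = (\<Sum>i\<in>UNIV. \<alpha> $ i)"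

definition mi_power :: "real ^ 'm \<Rightarrow> nat ^ 'm \<Rightarrow> real" where
  "mi_power t \<alpha> = (\<Prod>i\<in>UNIV. (t $ i) ^ (\<alpha> $ i))"

definition multi_indices :: "nat \<Rightarrow> (nat ^ 'm) set" where
  "multi_indices L = {\<alpha>. 0 < mi_length \<alpha> \<and> mi_length \<alpha> \<le> L}"

definition mi_deg :: "('m \<Rightarrow> 'v::finite) \<Rightarrow> nat ^ 'm \<Rightarrow> nat ^ 'v" where
  "mi_deg blk \<alpha> = (\<chi> \<mu>. \<Sum>i | blk i = \<mu>. \<alpha> $ i)"

definition pure_power :: "('m \<Rightarrow> 'v::finite) \<Rightarrow> nat ^ 'm \<Rightarrow> bool" where
  "pure_power blk \<alpha> \<longleftrightarrow> (\<exists>!\<mu>. mi_deg blk \<alpha> $ \<mu> \<noteq> 0)"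

lemma finite_multi_indices: "finite (multi_indices L :: (nat ^ 'm) set)"
proof (rule finite_subset)
  show "(multi_indices L :: (nat ^ 'm) set) \<subseteq> vec_lambda ` (UNIV \<rightarrow>\<^sub>E {..L})"
  proof
    fix \<alpha> :: "nat ^ 'm" assume \<alpha>: "\<alpha> \<in> multi_indices L"
    have "\<alpha> $ i \<le> L" for i
    proof -
      have "\<alpha> $ i \<le> mi_length \<alpha>"
        unfolding mi_length_def by (rule member_le_sum) auto
      with \<alpha> show ?thesis by (simp add: multi_indices_def)
    qed
    then have "vec_nth \<alpha> \<in> UNIV \<rightarrow>\<^sub>E {..L}" by auto
    then show "\<alpha> \<in> vec_lambda ` (UNIV \<rightarrow>\<^sub>E {..L})"
      by (metis image_eqI vec_nth_inverse)
  qed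
  show "finite (vec_lambda ` (UNIV \<rightarrow>\<^sub>E {..L}) :: (nat ^ 'm) set)"
    by (intro finite_imageI finite_PiE) auto
qed

section \<open>The map \<open>\<gamma>\<close> and the generated set \<open>\<S>\<close>\<close>

definition gamma_map ::
  "(real ^ 'n) set \<Rightarrow> nat \<Rightarrow> (nat ^ 'm \<Rightarrow> real ^ 'n \<Rightarrow> real ^ 'n) \<Rightarrow>
    real ^ 'm \<Rightarrow> real ^ 'n \<Rightarrow> real ^ 'n" where
  "gamma_map W L X t x =
     exp_flow W (\<lambda>y. \<Sum>\<alpha>\<in>multi_indices L. mi_power t \<alpha> *\<^sub>R X \<alpha> y) x"

definition pure_pairs ::
  "('m \<Rightarrow> 'v::finite) \<Rightarrow> nat \<Rightarrow> (nat ^ 'm \<Rightarrow> real ^ 'n \<Rightarrow> real ^ 'n) \<Rightarrow>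
    ((real ^ 'n \<Rightarrow> real ^ 'n) \<times> (nat ^ 'v)) set" where
  "pure_pairs blk L X = {(X \<alpha>, mi_deg blk \<alpha>) | \<alpha>. \<alpha> \<in> multi_indices L \<and> pure_power blk \<alpha>}"

inductive_set bracket_closure ::
  "((real ^ 'n \<Rightarrow> real ^ 'n) \<times> (nat ^ 'v)) set \<Rightarrow> ((real ^ 'n \<Rightarrow> real ^ 'n) \<times> (nat ^ 'v)) set"
  for P :: "((real ^ 'n \<Rightarrow> real ^ 'n) \<times> (nat ^ 'v)) set" where
  base: "p \<in> P \<Longrightarrow> p \<in> bracket_closure P"
| bracket: "(X, d) \<in> bracket_closure P \<Longrightarrow> (Y, e) \<in> bracket_closure P \<Longrightarrow>
    (lie_bracket X Y, d + e) \<in> bracket_closure P"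

text \<open>The order \<open>e \<le> d\<close> on \<open>nat ^ 'v\<close> is the componentwise one (\<open>less_eq_vec_def\<close>).\<close>

definition finite_type_condition ::
  "(real ^ 'n) set \<Rightarrow> ((real ^ 'n \<Rightarrow> real ^ 'n) \<times> (nat ^ 'v)) set \<Rightarrow> bool" where
  "finite_type_condition W S \<longleftrightarrow>
     (\<exists>U F. open U \<and> 0 \<in> U \<and> U \<subseteq> W \<and> finite F \<and> F \<subseteq> S \<and>
       (\<forall>(X, d)\<in>S. \<exists>c :: (real ^ 'n \<Rightarrow> real ^ 'n) \<times> (nat ^ 'v) \<Rightarrow> real ^ 'n \<Rightarrow> real.
          (\<forall>(Y, e)\<in>F. e \<le> d \<longrightarrow> smooth_on (c (Y, e)) U) \<and>
          (\<forall>x\<in>U. X x = (\<Sum>(Y, e)\<in>{(Y, e)\<in>F. e \<le> d}. c (Y, e) x *\<^sub>R Y x))))"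

end

theory Submission
  imports Defs
begin

text \<open>The flow \<open>\<gamma>\<close> is analytic when the fields are, because the coordinates of \<open>exp(Y)x\<close> are sums of
  the Lie series \<open>\<Sum>k. Y\<^sup>k x\<^sub>j / k!\<close>, which converges as a power series in \<open>(t, x)\<close> for small \<open>t\<close>.
  Conversely, if the fields of order at most \<open>k\<close> are analytic, so is their truncated flow, and it differs
  from \<open>\<gamma>\<close> by \<open>\<Sum>t\<^sup>\<alpha> X\<^sub>\<alpha>\<close> over \<open>|\<alpha>| = k + 1\<close>, up to higher order in \<open>t\<close>; hence the fields of
  order \<open>k + 1\<close> are Taylor coefficients of an analytic map.

  For the finite-type condition, the germs spanned by elements of \<open>\<S>\<close> of degree at most \<open>d\<close> form a
  module that grows with \<open>d\<close>. Dickson's lemma, applied to the pairs of \<open>d\<close> and a leading exponent of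
  that module, together with division of convergent power series, yields finitely many generators for
  all germs in \<open>\<S>\<close>. The brackets of these generators satisfy finitely many relations, valid on a common
  neighborhood, and by the Leibniz rule these relations propagate to all of \<open>\<S>\<close> on that neighborhood.\<close>

section \<open>Power series in several variables\<close>

text \<open>Noetherianity of the ring of convergent power series would only give generators for each
  degree \<open>d\<close> separately, whereas one finite set has to serve all degrees, and for
  degree \<open>d\<close> only its elements of degree at most \<open>d\<close> may be used. In
  effect this is finite generation of a Rees-type module, with one additional polynomial variable
  per factor to record the degree.

  Formal division by leading terms is triangular and always solvable; convergence is the obstacle.
  It is controlled by the sum of the absolute values of the coefficients weighted by a polyradius.
  This norm is submultiplicative, so division becomes an estimate with contraction factor 1/2, once
  the polyradius is chosen such that each tail weighs at most half of its leading term.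
  Differentiation, in contrast, costs radius. An iterated Lie derivative of order \<open>p\<close>
  therefore loses a factor comparable to \<open>p ^ p\<close>, which the \<open>fact p\<close> in
  the denominator of the Lie series compensates.\<close>

lemma mi_power_add: "mi_power z (\<alpha> + \<beta>) = mi_power z \<alpha> * mi_power z \<beta>"
  by (simp add: mi_power_def power_add prod.distrib)

lemma mi_power_0 [simp]: "mi_power z 0 = 1"
  by (simp add: mi_power_def)

lemma mi_power_nonneg: "(\<And>i. 0 \<le> w $ i) \<Longrightarrow> 0 \<le> mi_power w \<beta>"
  by (simp add: mi_power_def prod_nonneg)

lemma mi_power_pos: "(\<And>i. 0 < w $ i) \<Longrightarrow> 0 < mi_power w \<beta>"
  by (simp add: mi_power_def prod_pos)

lemma abs_mi_power: "\<bar>mi_power z \<beta>\<bar> = mi_power (\<chi> i. \<bar>z $ i\<bar>) \<beta>"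
  by (simp add: mi_power_def abs_prod power_abs)

lemma mi_power_mono:
  assumes "\<And>i. 0 \<le> z $ i" "\<And>i. z $ i \<le> w $ i"
  shows "mi_power z \<beta> \<le> mi_power w \<beta>"
  unfolding mi_power_def using assms by (intro prod_mono) (auto intro: power_mono)

lemma abs_mi_power_le:
  assumes "\<And>i. \<bar>z $ i\<bar> \<le> w $ i"
  shows "\<bar>mi_power z \<beta>\<bar> \<le> mi_power w \<beta>"
  unfolding abs_mi_power using assms by (intro mi_power_mono) auto

lemma mi_power_scale: "mi_power (c *\<^sub>R z) \<beta> = c ^ mi_length \<beta> * mi_power z \<beta>"
  by (simp add: mi_power_def mi_length_def power_mult_distrib prod.distrib power_sum)

lemma mi_power_axis [simp]: "mi_power z (axis i (Suc 0)) = z $ i"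
proof -
  have "mi_power z (axis i (Suc 0)) = (\<Prod>j\<in>UNIV. if i = j then z $ j else 1)"
    unfolding mi_power_def by (intro prod.cong) (auto simp: axis_def)
  then show ?thesis by simp
qed

lemma mi_length_axis [simp]: "mi_length (axis i (n::nat)) = n"
  by (simp add: mi_length_def axis_def)

lemma mi_length_eq_0 [simp]: "mi_length \<beta> = 0 \<longleftrightarrow> \<beta> = 0"
  by (auto simp: mi_length_def vec_eq_iff)

text \<open>The index set of a Cauchy product at \<beta>. Pairs instead of differences avoid
  truncated subtraction, and the fibers partition all pairs of multi-indices.\<close>

definition mi_fiber :: "nat ^ 'i \<Rightarrow> ((nat ^ 'i) \<times> (nat ^ 'i)) set" where
  "mi_fiber \<beta> = {p. fst p + snd p = \<beta>}"

lemma mem_mi_fiber [simp]: "p \<in> mi_fiber \<beta> \<longleftrightarrow> fst p + snd p = \<beta>"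
  by (simp add: mi_fiber_def)

lemma mi_fiber_eq: "mi_fiber \<beta> = (\<lambda>\<gamma>. (\<gamma>, \<beta> - \<gamma>)) ` {\<gamma>. \<gamma> \<le> \<beta>}"
proof -
  have "(a, b) \<in> mi_fiber \<beta> \<longleftrightarrow> a \<le> \<beta> \<and> b = \<beta> - a" for a b
    by (auto simp: less_eq_vec_def vec_eq_iff) (metis le_add1, metis add_diff_cancel_left')
  then show ?thesis by (auto simp: image_iff)
qed

lemma atMost_mi_eq: "{\<gamma>. \<gamma> \<le> \<beta>} = vec_lambda ` (\<Pi>\<^sub>E i\<in>UNIV. {..(\<beta>::nat^'i) $ i})"
proof -
  have "\<gamma> \<in> vec_lambda ` (\<Pi>\<^sub>E i\<in>UNIV. {..\<beta> $ i})" if "\<gamma> \<le> \<beta>" for \<gamma>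
    using that by (intro image_eqI[of _ _ "vec_nth \<gamma>"]) (auto simp: less_eq_vec_def)
  then show ?thesis by (auto simp: less_eq_vec_def)
qed

lemma finite_atMost_mi [simp]: "finite {\<gamma>. \<gamma> \<le> (\<beta>::nat^'i)}"
  unfolding atMost_mi_eq by (intro finite_imageI finite_PiE) auto

lemma finite_mi_fiber [simp]: "finite (mi_fiber \<beta>)"
  unfolding mi_fiber_eq by simp

text \<open>The fibers of addition partition all pairs, so an unordered sum over pairs may be taken
  fiber by fiber.\<close>

lemma has_sum_mi_fiber:
  fixes T :: "(nat ^ 'i) \<times> (nat ^ 'i) \<Rightarrow> real"
  assumes "(T has_sum S) UNIV"
  shows "((\<lambda>\<beta>. \<Sum>p\<in>mi_fiber \<beta>. T p) has_sum S) UNIV"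
proof -
  have "bij_betw snd (Sigma UNIV (mi_fiber :: nat ^ 'i \<Rightarrow> _)) UNIV"
    by (rule bij_betwI[of _ _ _ "\<lambda>p. (fst p + snd p, p)"]) auto
  from has_sum_reindex_bij_betw[OF this, of T S]
  have "((\<lambda>x. T (snd x)) has_sum S) (Sigma UNIV mi_fiber)"
    using assms by simp
  then show ?thesis
    by (rule has_sum_SigmaD) (simp add: has_sum_finite)
qed

text \<open>A finite set of pairs meets finitely many fibers, and completing these fibers only
  increases a nonnegative sum.\<close>

lemma sum_le_mi_fiber:
  fixes T :: "(nat ^ 'i) \<times> (nat ^ 'i) \<Rightarrow> real"
  assumes "\<And>p. 0 \<le> T p" "finite G"
    and "\<And>F. finite F \<Longrightarrow> (\<Sum>\<beta>\<in>F. \<Sum>p\<in>mi_fiber \<beta>. T p) \<le> C"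
  shows "sum T G \<le> C"
proof -
  let ?F = "(\<lambda>p. fst p + snd p) ` G"
  have "sum T G \<le> sum T (\<Union>\<beta>\<in>?F. mi_fiber \<beta>)"
    using assms by (intro sum_mono2) auto
  also have "\<dots> = (\<Sum>\<beta>\<in>?F. \<Sum>p\<in>mi_fiber \<beta>. T p)"
    using assms by (intro sum.UNION_disjoint) auto
  finally show ?thesis using assms(2) assms(3)[of ?F] by auto
qed

section \<open>Absolutely summable families and double series\<close>

lemma abs_summable_if_sums_bounded:
  fixes f :: "'a \<Rightarrow> real"
  assumes "\<And>F. finite F \<Longrightarrow> (\<Sum>x\<in>F. \<bar>f x\<bar>) \<le> C"
  shows "(\<lambda>x. norm (f x)) summable_on UNIV" "f summable_on UNIV" "\<bar>infsum f UNIV\<bar> \<le> C"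
    "(\<Sum>\<^sub>\<infinity>x. \<bar>f x\<bar>) \<le> C"
proof -
  show 1: "(\<lambda>x. norm (f x)) summable_on UNIV"
    using assms by (intro nonneg_bdd_above_summable_on) (auto intro!: bdd_aboveI2)
  then show 2: "f summable_on UNIV"
    by (rule abs_summable_summable)
  show 3: "(\<Sum>\<^sub>\<infinity>x. \<bar>f x\<bar>) \<le> C"
    using 1 assms by (intro infsum_le_finite_sums) auto
  show "\<bar>infsum f UNIV\<bar> \<le> C"
    using norm_infsum_bound[OF 1] 3 by simp
qed

lemma sum_abs_le_infsum_abs:
  fixes f :: "'a \<Rightarrow> real"
  assumes "(\<lambda>x. norm (f x)) summable_on UNIV" "finite F"
  shows "(\<Sum>x\<in>F. \<bar>f x\<bar>) \<le> (\<Sum>\<^sub>\<infinity>x. \<bar>f x\<bar>)"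
  using assms by (intro finite_sum_le_infsum) auto

lemma sum_abs_prod_le:
  fixes f :: "'a \<Rightarrow> real" and g :: "'b \<Rightarrow> real"
  assumes f: "\<And>F. finite F \<Longrightarrow> (\<Sum>x\<in>F. \<bar>f x\<bar>) \<le> A"
    and g: "\<And>F. finite F \<Longrightarrow> (\<Sum>x\<in>F. \<bar>g x\<bar>) \<le> B"
    and G: "finite G"
  shows "(\<Sum>p\<in>G. \<bar>f (fst p) * g (snd p)\<bar>) \<le> A * B"
proof -
  have "(\<Sum>p\<in>G. \<bar>f (fst p) * g (snd p)\<bar>) \<le> (\<Sum>p\<in>fst ` G \<times> snd ` G. \<bar>f (fst p) * g (snd p)\<bar>)"
    using G by (intro sum_mono2 subset_fst_snd) auto
  also have "\<dots> = (\<Sum>x\<in>fst ` G. \<bar>f x\<bar>) * (\<Sum>x\<in>snd ` G. \<bar>g x\<bar>)"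
    by (simp add: sum_product sum.cartesian_product case_prod_unfold abs_mult)
  also have "\<dots> \<le> A * B"
    using G f[of "{}"] by (intro mult_mono sum_nonneg f g) auto
  finally show ?thesis .
qed

text \<open>Fubini for a family whose finite absolute sums are bounded. The third claim keeps the
  constant \<open>C\<close>, so that norm estimates pass through an infinite inner sum.\<close>

lemma has_sum_sections:
  fixes T :: "'a \<times> 'b \<Rightarrow> real"
  assumes T: "\<And>G. finite G \<Longrightarrow> (\<Sum>p\<in>G. \<bar>T p\<bar>) \<le> C"
  shows "\<And>a. (\<lambda>b. T (a, b)) summable_on UNIV"
    "((\<lambda>a. \<Sum>\<^sub>\<infinity>b. T (a, b)) has_sum infsum T UNIV) UNIV"
    "\<And>F. finite F \<Longrightarrow> (\<Sum>a\<in>F. \<bar>\<Sum>\<^sub>\<infinity>b. T (a, b)\<bar>) \<le> C"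
proof -
  have sec: "(\<Sum>b\<in>G. \<bar>T (a, b)\<bar>) \<le> C" if "finite G" for a G
  proof -
    have "(\<Sum>b\<in>G. \<bar>T (a, b)\<bar>) = (\<Sum>p\<in>Pair a ` G. \<bar>T p\<bar>)"
      by (subst sum.reindex) (auto intro: inj_onI)
    then show ?thesis using T[of "Pair a ` G"] that by simp
  qed
  show s: "(\<lambda>b. T (a, b)) summable_on UNIV" for a
    by (rule abs_summable_if_sums_bounded(2)[OF sec])
  have s': "(\<lambda>b. \<bar>T (a, b)\<bar>) summable_on UNIV" for a
    using abs_summable_if_sums_bounded(1)[OF sec] by simp
  have hs: "((\<lambda>a. \<Sum>\<^sub>\<infinity>b. S (a, b)) has_sum infsum S UNIV) UNIV"
    if "S summable_on UNIV" "\<And>a. (\<lambda>b. S (a, b)) summable_on UNIV" for S :: "'a \<times> 'b \<Rightarrow> real"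
  proof (rule has_sum_SigmaD[where f = S and A = UNIV and B = "\<lambda>_. UNIV"])
    show "(S has_sum infsum S UNIV) (UNIV \<times> UNIV)" using that by simp
    show "((\<lambda>y. S (x, y)) has_sum (\<Sum>\<^sub>\<infinity>b. S (x, b))) UNIV" for x using that by simp
  qed
  show "((\<lambda>a. \<Sum>\<^sub>\<infinity>b. T (a, b)) has_sum infsum T UNIV) UNIV"
    by (rule hs[OF abs_summable_if_sums_bounded(2)[OF T] s])
  fix F :: "'a set" assume F: "finite F"
  have "(\<Sum>a\<in>F. \<bar>\<Sum>\<^sub>\<infinity>b. T (a, b)\<bar>) \<le> (\<Sum>a\<in>F. \<Sum>\<^sub>\<infinity>b. \<bar>T (a, b)\<bar>)"
  proof (rule sum_mono)
    show "\<bar>\<Sum>\<^sub>\<infinity>b. T (a, b)\<bar> \<le> (\<Sum>\<^sub>\<infinity>b. \<bar>T (a, b)\<bar>)" for a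
      using norm_infsum_bound[of "\<lambda>b. T (a, b)" UNIV] s' by simp
  qed
  also have "\<dots> \<le> (\<Sum>\<^sub>\<infinity>p. \<bar>T p\<bar>)"
  proof (rule finite_sum_le_has_sum[OF _ F])
    show "((\<lambda>a. \<Sum>\<^sub>\<infinity>b. \<bar>T (a, b)\<bar>) has_sum (\<Sum>\<^sub>\<infinity>p. \<bar>T p\<bar>)) UNIV"
      using hs[of "\<lambda>p. \<bar>T p\<bar>"] abs_summable_if_sums_bounded(1)[OF T] s' by simp
  qed (auto intro: infsum_nonneg)
  also have "\<dots> \<le> C" by (rule abs_summable_if_sums_bounded(4)[OF T])
  finally show "(\<Sum>a\<in>F. \<bar>\<Sum>\<^sub>\<infinity>b. T (a, b)\<bar>) \<le> C" .
qed

text \<open>The weighted l1-norm of the coefficients at polyradius \<open>w\<close> is at most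
  \<open>C\<close>. Formulated with finite sums, it presupposes no summability but implies
  it.\<close>

definition ps_bound :: "real ^ 'i \<Rightarrow> (nat ^ 'i \<Rightarrow> real) \<Rightarrow> real \<Rightarrow> bool" where
  "ps_bound w a C \<longleftrightarrow> (\<forall>F. finite F \<longrightarrow> (\<Sum>\<beta>\<in>F. \<bar>a \<beta>\<bar> * mi_power w \<beta>) \<le> C)"

text \<open>\<open>infsum\<close> defaults to 0 for families that are not summable; the algebraic
  rules below therefore assume bounds at a polyradius that dominates \<open>z\<close>.\<close>

definition ps_eval :: "(nat ^ 'i \<Rightarrow> real) \<Rightarrow> real ^ 'i \<Rightarrow> real" where
  "ps_eval a z = (\<Sum>\<^sub>\<infinity>\<beta>. a \<beta> * mi_power z \<beta>)"

definition ps_mult :: "(nat ^ 'i \<Rightarrow> real) \<Rightarrow> (nat ^ 'i \<Rightarrow> real) \<Rightarrow> nat ^ 'i \<Rightarrow> real" where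
  "ps_mult a b \<beta> = (\<Sum>p\<in>mi_fiber \<beta>. a (fst p) * b (snd p))"

definition ps_deriv :: "'i \<Rightarrow> (nat ^ 'i \<Rightarrow> real) \<Rightarrow> nat ^ 'i \<Rightarrow> real" where
  "ps_deriv i a \<beta> = real (\<beta> $ i + 1) * a (\<beta> + axis i 1)"

lemma ps_boundD: "ps_bound w a C \<Longrightarrow> finite F \<Longrightarrow> (\<Sum>\<beta>\<in>F. \<bar>a \<beta>\<bar> * mi_power w \<beta>) \<le> C"
  by (simp add: ps_bound_def)

lemma ps_bound_nonneg: "ps_bound w a C \<Longrightarrow> 0 \<le> C"
  using ps_boundD[of w a C "{}"] by simp

lemma ps_bound_mono:
  assumes "ps_bound w a C" "\<And>i. 0 \<le> w' $ i" "\<And>i. w' $ i \<le> w $ i" "C \<le> C'"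
  shows "ps_bound w' a C'"
  unfolding ps_bound_def
proof (intro allI impI)
  fix F :: "(nat^'a) set" assume F: "finite F"
  have "(\<Sum>\<beta>\<in>F. \<bar>a \<beta>\<bar> * mi_power w' \<beta>) \<le> (\<Sum>\<beta>\<in>F. \<bar>a \<beta>\<bar> * mi_power w \<beta>)"
    using assms by (intro sum_mono mult_left_mono mi_power_mono) auto
  also have "\<dots> \<le> C'" using ps_boundD[OF assms(1) F] assms(4) by linarith
  finally show "(\<Sum>\<beta>\<in>F. \<bar>a \<beta>\<bar> * mi_power w' \<beta>) \<le> C'" .
qed

lemma ps_bound_add:
  assumes "ps_bound w a A" "ps_bound w b B" "\<And>i. 0 \<le> w $ i"
  shows "ps_bound w (\<lambda>\<beta>. a \<beta> + b \<beta>) (A + B)"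
  unfolding ps_bound_def
proof (intro allI impI)
  fix F :: "(nat^'a) set" assume F: "finite F"
  have "(\<Sum>\<beta>\<in>F. \<bar>a \<beta> + b \<beta>\<bar> * mi_power w \<beta>)
      \<le> (\<Sum>\<beta>\<in>F. \<bar>a \<beta>\<bar> * mi_power w \<beta> + \<bar>b \<beta>\<bar> * mi_power w \<beta>)"
    unfolding distrib_right[symmetric] using assms
    by (intro sum_mono mult_right_mono mi_power_nonneg) auto
  also have "\<dots> \<le> A + B"
    using ps_boundD[OF assms(1) F] ps_boundD[OF assms(2) F] by (simp add: sum.distrib)
  finally show "(\<Sum>\<beta>\<in>F. \<bar>a \<beta> + b \<beta>\<bar> * mi_power w \<beta>) \<le> A + B" .
qed

lemma ps_bound_cmult:
  assumes "ps_bound w a A"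
  shows "ps_bound w (\<lambda>\<beta>. c * a \<beta>) (\<bar>c\<bar> * A)"
  unfolding ps_bound_def using ps_boundD[OF assms]
  by (auto simp: abs_mult mult.assoc sum_distrib_left[symmetric] intro: mult_left_mono)

lemma ps_bound_zero: "ps_bound w (\<lambda>_. 0) 0"
  by (simp add: ps_bound_def)

lemma ps_bound_sum:
  assumes "finite I" "\<And>i. i \<in> I \<Longrightarrow> ps_bound w (a i) (A i)" "\<And>i. 0 \<le> w $ i"
  shows "ps_bound w (\<lambda>\<beta>. \<Sum>i\<in>I. a i \<beta>) (\<Sum>i\<in>I. A i)"
  using assms(1,2)
proof (induction I)
  case empty
  then show ?case by (simp add: ps_bound_zero)
next
  case (insert i I)
  then show ?case using ps_bound_add[of w "a i" "A i"] assms(3) by simp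
qed

text \<open>The norm is submultiplicative: monomials multiply along a fiber, so the weighted Cauchy
  product is dominated by the fiber sums of the product of the two weighted families.\<close>

lemma ps_bound_mult:
  assumes "ps_bound w a A" "ps_bound w b B" "\<And>i. 0 \<le> w $ i"
  shows "ps_bound w (ps_mult a b) (A * B)"
  unfolding ps_bound_def
proof (intro allI impI)
  fix F :: "(nat^'a) set" assume F: "finite F"
  let ?T = "\<lambda>p. (\<bar>a (fst p)\<bar> * mi_power w (fst p)) * (\<bar>b (snd p)\<bar> * mi_power w (snd p))"
  let ?U = "\<Union>\<beta>\<in>F. mi_fiber \<beta>"
  have finU: "finite ?U" using F by auto
  have nonneg [simp]: "\<bar>mi_power w \<beta>\<bar> = mi_power w \<beta>" for \<beta>
    using assms(3) mi_power_nonneg[of w] by simp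
  have bd: "(\<Sum>x\<in>F. \<bar>\<bar>c x\<bar> * mi_power w x\<bar>) \<le> C" if "ps_bound w c C" "finite F" for c C F
    using ps_boundD[OF that] by (simp add: abs_mult)
  have "(\<Sum>\<beta>\<in>F. \<bar>ps_mult a b \<beta>\<bar> * mi_power w \<beta>) \<le> (\<Sum>\<beta>\<in>F. \<Sum>p\<in>mi_fiber \<beta>. ?T p)"
  proof (intro sum_mono)
    fix \<beta>
    have "\<bar>ps_mult a b \<beta>\<bar> * mi_power w \<beta> \<le> (\<Sum>p\<in>mi_fiber \<beta>. \<bar>a (fst p) * b (snd p)\<bar>) * mi_power w \<beta>"
      unfolding ps_mult_def using assms by (intro mult_right_mono mi_power_nonneg sum_abs) auto
    also have "\<dots> = (\<Sum>p\<in>mi_fiber \<beta>. ?T p)"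
      unfolding sum_distrib_right
      by (intro sum.cong) (auto simp: mi_power_add abs_mult)
    finally show "\<bar>ps_mult a b \<beta>\<bar> * mi_power w \<beta> \<le> (\<Sum>p\<in>mi_fiber \<beta>. ?T p)" .
  qed
  also have "\<dots> = sum ?T ?U"
    using F by (intro sum.UNION_disjoint[symmetric]) auto
  also have "\<dots> \<le> A * B"
    using sum_abs_prod_le[OF bd[OF assms(1)] bd[OF assms(2)] finU] nonneg
    by (simp add: abs_mult)
  finally show "(\<Sum>\<beta>\<in>F. \<bar>ps_mult a b \<beta>\<bar> * mi_power w \<beta>) \<le> A * B" .
qed

lemma ps_terms_bounded:
  assumes "ps_bound w a C" "\<And>i. \<bar>z $ i\<bar> \<le> w $ i" "finite F"
  shows "(\<Sum>\<beta>\<in>F. \<bar>a \<beta> * mi_power z \<beta>\<bar>) \<le> C"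
proof -
  have "(\<Sum>\<beta>\<in>F. \<bar>a \<beta> * mi_power z \<beta>\<bar>) \<le> (\<Sum>\<beta>\<in>F. \<bar>a \<beta>\<bar> * mi_power w \<beta>)"
    unfolding abs_mult using assms by (intro sum_mono mult_left_mono abs_mi_power_le) auto
  then show ?thesis using ps_boundD[OF assms(1,3)] by linarith
qed

context
  fixes w z :: "real ^ 'i" and a :: "nat ^ 'i \<Rightarrow> real" and C
  assumes a: "ps_bound w a C" and z: "\<And>i. \<bar>z $ i\<bar> \<le> w $ i"
begin

lemma ps_has_sum: "((\<lambda>\<beta>. a \<beta> * mi_power z \<beta>) has_sum ps_eval a z) UNIV"
  unfolding ps_eval_def using abs_summable_if_sums_bounded(2)[OF ps_terms_bounded[OF a z]]
  by (rule has_sum_infsum)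

lemma abs_ps_eval_le: "\<bar>ps_eval a z\<bar> \<le> C"
  unfolding ps_eval_def by (rule abs_summable_if_sums_bounded(3)[OF ps_terms_bounded[OF a z]])

end

lemma ps_evalI: "((\<lambda>\<beta>. a \<beta> * mi_power z \<beta>) has_sum s) UNIV \<Longrightarrow> ps_eval a z = s"
  unfolding ps_eval_def by (rule infsumI)

lemma ps_eval_add:
  assumes "ps_bound w a A" "ps_bound w b B" "\<And>i. \<bar>z $ i\<bar> \<le> w $ i"
  shows "ps_eval (\<lambda>\<beta>. a \<beta> + b \<beta>) z = ps_eval a z + ps_eval b z"
  using has_sum_add[OF ps_has_sum[OF assms(1,3)] ps_has_sum[OF assms(2,3)]]
  by (intro ps_evalI) (simp add: distrib_right)

lemma ps_eval_zero: "ps_eval (\<lambda>_. 0) z = 0"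
  by (simp add: ps_eval_def)

lemma ps_eval_sum:
  assumes "finite I" "\<And>i. i \<in> I \<Longrightarrow> ps_bound w (a i) (A i)" "\<And>i. \<bar>z $ i\<bar> \<le> w $ i"
  shows "ps_eval (\<lambda>\<beta>. \<Sum>i\<in>I. a i \<beta>) z = (\<Sum>i\<in>I. ps_eval (a i) z)"
  using assms(1,2)
proof (induction I)
  case empty
  then show ?case by (simp add: ps_eval_zero)
next
  case (insert i I)
  have "0 \<le> w $ k" for k using assms(3)[of k] by linarith
  with insert ps_eval_add[OF insert.prems[of i] ps_bound_sum[of I w a A] assms(3)]
  show ?case by simp
qed

text \<open>The double family of products of terms is summed in two ways: by sections it gives the
  product of the values, by fibers the Cauchy product.\<close>

lemma ps_eval_mult:
  assumes "ps_bound w a A" "ps_bound w b B" "\<And>i. \<bar>z $ i\<bar> \<le> w $ i"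
  shows "ps_eval (ps_mult a b) z = ps_eval a z * ps_eval b z"
proof (rule ps_evalI)
  let ?f = "\<lambda>\<beta>. a \<beta> * mi_power z \<beta>" and ?g = "\<lambda>\<beta>. b \<beta> * mi_power z \<beta>"
  let ?T = "\<lambda>p. ?f (fst p) * ?g (snd p)"
  note T = sum_abs_prod_le[OF ps_terms_bounded[OF assms(1,3)] ps_terms_bounded[OF assms(2,3)]]
  have "(\<Sum>\<^sub>\<infinity>y. ?T (x, y)) = ?f x * ps_eval b z" for x
    unfolding ps_eval_def fst_conv snd_conv by (rule infsum_cmult_right')
  then have "((\<lambda>x. ?f x * ps_eval b z) has_sum infsum ?T UNIV) UNIV"
    using has_sum_sections(2)[OF T] by simp
  moreover have "((\<lambda>x. ?f x * ps_eval b z) has_sum (ps_eval a z * ps_eval b z)) UNIV"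
    using has_sum_cmult_left[OF ps_has_sum[OF assms(1,3)]] .
  ultimately have "infsum ?T UNIV = ps_eval a z * ps_eval b z"
    by (rule has_sum_unique)
  then have "(?T has_sum (ps_eval a z * ps_eval b z)) UNIV"
    using has_sum_infsum[OF abs_summable_if_sums_bounded(2)[OF T]] by simp
  from has_sum_mi_fiber[OF this]
  have "((\<lambda>\<beta>. \<Sum>p\<in>mi_fiber \<beta>. ?T p) has_sum (ps_eval a z * ps_eval b z)) UNIV" .
  moreover have "(\<Sum>p\<in>mi_fiber \<beta>. ?T p) = ps_mult a b \<beta> * mi_power z \<beta>" for \<beta>
    unfolding ps_mult_def sum_distrib_right
    by (intro sum.cong) (auto simp: mi_power_add)
  ultimately show "((\<lambda>\<beta>. ps_mult a b \<beta> * mi_power z \<beta>) has_sum (ps_eval a z * ps_eval b z)) UNIV"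
    by simp
qed

section \<open>Re-expansion about another point and termwise differentiation\<close>

definition mi_choose :: "nat ^ 'i \<Rightarrow> nat ^ 'i \<Rightarrow> real" where
  "mi_choose \<beta> \<gamma> = (\<Prod>i\<in>UNIV. real ((\<beta> $ i) choose (\<gamma> $ i)))"

lemma mi_choose_nonneg: "0 \<le> mi_choose \<beta> \<gamma>"
  by (simp add: mi_choose_def prod_nonneg)

lemma mi_choose_axis [simp]: "mi_choose (\<delta> + axis i (Suc 0)) (axis i (Suc 0)) = real (\<delta> $ i + 1)"
proof -
  have "mi_choose (\<delta> + axis i (Suc 0)) (axis i (Suc 0)) = (\<Prod>j\<in>UNIV. if i = j then real (\<delta> $ j + 1) else 1)"
    unfolding mi_choose_def by (intro prod.cong) (auto simp: axis_def)
  then show ?thesis by simp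
qed

text \<open>The binomial theorem in each coordinate; the product of the resulting sums is a sum over
  all choices of exponents, that is, over all \<gamma> \<le> \<beta>.\<close>

lemma mi_binomial:
  "(\<Sum>p\<in>mi_fiber \<beta>. mi_choose \<beta> (fst p) * (mi_power z (snd p) * mi_power h (fst p)))
    = mi_power (z + h) \<beta>"
proof -
  let ?f = "\<lambda>i k. real (\<beta> $ i choose k) * (z $ i ^ (\<beta> $ i - k) * h $ i ^ k)"
  have "(\<Sum>p\<in>mi_fiber \<beta>. mi_choose \<beta> (fst p) * (mi_power z (snd p) * mi_power h (fst p)))
      = (\<Sum>\<gamma>\<in>{\<gamma>. \<gamma> \<le> \<beta>}. mi_choose \<beta> \<gamma> * (mi_power z (\<beta> - \<gamma>) * mi_power h \<gamma>))"
    unfolding mi_fiber_eq by (subst sum.reindex) (auto intro: inj_onI)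
  also have "\<dots> = (\<Sum>g\<in>(\<Pi>\<^sub>E i\<in>UNIV. {..\<beta> $ i}). \<Prod>i\<in>UNIV. ?f i (g i))"
    unfolding atMost_mi_eq
    by (subst sum.reindex)
       (auto intro!: inj_onI simp: vec_lambda_inject mi_choose_def mi_power_def prod.distrib)
  also have "\<dots> = (\<Prod>i\<in>UNIV. \<Sum>k\<in>{..\<beta> $ i}. ?f i k)"
    by (rule prod_sum_PiE[symmetric]) auto
  also have "\<dots> = mi_power (z + h) \<beta>"
    unfolding mi_power_def
    by (intro prod.cong) (auto simp: binomial_ring[of "h $ i" "z $ i" for i] add.commute[of "z $ i" "h $ i" for i] mult_ac)
  finally show ?thesis .
qed

text \<open>The Taylor coefficients about \<open>z\<close>: the derivative of order \<gamma> at
  \<open>z\<close>, divided by the factorial of \<gamma>.\<close>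

definition ps_shift :: "real ^ 'i \<Rightarrow> (nat ^ 'i \<Rightarrow> real) \<Rightarrow> nat ^ 'i \<Rightarrow> real" where
  "ps_shift z a \<gamma> = ps_eval (\<lambda>\<delta>. mi_choose (\<delta> + \<gamma>) \<gamma> * a (\<delta> + \<gamma>)) z"

context
  fixes w z u :: "real ^ 'i" and a :: "nat ^ 'i \<Rightarrow> real" and C
  assumes a: "ps_bound w a C" and zu: "\<And>i. \<bar>z $ i\<bar> + u $ i \<le> w $ i"
begin

text \<open>The terms of the series at \<open>z + h\<close> after binomial expansion, indexed by the
  exponents of \<open>h\<close> and of \<open>z\<close>. Fibers regroup them into the series of
  \<open>a\<close> at \<open>z + h\<close>, sections into the series of \<open>ps_shift z a\<close>
  at \<open>h\<close>.\<close>

private definition "T h p = mi_choose (snd p + fst p) (fst p) * a (snd p + fst p) *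
  mi_power z (snd p) * mi_power h (fst p)"

text \<open>In absolute values the binomial sum over a fiber is exactly the monomial at |z| + |h|,
  which is dominated by the monomial at \<open>w\<close>.\<close>

private lemma T_bound:
  assumes h: "\<And>i. \<bar>h $ i\<bar> \<le> u $ i" and G: "finite G"
  shows "(\<Sum>p\<in>G. \<bar>T h p\<bar>) \<le> C"
proof (rule sum_le_mi_fiber[OF _ G])
  fix F :: "(nat ^ 'i) set" assume F: "finite F"
  let ?z = "\<chi> i. \<bar>z $ i\<bar>" and ?h = "\<chi> i. \<bar>h $ i\<bar>"
  have "(\<Sum>p\<in>mi_fiber \<beta>. \<bar>T h p\<bar>) = \<bar>a \<beta>\<bar> * mi_power (?z + ?h) \<beta>" for \<beta>
    unfolding mi_binomial[symmetric] sum_distrib_left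
    by (intro sum.cong) (auto simp: T_def abs_mult mi_choose_nonneg abs_mi_power add.commute)
  also have "\<dots> \<beta> \<le> \<bar>a \<beta>\<bar> * mi_power w \<beta>" for \<beta>
    by (intro mult_left_mono mi_power_mono) (auto intro: order_trans[OF add_left_mono[OF h] zu])
  finally have "(\<Sum>\<beta>\<in>F. \<Sum>p\<in>mi_fiber \<beta>. \<bar>T h p\<bar>) \<le> (\<Sum>\<beta>\<in>F. \<bar>a \<beta>\<bar> * mi_power w \<beta>)"
    by (intro sum_mono) auto
  also have "\<dots> \<le> C" by (rule ps_boundD[OF a F])
  finally show "(\<Sum>\<beta>\<in>F. \<Sum>p\<in>mi_fiber \<beta>. \<bar>T h p\<bar>) \<le> C" .
qed auto

private lemma T_infsum_section: "(\<Sum>\<^sub>\<infinity>\<delta>. T h (\<gamma>, \<delta>)) = ps_shift z a \<gamma> * mi_power h \<gamma>"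
  unfolding T_def fst_conv snd_conv ps_shift_def ps_eval_def by (rule infsum_cmult_left')

private lemma T_has_sum:
  assumes h: "\<And>i. \<bar>h $ i\<bar> \<le> u $ i"
  shows "((\<lambda>\<gamma>. ps_shift z a \<gamma> * mi_power h \<gamma>) has_sum ps_eval a (z + h)) UNIV"
proof -
  have S: "(T h has_sum infsum (T h) UNIV) UNIV"
    using abs_summable_if_sums_bounded(2)[OF T_bound[OF h]] by simp
  have "(\<Sum>p\<in>mi_fiber \<beta>. T h p) = a \<beta> * mi_power (z + h) \<beta>" for \<beta>
    unfolding mi_binomial[symmetric] sum_distrib_left
    by (intro sum.cong) (auto simp: T_def add.commute)
  with has_sum_mi_fiber[OF S]
  have "((\<lambda>\<beta>. a \<beta> * mi_power (z + h) \<beta>) has_sum infsum (T h) UNIV) UNIV" by simp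
  from ps_evalI[OF this] show ?thesis
    using has_sum_sections(2)[OF T_bound[OF h]] by (simp add: T_infsum_section)
qed

lemma ps_shift_bound:
  assumes u: "\<And>i. 0 \<le> u $ i"
  shows "ps_bound u (ps_shift z a) C"
  unfolding ps_bound_def
proof (intro allI impI)
  fix F :: "(nat ^ 'i) set" assume F: "finite F"
  \<comment> \<open>With \<open>h = u\<close> the section sums are the shifted coefficients weighted
    by \<open>u\<close>, so their bound is the claimed norm bound.\<close>
  have "\<bar>u $ i\<bar> \<le> u $ i" for i using u by simp
  from has_sum_sections(3)[OF T_bound[OF this] F]
  show "(\<Sum>\<gamma>\<in>F. \<bar>ps_shift z a \<gamma>\<bar> * mi_power u \<gamma>) \<le> C"
    using mi_power_nonneg[of u] u by (simp add: T_infsum_section abs_mult)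
qed

lemma ps_eval_shift:
  assumes "\<And>i. \<bar>h $ i\<bar> \<le> u $ i"
  shows "ps_eval (ps_shift z a) h = ps_eval a (z + h)"
  by (rule ps_evalI[OF T_has_sum[OF assms]])

end

lemma ps_shift_axis: "ps_shift z a (axis i 1) = ps_eval (ps_deriv i a) z"
  by (simp add: ps_shift_def ps_deriv_def[abs_def])

lemma mi_length_le_1: "{\<gamma>. mi_length \<gamma> < 2} = insert 0 (range (\<lambda>i. axis i (1::nat)))"
proof -
  have "\<gamma> = 0 \<or> (\<exists>i. \<gamma> = axis i 1)" if "mi_length \<gamma> < 2" for \<gamma> :: "nat ^ 'i"
  proof (cases "\<gamma> = 0")
    case False
    then obtain i where i: "\<gamma> $ i \<noteq> 0" by (auto simp: vec_eq_iff)
    have "\<gamma> $ j = axis i 1 $ j" for j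
    proof -
      have "(\<Sum>k\<in>UNIV. \<gamma> $ k) = \<gamma> $ i + (\<Sum>k\<in>UNIV - {i}. \<gamma> $ k)"
        by (rule sum.remove) auto
      with that i have "\<gamma> $ i = 1 \<and> (\<Sum>k\<in>UNIV - {i}. \<gamma> $ k) = 0"
        unfolding mi_length_def by linarith
      then show ?thesis by (auto simp: axis_def)
    qed
    then show ?thesis by (auto simp: vec_eq_iff)
  qed auto
  then show ?thesis by (auto simp: mi_length_eq_0[THEN iffD2])
qed

text \<open>After deletion of the terms of length below \<open>k\<close>, each remaining monomial
  gains a factor of at most \<open>s ^ k\<close> when the polyradius shrinks from \<open>u\<close>
  to \<open>s *\<^sub>R u\<close>.\<close>

lemma ps_eval_remainder:
  fixes b :: "nat ^ 'i \<Rightarrow> real"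
  assumes b: "ps_bound u b C" and s: "0 \<le> s" "s \<le> 1" and u: "\<And>i. 0 \<le> u $ i"
    and h: "\<And>i. \<bar>h $ i\<bar> \<le> s * u $ i"
  shows "\<bar>ps_eval b h - (\<Sum>\<gamma>\<in>{\<gamma>. mi_length \<gamma> < k}. b \<gamma> * mi_power h \<gamma>)\<bar> \<le> s ^ k * C"
proof -
  let ?L = "{\<gamma> :: nat ^ 'i. mi_length \<gamma> < k}"
  have finL: "finite ?L"
  proof -
    have "?L \<subseteq> insert 0 (multi_indices k)"
      by (auto simp: multi_indices_def zero_less_iff_neq_zero simp del: neq0_conv)
    then show ?thesis using finite_multi_indices finite_subset by blast
  qed
  define b' where "b' \<gamma> = (if mi_length \<gamma> < k then 0 else b \<gamma>)" for \<gamma>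
  have hu: "\<bar>h $ i\<bar> \<le> u $ i" for i
    using h[of i] s u[of i] mult_left_le_one_le[of "u $ i" s] by linarith
  have "ps_bound (s *\<^sub>R u) b' (s ^ k * C)"
    unfolding ps_bound_def
  proof (intro allI impI)
    fix F :: "(nat ^ 'i) set" assume F: "finite F"
    have "\<bar>b' \<gamma>\<bar> * mi_power (s *\<^sub>R u) \<gamma> \<le> s ^ k * (\<bar>b \<gamma>\<bar> * mi_power u \<gamma>)" for \<gamma>
    proof (cases "mi_length \<gamma> < k")
      case True
      then show ?thesis using s u by (simp add: b'_def mi_power_nonneg)
    next
      case False
      then have "s ^ mi_length \<gamma> \<le> s ^ k" using s by (intro power_decreasing) auto
      then have "s ^ mi_length \<gamma> * (\<bar>b \<gamma>\<bar> * mi_power u \<gamma>) \<le> s ^ k * (\<bar>b \<gamma>\<bar> * mi_power u \<gamma>)"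
        using u by (intro mult_right_mono) (auto simp: mi_power_nonneg)
      then show ?thesis using False by (simp add: b'_def mi_power_scale mult_ac)
    qed
    then have "(\<Sum>\<gamma>\<in>F. \<bar>b' \<gamma>\<bar> * mi_power (s *\<^sub>R u) \<gamma>) \<le> s ^ k * (\<Sum>\<gamma>\<in>F. \<bar>b \<gamma>\<bar> * mi_power u \<gamma>)"
      unfolding sum_distrib_left by (intro sum_mono)
    also have "\<dots> \<le> s ^ k * C" using s ps_boundD[OF b F] by (intro mult_left_mono) auto
    finally show "(\<Sum>\<gamma>\<in>F. \<bar>b' \<gamma>\<bar> * mi_power (s *\<^sub>R u) \<gamma>) \<le> s ^ k * C" .
  qed
  note B = this
  have hs: "\<bar>h $ i\<bar> \<le> (s *\<^sub>R u) $ i" for i using h by simp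
  let ?P = "\<lambda>\<gamma>. (if mi_length \<gamma> < k then b \<gamma> else 0) * mi_power h \<gamma>"
  have "(?P has_sum (\<Sum>\<gamma>\<in>?L. b \<gamma> * mi_power h \<gamma>)) UNIV"
    by (rule has_sum_finite_neutralI[where B = ?L]) (auto simp: finL intro!: sum.cong)
  from has_sum_add[OF this ps_has_sum[OF B hs]]
  have "((\<lambda>\<gamma>. b \<gamma> * mi_power h \<gamma>) has_sum
      ((\<Sum>\<gamma>\<in>?L. b \<gamma> * mi_power h \<gamma>) + ps_eval b' h)) UNIV"
    by (rule has_sum_cong[THEN iffD1, rotated]) (auto simp: b'_def)
  from ps_evalI[OF this] abs_ps_eval_le[OF B hs] show ?thesis by simp
qed

text \<open>The remainder estimate with \<open>k = 2\<close> and \<open>s = norm h / m\<close>,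
  where \<open>m\<close> is the least radius, leaves an error quadratic in \<open>h\<close>.\<close>

lemma ps_has_derivative_0:
  fixes b :: "nat ^ 'i \<Rightarrow> real"
  assumes b: "ps_bound u b C" and u: "\<And>i. 0 < u $ i"
  shows "(ps_eval b has_derivative (\<lambda>h. \<Sum>i\<in>UNIV. b (axis i 1) * h $ i)) (at 0)"
proof -
  define m where "m = Min (range (\<lambda>i. u $ i))"
  have m: "0 < m" "\<And>i. m \<le> u $ i"
    unfolding m_def using u by (auto simp: Min_gr_iff)
  have C: "0 \<le> C" by (rule ps_bound_nonneg[OF b])
  have b0: "ps_eval b 0 = b 0"
    using ps_eval_remainder[OF b order_refl, of 0 1] u
    by (simp add: less_imp_le mi_length_eq_0[unfolded mi_length_def])
  have rem: "\<bar>ps_eval b h - b 0 - (\<Sum>i\<in>UNIV. b (axis i 1) * h $ i)\<bar> \<le> (C / m\<^sup>2) * norm h * norm h"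
    if h: "norm h \<le> m" for h
  proof -
    have "\<bar>h $ i\<bar> \<le> norm h / m * u $ i" for i
    proof -
      have "\<bar>h $ i\<bar> \<le> norm h / m * m" using component_le_norm_cart[of h i] m by simp
      also have "\<dots> \<le> norm h / m * u $ i" using m by (intro mult_left_mono) auto
      finally show ?thesis .
    qed
    from ps_eval_remainder[OF b _ _ _ this, of 2] h m u
    have "\<bar>ps_eval b h - (\<Sum>\<gamma>\<in>{\<gamma>. mi_length \<gamma> < 2}. b \<gamma> * mi_power h \<gamma>)\<bar> \<le> (norm h / m)\<^sup>2 * C"
      by (simp add: less_imp_le)
    moreover have "(\<Sum>\<gamma>\<in>{\<gamma>. mi_length \<gamma> < 2}. b \<gamma> * mi_power h \<gamma>) = b 0 + (\<Sum>i\<in>UNIV. b (axis i 1) * h $ i)"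
      unfolding mi_length_le_1
      by (subst sum.insert) (auto simp: axis_eq_0_iff sum.reindex inj_on_def axis_eq_axis)
    ultimately show ?thesis by (simp add: power2_eq_square field_simps)
  qed
  show ?thesis
  proof (rule has_derivativeI_sandwich[of m])
    show "bounded_linear (\<lambda>h. \<Sum>i\<in>UNIV. b (axis i 1) * h $ i)"
      by (intro bounded_linear_sum bounded_linear_const_mult bounded_linear_vec_nth)
    show "((\<lambda>h. (C / m\<^sup>2) * norm h) \<longlongrightarrow> 0) (at 0)"
      by (rule tendsto_eq_intros | simp)+
    fix y :: "real ^ 'i" assume "y \<in> UNIV" "y \<noteq> 0" "dist y 0 < m"
    then show "norm (ps_eval b y - ps_eval b 0 - (\<Sum>i\<in>UNIV. b (axis i 1) * (y - 0) $ i)) / norm (y - 0) \<le> (C / m\<^sup>2) * norm y"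
      using rem[of y] by (simp add: b0 divide_le_eq)
  qed (use m in auto)
qed

text \<open>Re-expansion about \<open>z\<close> on the remaining polyradius \<open>w - |z|\<close>
  reduces the claim to the derivative at 0.\<close>

theorem ps_has_derivative:
  fixes a :: "nat ^ 'i \<Rightarrow> real"
  assumes a: "ps_bound w a C" and z: "\<And>i. \<bar>z $ i\<bar> < w $ i"
  shows "(ps_eval a has_derivative (\<lambda>h. \<Sum>i\<in>UNIV. ps_eval (ps_deriv i a) z * h $ i)) (at z)"
proof -
  define u where "u = (\<chi> i. w $ i - \<bar>z $ i\<bar>)"
  have u: "\<And>i. 0 < u $ i" "\<And>i. \<bar>z $ i\<bar> + u $ i \<le> w $ i" using z by (auto simp: u_def)
  have S0: "(ps_eval (ps_shift z a) has_derivative (\<lambda>h. \<Sum>i\<in>UNIV. ps_shift z a (axis i 1) * h $ i)) (at (z - z))"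
    using ps_has_derivative_0[OF ps_shift_bound[OF a u(2)] u(1)] u(1) by (simp add: less_imp_le)
  have "((\<lambda>y. y - z) has_derivative (\<lambda>h. h)) (at z)"
    by (auto intro!: derivative_eq_intros)
  from has_derivative_compose[OF this S0]
  have *: "((\<lambda>y. ps_eval (ps_shift z a) (y - z)) has_derivative
      (\<lambda>h. \<Sum>i\<in>UNIV. ps_eval (ps_deriv i a) z * h $ i)) (at z)"
    unfolding ps_shift_axis .
  have "\<forall>\<^sub>F y in nhds z. \<forall>i. \<bar>(y - z) $ i\<bar> < u $ i"
  proof -
    have "((\<lambda>y. \<bar>(y - z) $ i\<bar>) \<longlongrightarrow> \<bar>(z - z) $ i\<bar>) (nhds z)" for i
      by (intro tendsto_intros) (simp add: filterlim_ident)
    then have "\<forall>\<^sub>F y in nhds z. \<bar>(y - z) $ i\<bar> < u $ i" for i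
      using u(1)[of i] by (intro order_tendstoD(2)[where y = "\<bar>(z - z) $ i\<bar>"]) auto
    then show ?thesis by (simp add: eventually_all_finite)
  qed
  then have "\<forall>\<^sub>F y in nhds z. ps_eval (ps_shift z a) (y - z) = ps_eval a y"
    by eventually_elim (use ps_eval_shift[OF a u(2)] in \<open>auto simp: less_imp_le\<close>)
  note ev = this
  show ?thesis
  proof (rule has_derivative_transform_eventually[OF *])
    show "\<forall>\<^sub>F y in at z. ps_eval (ps_shift z a) (y - z) = ps_eval a y"
      using ev by (simp add: eventually_at_filter eventually_mono)
    show "ps_eval (ps_shift z a) (z - z) = ps_eval a z"
      by (rule eventually_nhds_x_imp_x[OF ev])
  qed simp
qed

text \<open>Cauchy's estimate for the l1-norm: shrinking the radii by \<theta> pays for the factor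
  \<open>\<beta> $ i + 1\<close>, and the shift of the exponent by one costs a division by
  \<open>w $ i\<close>.\<close>

lemma ps_bound_deriv:
  assumes a: "ps_bound w a C" and \<theta>: "0 < \<theta>" "\<theta> < 1" and w: "\<And>i. 0 < w $ i"
  shows "ps_bound (\<theta> *\<^sub>R w) (ps_deriv i a) (C / ((1 - \<theta>) * w $ i))"
  unfolding ps_bound_def
proof (intro allI impI)
  fix F :: "(nat ^ 'a) set" assume F: "finite F"
  \<comment> \<open>Each of the \<open>m + 1\<close> copies of \<open>\<theta> ^ m\<close> is at
    most the corresponding term \<open>\<theta> ^ j\<close> of the geometric sum.\<close>
  have pow: "real (m + 1) * \<theta> ^ m \<le> 1 / (1 - \<theta>)" for m
  proof -
    have "real (m + 1) * \<theta> ^ m = (\<Sum>j\<le>m. \<theta> ^ m)" by simp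
    also have "\<dots> \<le> (\<Sum>j\<le>m. \<theta> ^ j)"
      using \<theta> by (intro sum_mono power_decreasing) auto
    also have "\<dots> = (1 - \<theta> ^ (m + 1)) / (1 - \<theta>)"
      using \<theta> by (simp add: sum_gp0)
    also have "\<dots> \<le> 1 / (1 - \<theta>)" using \<theta> by (intro divide_right_mono) auto
    finally show ?thesis .
  qed
  have "\<bar>ps_deriv i a \<beta>\<bar> * mi_power (\<theta> *\<^sub>R w) \<beta>
      \<le> (\<bar>a (\<beta> + axis i 1)\<bar> * mi_power w (\<beta> + axis i 1)) / ((1 - \<theta>) * w $ i)" for \<beta>
  proof -
    have le: "\<beta> $ i \<le> mi_length \<beta>" unfolding mi_length_def by (rule member_le_sum) auto
    have "\<bar>ps_deriv i a \<beta>\<bar> * mi_power (\<theta> *\<^sub>R w) \<beta>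
        = (real (\<beta> $ i + 1) * \<theta> ^ mi_length \<beta>) * (\<bar>a (\<beta> + axis i 1)\<bar> * mi_power w \<beta>)"
      by (simp add: ps_deriv_def mi_power_scale abs_mult mult_ac)
    also have "\<dots> \<le> (1 / (1 - \<theta>)) * (\<bar>a (\<beta> + axis i 1)\<bar> * mi_power w \<beta>)"
    proof (rule mult_right_mono)
      have "real (\<beta> $ i + 1) * \<theta> ^ mi_length \<beta> \<le> real (mi_length \<beta> + 1) * \<theta> ^ mi_length \<beta>"
        using le \<theta> by (intro mult_right_mono) auto
      with pow[of "mi_length \<beta>"] show "real (\<beta> $ i + 1) * \<theta> ^ mi_length \<beta> \<le> 1 / (1 - \<theta>)" by linarith
      show "0 \<le> \<bar>a (\<beta> + axis i 1)\<bar> * mi_power w \<beta>"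
        using mi_power_pos[of w \<beta>] w by simp
    qed
    also have "\<dots> = (\<bar>a (\<beta> + axis i 1)\<bar> * mi_power w (\<beta> + axis i 1)) / ((1 - \<theta>) * w $ i)"
      using w[of i] by (simp add: mi_power_add)
    finally show ?thesis .
  qed
  then have "(\<Sum>\<beta>\<in>F. \<bar>ps_deriv i a \<beta>\<bar> * mi_power (\<theta> *\<^sub>R w) \<beta>)
      \<le> (\<Sum>\<beta>\<in>F. \<bar>a (\<beta> + axis i 1)\<bar> * mi_power w (\<beta> + axis i 1)) / ((1 - \<theta>) * w $ i)"
    unfolding sum_divide_distrib by (intro sum_mono)
  also have "(\<Sum>\<beta>\<in>F. \<bar>a (\<beta> + axis i 1)\<bar> * mi_power w (\<beta> + axis i 1))
      = (\<Sum>\<beta>\<in>(\<lambda>\<beta>. \<beta> + axis i 1) ` F. \<bar>a \<beta>\<bar> * mi_power w \<beta>)"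
    by (subst sum.reindex) (auto intro: inj_onI)
  also have "\<dots> / ((1 - \<theta>) * w $ i) \<le> C / ((1 - \<theta>) * w $ i)"
    using F \<theta> w[of i] by (intro divide_right_mono ps_boundD[OF a]) auto
  finally show "(\<Sum>\<beta>\<in>F. \<bar>ps_deriv i a \<beta>\<bar> * mi_power (\<theta> *\<^sub>R w) \<beta>) \<le> C / ((1 - \<theta>) * w $ i)"
    by simp
qed

section \<open>Series in two blocks of variables, with exponents joined along a sum type\<close>

definition vjoin :: "'a ^ 'm \<Rightarrow> 'a ^ 'n \<Rightarrow> 'a ^ ('m + 'n)" where
  "vjoin x y = (\<chi> k. case k of Inl i \<Rightarrow> x $ i | Inr j \<Rightarrow> y $ j)"

lemma vjoin_nth [simp]: "vjoin x y $ Inl i = x $ i" "vjoin x y $ Inr j = y $ j"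
  by (simp_all add: vjoin_def)

lemma bij_vjoin: "bij_betw (\<lambda>p. vjoin (fst p) (snd p)) UNIV UNIV"
  by (rule bij_betwI[of _ _ _ "\<lambda>z. (\<chi> i. z $ Inl i, \<chi> j. z $ Inr j)"])
     (auto simp: vec_eq_iff vjoin_def split: sum.split)

lemma vjoin_eq_iff [simp]: "vjoin x y = vjoin x' y' \<longleftrightarrow> x = x' \<and> y = y'"
  using bij_vjoin by (auto simp: bij_betw_def inj_on_def)

lemma prod_UNIV_sum_type: "(\<Prod>k\<in>UNIV. f k) = (\<Prod>i\<in>UNIV. f (Inl i)) * (\<Prod>j\<in>UNIV. f (Inr j))"
  for f :: "'a::finite + 'b::finite \<Rightarrow> 'c::comm_monoid_mult"
  by (simp add: UNIV_Plus_UNIV[symmetric] prod.Plus del: UNIV_Plus_UNIV)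

lemma mi_power_vjoin: "mi_power (vjoin t x) (vjoin \<alpha> \<beta>) = mi_power t \<alpha> * mi_power x \<beta>"
  by (simp add: mi_power_def prod_UNIV_sum_type)

text \<open>A fixed \<alpha> selects part of the weighted sum, and all selected terms share the
  factor \<open>mi_power v \<alpha>\<close>.\<close>

lemma ps_bound_section:
  assumes a: "ps_bound (vjoin v w) a C" and v: "\<And>i. 0 < v $ i"
  shows "ps_bound w (\<lambda>\<beta>. a (vjoin \<alpha> \<beta>)) (C / mi_power v \<alpha>)"
  unfolding ps_bound_def
proof (intro allI impI)
  fix F :: "(nat ^ 'b) set" assume F: "finite F"
  have "(\<Sum>\<beta>\<in>F. \<bar>a (vjoin \<alpha> \<beta>)\<bar> * mi_power w \<beta>) * mi_power v \<alpha>
      = (\<Sum>\<gamma>\<in>vjoin \<alpha> ` F. \<bar>a \<gamma>\<bar> * mi_power (vjoin v w) \<gamma>)"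
    by (subst sum.reindex) (auto simp: mi_power_vjoin sum_distrib_left mult_ac inj_on_def)
  also have "\<dots> \<le> C" using F by (intro ps_boundD[OF a]) auto
  finally show "(\<Sum>\<beta>\<in>F. \<bar>a (vjoin \<alpha> \<beta>)\<bar> * mi_power w \<beta>) \<le> C / mi_power v \<alpha>"
    using mi_power_pos[of v \<alpha>] v by (simp add: pos_le_divide_eq)
qed

lemma ps_has_sum_split:
  assumes a: "ps_bound (vjoin v w) a C" and v: "\<And>i. 0 < v $ i"
    and t: "\<And>i. \<bar>t $ i\<bar> \<le> v $ i" and x: "\<And>j. \<bar>x $ j\<bar> \<le> w $ j"
  shows "((\<lambda>\<alpha>. mi_power t \<alpha> * ps_eval (\<lambda>\<beta>. a (vjoin \<alpha> \<beta>)) x) has_sum ps_eval a (vjoin t x)) UNIV"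
proof -
  have z: "\<bar>vjoin t x $ k\<bar> \<le> vjoin v w $ k" for k
    using t x by (cases k) auto
  let ?f = "\<lambda>p. a (vjoin (fst p) (snd p)) * mi_power (vjoin t x) (vjoin (fst p) (snd p))"
  have s: "(?f has_sum ps_eval a (vjoin t x)) UNIV"
    using ps_has_sum[OF a z] has_sum_reindex_bij_betw[OF bij_vjoin,
      of "\<lambda>\<gamma>. a \<gamma> * mi_power (vjoin t x) \<gamma>"] by simp
  show ?thesis
  proof (rule has_sum_SigmaD[where f = ?f and A = UNIV and B = "\<lambda>_. UNIV"])
    show "(?f has_sum ps_eval a (vjoin t x)) (UNIV \<times> UNIV)" using s by simp
    show "((\<lambda>\<beta>. ?f (\<alpha>, \<beta>)) has_sum mi_power t \<alpha> * ps_eval (\<lambda>\<beta>. a (vjoin \<alpha> \<beta>)) x) UNIV" for \<alpha>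
      using has_sum_cmult_right[OF ps_has_sum[OF ps_bound_section[OF a v] x], of "mi_power t \<alpha>" \<alpha>]
      by (simp add: mi_power_vjoin mult_ac)
  qed
qed

section \<open>Smooth functions and analytic germs\<close>

text \<open>On an open set the derivative at a point depends only on the values in the set; this is
  what allows representatives to be exchanged.\<close>

lemma Ck_on_cong:
  assumes "open S" "\<And>x. x \<in> S \<Longrightarrow> f x = g x" "Ck_on k f S"
  shows "Ck_on k g S"
  using assms(2,3)
proof (induction k arbitrary: f g)
  case 0
  then show ?case using continuous_on_cong[of S S f g] by simp
next
  case (Suc k)
  have d: "(f has_derivative D) (at x) \<longleftrightarrow> (g has_derivative D) (at x)" if "x \<in> S" for x D
    using has_derivative_transform_within_open[OF _ \<open>open S\<close> that, of f D UNIV g]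
      has_derivative_transform_within_open[OF _ \<open>open S\<close> that, of g D UNIV f] Suc.prems(1)
    by metis
  have "frechet_derivative f (at x) = frechet_derivative g (at x)" if "x \<in> S" for x
    unfolding frechet_derivative_def d[OF that] ..
  then have eq: "frechet_derivative f (at x) v = frechet_derivative g (at x) v" if "x \<in> S" for x v
    using that by metis
  have "Ck_on k (\<lambda>x. frechet_derivative f (at x) v) S" for v
    using Suc.prems(2) by (simp only: Ck_on.simps)
  then have "Ck_on k (\<lambda>x. frechet_derivative g (at x) v) S" for v
    using eq by (rule Suc.IH[rotated])
  moreover have "g differentiable (at x)" if "x \<in> S" for x
    using Suc.prems(2) that d[OF that] unfolding differentiable_def Ck_on.simps by blast
  ultimately show ?case by simp
qed

lemma Ck_on_SucI:
  assumes "open S" "\<And>x. x \<in> S \<Longrightarrow> (f has_derivative f' x) (at x)" "\<And>v. Ck_on k (\<lambda>x. f' x v) S"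
  shows "Ck_on (Suc k) f S"
proof -
  have "frechet_derivative f (at x) = f' x" if "x \<in> S" for x
    using frechet_derivative_at[OF assms(2)[OF that]] by simp
  then have "Ck_on k (\<lambda>x. frechet_derivative f (at x) v) S" for v
    using assms(3)[of v] by (intro Ck_on_cong[OF assms(1) _ assms(3)]) auto
  then show ?thesis using assms(2) by (auto simp: differentiable_def)
qed

lemma Ck_on_SucD:
  assumes "Ck_on (Suc k) f S"
  shows "\<And>x. x \<in> S \<Longrightarrow> (f has_derivative frechet_derivative f (at x)) (at x)"
    "\<And>v. Ck_on k (\<lambda>x. frechet_derivative f (at x) v) S"
  using assms by (auto simp: frechet_derivative_works)

lemma Ck_on_Suc_imp: "Ck_on (Suc k) f S \<Longrightarrow> Ck_on k f S"
proof (induction k arbitrary: f)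
  case 0
  then show ?case
    by (auto intro!: differentiable_imp_continuous_on differentiable_at_imp_differentiable_on)
next
  case (Suc k)
  from Suc.prems have "\<forall>x\<in>S. f differentiable (at x)"
    "\<And>v. Ck_on (Suc k) (\<lambda>x. frechet_derivative f (at x) v) S"
    by (simp_all only: Ck_on.simps) auto
  with Suc.IH show ?case by simp
qed

lemma Ck_on_subset: "Ck_on k f S \<Longrightarrow> T \<subseteq> S \<Longrightarrow> Ck_on k f T"
  by (induction k arbitrary: f) (auto intro: continuous_on_subset)

lemma Ck_on_const: "open S \<Longrightarrow> Ck_on k (\<lambda>x. c) S"
proof (induction k arbitrary: c)
  case (Suc k)
  then show ?case by (intro Ck_on_SucI[where f' = "\<lambda>x v. 0"]) auto
qed auto

lemma Ck_on_add:
  assumes "open S"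
  shows "Ck_on k f S \<Longrightarrow> Ck_on k g S \<Longrightarrow> Ck_on k (\<lambda>x. f x + g x) S"
proof (induction k arbitrary: f g)
  case 0
  then show ?case by (auto intro: continuous_intros)
next
  case (Suc k)
  show ?case
    by (rule Ck_on_SucI[OF assms has_derivative_add[OF Ck_on_SucD(1)[OF Suc.prems(1)] Ck_on_SucD(1)[OF Suc.prems(2)]]])
       (use Suc Ck_on_SucD(2) in blast)+
qed

lemma Ck_on_sum:
  assumes "open S" "\<And>i. i \<in> I \<Longrightarrow> Ck_on k (f i) S"
  shows "Ck_on k (\<lambda>x. \<Sum>i\<in>I. f i x) S"
  using assms(2) by (induction I rule: infinite_finite_induct) (auto intro: Ck_on_add Ck_on_const assms(1))

lemma Ck_on_scaleR:
  fixes f :: "'a::euclidean_space \<Rightarrow> real"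
  assumes "open S"
  shows "Ck_on k f S \<Longrightarrow> Ck_on k g S \<Longrightarrow> Ck_on k (\<lambda>x. f x *\<^sub>R g x) S"
proof (induction k arbitrary: f g)
  case 0
  then show ?case by (auto intro: continuous_intros)
next
  case (Suc k)
  show ?case
    by (rule Ck_on_SucI[OF assms has_derivative_scaleR[OF Ck_on_SucD(1)[OF Suc.prems(1)] Ck_on_SucD(1)[OF Suc.prems(2)]]])
       (use Suc.prems in \<open>auto intro!: Ck_on_add[OF assms] Suc.IH intro: Ck_on_SucD(2) Ck_on_Suc_imp simp del: Ck_on.simps\<close>)
qed

lemma Ck_on_bounded_linear:
  assumes "open S" "bounded_linear L"
  shows "Ck_on k f S \<Longrightarrow> Ck_on k (\<lambda>x. L (f x)) S"
proof (induction k arbitrary: f)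
  case 0
  then show ?case using assms(2) by (auto intro: bounded_linear.continuous_on)
next
  case (Suc k)
  show ?case
    by (rule Ck_on_SucI[OF assms(1) bounded_linear.has_derivative[OF assms(2) Ck_on_SucD(1)[OF Suc.prems]]])
       (use Suc.IH Ck_on_SucD(2)[OF Suc.prems] in blast)+
qed

lemma smooth_on_cong:
  "open S \<Longrightarrow> (\<And>x. x \<in> S \<Longrightarrow> f x = g x) \<Longrightarrow> smooth_on f S \<Longrightarrow> smooth_on g S"
  unfolding smooth_on_def using Ck_on_cong by blast

lemma smooth_on_subset: "smooth_on f S \<Longrightarrow> T \<subseteq> S \<Longrightarrow> smooth_on f T"
  unfolding smooth_on_def using Ck_on_subset by blast

lemma smooth_on_const: "open S \<Longrightarrow> smooth_on (\<lambda>x. c) S"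
  by (simp add: smooth_on_def Ck_on_const)

lemma smooth_on_add: "open S \<Longrightarrow> smooth_on f S \<Longrightarrow> smooth_on g S \<Longrightarrow> smooth_on (\<lambda>x. f x + g x) S"
  by (simp add: smooth_on_def Ck_on_add)

lemma smooth_on_sum:
  "open S \<Longrightarrow> (\<And>i. i \<in> I \<Longrightarrow> smooth_on (f i) S) \<Longrightarrow> smooth_on (\<lambda>x. \<Sum>i\<in>I. f i x) S"
  by (simp add: smooth_on_def Ck_on_sum)

lemma smooth_on_scaleR:
  fixes f :: "'a::euclidean_space \<Rightarrow> real"
  shows "open S \<Longrightarrow> smooth_on f S \<Longrightarrow> smooth_on g S \<Longrightarrow> smooth_on (\<lambda>x. f x *\<^sub>R g x) S"
  by (simp add: smooth_on_def Ck_on_scaleR)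

lemma smooth_on_mult:
  fixes f g :: "'a::euclidean_space \<Rightarrow> real"
  shows "open S \<Longrightarrow> smooth_on f S \<Longrightarrow> smooth_on g S \<Longrightarrow> smooth_on (\<lambda>x. f x * g x) S"
  using smooth_on_scaleR[of S f g] by simp

lemma smooth_on_minus:
  assumes "open S" "smooth_on f S"
  shows "smooth_on (\<lambda>x. - f x) S"
  using smooth_on_scaleR[OF assms(1) smooth_on_const[OF assms(1), of "-1"] assms(2)] by simp

lemma smooth_on_diff:
  "open S \<Longrightarrow> smooth_on f S \<Longrightarrow> smooth_on g S \<Longrightarrow> smooth_on (\<lambda>x. f x - g x) S"
  using smooth_on_add[of S f "\<lambda>x. - g x"] by (simp add: smooth_on_minus)

lemma smooth_on_vec_nth: "open S \<Longrightarrow> smooth_on f S \<Longrightarrow> smooth_on (\<lambda>x. f x $ i) S"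
  by (simp add: smooth_on_def Ck_on_bounded_linear[OF _ bounded_linear_vec_nth])

lemma smooth_on_has_derivative:
  "smooth_on f S \<Longrightarrow> x \<in> S \<Longrightarrow> (f has_derivative frechet_derivative f (at x)) (at x)"
  unfolding smooth_on_def using Ck_on_SucD(1)[of 0] by blast

lemma smooth_on_frechet: "smooth_on f S \<Longrightarrow> smooth_on (\<lambda>x. frechet_derivative f (at x) v) S"
  unfolding smooth_on_def using Ck_on_SucD(2) by blast

lemma bounded_linear_vec_expand:
  assumes "bounded_linear (D :: real ^ 'n \<Rightarrow> _)"
  shows "D v = (\<Sum>i\<in>UNIV. v $ i *\<^sub>R D (axis i 1))"
proof -
  interpret bounded_linear D by fact
  have "v = (\<Sum>i\<in>UNIV. v $ i *\<^sub>R axis i 1)"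
    by (simp add: vec_eq_iff axis_def if_distrib cong: if_cong)
  then have "D v = D (\<Sum>i\<in>UNIV. v $ i *\<^sub>R axis i 1)" by (rule arg_cong)
  then show ?thesis by (simp add: sum scaleR)
qed

text \<open>Smoothness provides derivatives in fixed directions only; a varying direction is
  expanded in the standard basis.\<close>

lemma smooth_on_frechet_field:
  fixes f :: "real ^ 'n \<Rightarrow> 'b::real_normed_vector"
  assumes "open S" "smooth_on f S" "smooth_on v S"
  shows "smooth_on (\<lambda>x. frechet_derivative f (at x) (v x)) S"
proof (rule smooth_on_cong[OF assms(1)])
  show "smooth_on (\<lambda>x. \<Sum>i\<in>UNIV. v x $ i *\<^sub>R frechet_derivative f (at x) (axis i 1)) S"
    using assms by (intro smooth_on_sum smooth_on_scaleR smooth_on_vec_nth smooth_on_frechet)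
  show "(\<Sum>i\<in>UNIV. v x $ i *\<^sub>R frechet_derivative f (at x) (axis i 1)) = frechet_derivative f (at x) (v x)"
    if "x \<in> S" for x
    by (rule bounded_linear_vec_expand[OF has_derivative_bounded_linear[OF
      smooth_on_has_derivative[OF assms(2) that]], symmetric])
qed

lemma smooth_on_lie_bracket:
  fixes X Y :: "real ^ 'n \<Rightarrow> real ^ 'n"
  assumes "open S" "smooth_on X S" "smooth_on Y S"
  shows "smooth_on (lie_bracket X Y) S"
  unfolding lie_bracket_def using assms by (intro smooth_on_diff smooth_on_frechet_field)

text \<open>A single expansion about 0 with a norm bound. Expansions at nearby points are recovered
  from it by \<open>ps_shift\<close>.\<close>

definition analytic_germ :: "(real ^ 'i \<Rightarrow> real) \<Rightarrow> bool" where
  "analytic_germ f \<longleftrightarrow>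
    (\<exists>a r C. 0 < r \<and> ps_bound (vec r) a C \<and> (\<forall>x\<in>ball 0 r. f x = ps_eval a x))"

text \<open>One coefficient family and one constant serve all smaller radii, so several germs can be
  brought to a common ball.\<close>

lemma analytic_germ_ex:
  assumes "analytic_germ f"
  shows "\<exists>a R C. 0 < R \<and> (\<forall>r. 0 < r \<longrightarrow> r \<le> R \<longrightarrow>
    ps_bound (vec r) a C \<and> (\<forall>x\<in>ball 0 r. f x = ps_eval a x))"
proof -
  from assms obtain a R C where R: "0 < R" "ps_bound (vec R) a C" "\<forall>x\<in>ball 0 R. f x = ps_eval a x"
    unfolding analytic_germ_def by blast
  show ?thesis
    by (intro exI[of _ a] exI[of _ R] exI[of _ C]) (use R in \<open>auto intro: ps_bound_mono\<close>)
qed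

lemma analytic_germ2_ex:
  assumes "analytic_germ f" "analytic_germ g"
  shows "\<exists>a b r C D. 0 < r \<and> ps_bound (vec r) a C \<and> ps_bound (vec r) b D \<and>
    (\<forall>x\<in>ball 0 r. f x = ps_eval a x \<and> g x = ps_eval b x)"
proof -
  obtain a R C where a: "0 < R" "\<forall>r. 0 < r \<longrightarrow> r \<le> R \<longrightarrow>
    ps_bound (vec r) a C \<and> (\<forall>x\<in>ball 0 r. f x = ps_eval a x)"
    using analytic_germ_ex[OF assms(1)] by blast
  obtain b S D where b: "0 < S" "\<forall>r. 0 < r \<longrightarrow> r \<le> S \<longrightarrow>
    ps_bound (vec r) b D \<and> (\<forall>x\<in>ball 0 r. g x = ps_eval b x)"
    using analytic_germ_ex[OF assms(2)] by blast
  let ?r = "min R S"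
  have "0 < ?r" "?r \<le> R" "?r \<le> S" using a(1) b(1) by auto
  with a(2) b(2) show ?thesis by blast
qed

lemma in_ball_components: "x \<in> ball 0 r \<Longrightarrow> \<bar>x $ i\<bar> < vec r $ i" for x :: "real ^ 'i"
  using component_le_norm_cart[of x i] by (simp add: le_less_trans)

lemma in_ball_components': "x \<in> ball 0 r \<Longrightarrow> \<bar>x $ i\<bar> \<le> vec r $ i" for x :: "real ^ 'i"
  using in_ball_components less_imp_le by blast

lemma analytic_germ_cong:
  assumes "\<forall>\<^sub>F x in nhds 0. f x = g x" "analytic_germ f"
  shows "analytic_germ g"
proof -
  from assms(1) obtain \<epsilon> where \<epsilon>: "\<epsilon> > 0" "\<forall>x\<in>ball 0 \<epsilon>. f x = g x"
    unfolding eventually_nhds_metric by (auto simp: dist_commute)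
  obtain a R C where R: "0 < R" "\<forall>r. 0 < r \<longrightarrow> r \<le> R \<longrightarrow>
    ps_bound (vec r) a C \<and> (\<forall>x\<in>ball 0 r. f x = ps_eval a x)"
    using analytic_germ_ex[OF assms(2)] by blast
  show ?thesis unfolding analytic_germ_def
    using R(1) R(2)[rule_format, of "min R \<epsilon>"] \<epsilon>
    by (intro exI[of _ a] exI[of _ "min R \<epsilon>"] exI[of _ C]) auto
qed

lemma analytic_germ_add:
  assumes "analytic_germ f" "analytic_germ g"
  shows "analytic_germ (\<lambda>x. f x + g x)"
proof -
  obtain a b r C D where r: "0 < r" and A: "ps_bound (vec r) a C" "ps_bound (vec r) b D"
    and eq: "\<forall>x\<in>ball 0 r. f x = ps_eval a x \<and> g x = ps_eval b x"
    using analytic_germ2_ex[OF assms] by blast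
  show ?thesis unfolding analytic_germ_def
  proof (intro exI conjI ballI)
    show "ps_bound (vec r) (\<lambda>\<beta>. a \<beta> + b \<beta>) (C + D)"
      by (rule ps_bound_add[OF A]) (use r in simp)
    show "f x + g x = ps_eval (\<lambda>\<beta>. a \<beta> + b \<beta>) x" if "x \<in> ball 0 r" for x
      using eq that ps_eval_add[OF A in_ball_components'[OF that]] by simp
  qed (rule r)
qed

lemma analytic_germ_mult:
  assumes "analytic_germ f" "analytic_germ g"
  shows "analytic_germ (\<lambda>x. f x * g x)"
proof -
  obtain a b r C D where r: "0 < r" and A: "ps_bound (vec r) a C" "ps_bound (vec r) b D"
    and eq: "\<forall>x\<in>ball 0 r. f x = ps_eval a x \<and> g x = ps_eval b x"
    using analytic_germ2_ex[OF assms] by blast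
  show ?thesis unfolding analytic_germ_def
  proof (intro exI conjI ballI)
    show "ps_bound (vec r) (ps_mult a b) (C * D)"
      by (rule ps_bound_mult[OF A]) (use r in simp)
    show "f x * g x = ps_eval (ps_mult a b) x" if "x \<in> ball 0 r" for x
      using eq that ps_eval_mult[OF A in_ball_components'[OF that]] by simp
  qed (rule r)
qed

definition ps_const :: "real \<Rightarrow> nat ^ 'i \<Rightarrow> real" where
  "ps_const c \<beta> = (if \<beta> = 0 then c else 0)"

lemma ps_bound_finite_support:
  assumes "finite B" "\<And>\<beta>. \<beta> \<notin> B \<Longrightarrow> a \<beta> = 0" "\<And>i. 0 \<le> w $ i"
  shows "ps_bound w a (\<Sum>\<beta>\<in>B. \<bar>a \<beta>\<bar> * mi_power w \<beta>)"
  unfolding ps_bound_def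
proof (intro allI impI)
  fix F :: "(nat ^ 'a) set" assume "finite F"
  have "(\<Sum>\<beta>\<in>F. \<bar>a \<beta>\<bar> * mi_power w \<beta>) = (\<Sum>\<beta>\<in>F \<inter> B. \<bar>a \<beta>\<bar> * mi_power w \<beta>)"
    using assms(2) \<open>finite F\<close> by (intro sum.mono_neutral_right) auto
  also have "\<dots> \<le> (\<Sum>\<beta>\<in>B. \<bar>a \<beta>\<bar> * mi_power w \<beta>)"
    using assms(1,3) by (intro sum_mono2) (auto intro!: mult_nonneg_nonneg mi_power_nonneg)
  finally show "(\<Sum>\<beta>\<in>F. \<bar>a \<beta>\<bar> * mi_power w \<beta>) \<le> (\<Sum>\<beta>\<in>B. \<bar>a \<beta>\<bar> * mi_power w \<beta>)" .
qed

lemma ps_eval_finite_support: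
  assumes "finite B" "\<And>\<beta>. \<beta> \<notin> B \<Longrightarrow> a \<beta> = 0"
  shows "ps_eval a z = (\<Sum>\<beta>\<in>B. a \<beta> * mi_power z \<beta>)"
  by (rule ps_evalI, rule has_sum_finite_neutralI[where B = B]) (use assms in auto)

lemma analytic_germ_finite_support:
  assumes "finite B" "\<And>\<beta>. \<beta> \<notin> B \<Longrightarrow> a \<beta> = 0"
  shows "analytic_germ (ps_eval a)"
  unfolding analytic_germ_def
proof (intro exI conjI ballI)
  show "ps_bound (vec 1) a (\<Sum>\<beta>\<in>B. \<bar>a \<beta>\<bar> * mi_power (vec 1) \<beta>)"
    by (rule ps_bound_finite_support[OF assms]) auto
qed auto

lemma analytic_germ_const: "analytic_germ (\<lambda>x :: real ^ 'i. c)"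
proof -
  have "ps_eval (ps_const c) = (\<lambda>x :: real ^ 'i. c)"
    by (rule ext, subst ps_eval_finite_support[of "{0}"]) (auto simp: ps_const_def)
  moreover have "analytic_germ (ps_eval (ps_const c) :: real ^ 'i \<Rightarrow> real)"
    by (rule analytic_germ_finite_support[of "{0}"]) (auto simp: ps_const_def)
  ultimately show ?thesis by metis
qed

lemma analytic_germ_sum:
  "(\<And>i. i \<in> I \<Longrightarrow> analytic_germ (f i)) \<Longrightarrow> analytic_germ (\<lambda>x. \<Sum>i\<in>I. f i x)"
  by (induction I rule: infinite_finite_induct) (auto intro: analytic_germ_add analytic_germ_const)

lemma analytic_germ_diff: "analytic_germ f \<Longrightarrow> analytic_germ g \<Longrightarrow> analytic_germ (\<lambda>x. f x - g x)"
  using analytic_germ_add[of f, OF _ analytic_germ_mult[OF analytic_germ_const[of "-1"], of g]] by simp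

lemma vec_scaleR: "c *\<^sub>R vec r = (vec (c * r) :: real ^ 'i)"
  by (simp add: vec_eq_iff)

lemma ps_bound_deriv_vec:
  assumes "ps_bound (vec R) a C" "0 < r" "r < R"
  shows "ps_bound (vec r) (ps_deriv i a) (C / (R - r))"
proof -
  have "(1 - r / R) * vec R $ i = R - r" using assms by (simp add: field_simps)
  with ps_bound_deriv[of "vec R" a C "r / R" i] assms show ?thesis by (simp add: vec_scaleR)
qed

lemma analytic_germ_derivative:
  assumes "analytic_germ f"
  obtains f' where "\<And>i. analytic_germ (f' i)"
    "\<forall>\<^sub>F x in nhds 0. (f has_derivative (\<lambda>h. \<Sum>i\<in>UNIV. f' i x * h $ i)) (at x)"
proof -
  from assms obtain a R C where R: "0 < R" "ps_bound (vec R) a C" "\<forall>x\<in>ball 0 R. f x = ps_eval a x"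
    unfolding analytic_germ_def by blast
  show ?thesis
  proof (rule that[of "\<lambda>i. ps_eval (ps_deriv i a)"])
    show "analytic_germ (ps_eval (ps_deriv i a))" for i
      unfolding analytic_germ_def
      using R(1) ps_bound_deriv_vec[OF R(2), of "R / 2" i]
      by (intro exI[of _ "ps_deriv i a"] exI[of _ "R / 2"] exI[of _ "C / (R - R / 2)"]) auto
    have "(f has_derivative (\<lambda>h. \<Sum>i\<in>UNIV. ps_eval (ps_deriv i a) x * h $ i)) (at x)"
      if "x \<in> ball 0 R" for x
      by (rule has_derivative_transform_within_open[OF ps_has_derivative[OF R(2) in_ball_components[OF that]] open_ball that])
         (use R in auto)
    moreover have "\<forall>\<^sub>F x in nhds 0. x \<in> ball (0 :: real ^ 'a) R"
      using R(1) by (intro eventually_nhds_in_open) auto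
    ultimately show "\<forall>\<^sub>F x in nhds 0. (f has_derivative (\<lambda>h. \<Sum>i\<in>UNIV. ps_eval (ps_deriv i a) x * h $ i)) (at x)"
      by (simp add: eventually_mono)
  qed
qed

text \<open>Bounds are assumed at every radius below \<open>R\<close>, with a constant depending on
  the radius. Differentiation preserves this assumption although it costs radius, so the induction
  on \<open>k\<close> stays on the same ball.\<close>

lemma Ck_on_ps_eval:
  assumes "\<And>r. 0 < r \<Longrightarrow> r < R \<Longrightarrow> \<exists>C. ps_bound (vec r) a C"
  shows "Ck_on k (ps_eval a) (ball 0 R)"
  using assms
proof (induction k arbitrary: a)
  have der: "(ps_eval a has_derivative (\<lambda>h. \<Sum>i\<in>UNIV. ps_eval (ps_deriv i a) x * h $ i)) (at x)"
    if b: "\<And>r. 0 < r \<Longrightarrow> r < R \<Longrightarrow> \<exists>C. ps_bound (vec r) a C" and x: "x \<in> ball 0 R" for a :: "nat ^ 'a \<Rightarrow> real" and x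
  proof -
    from x obtain r where r: "norm x < r" "r < R" by (auto dest: dense)
    then have "0 < r" using norm_ge_zero[of x] by linarith
    with b r obtain C where "ps_bound (vec r) a C" by blast
    then show ?thesis by (rule ps_has_derivative) (use in_ball_components[of x r] r in auto)
  qed
  case 0
  have "\<And>x. x \<in> ball 0 R \<Longrightarrow> isCont (ps_eval a) x"
    using der[OF 0] has_derivative_continuous by blast
  then show ?case by (simp add: continuous_at_imp_continuous_on)
  case (Suc k)
  show ?case
  proof (rule Ck_on_SucI[OF open_ball der[OF Suc.prems]])
    fix v :: "real ^ 'a"
    let ?b = "\<lambda>\<beta>. \<Sum>i\<in>UNIV. v $ i * ps_deriv i a \<beta>"
    have b: "\<exists>C. \<forall>i. ps_bound (vec r) (\<lambda>\<beta>. v $ i * ps_deriv i a \<beta>) (C i)" if r: "0 < r" "r < R" for r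
    proof -
      \<comment> \<open>The derivative is bounded at \<open>r\<close> through a bound of
        \<open>a\<close> at a slightly larger radius.\<close>
      from r obtain r' where r': "r < r'" "r' < R" by (auto dest: dense)
      then have "0 < r'" using r by linarith
      with r' Suc.prems obtain C where C: "ps_bound (vec r') a C" by blast
      show ?thesis
        using ps_bound_cmult[OF ps_bound_deriv_vec[OF C r(1) r'(1)]]
        by (intro exI[of _ "\<lambda>i. \<bar>v $ i\<bar> * (C / (r' - r))"]) blast
    qed
    have "Ck_on k (ps_eval ?b) (ball 0 R)"
    proof (rule Suc.IH)
      fix r assume "0 < r" "r < R"
      from b[OF this] obtain C where "\<And>i. ps_bound (vec r) (\<lambda>\<beta>. v $ i * ps_deriv i a \<beta>) (C i)" by blast
      then have "ps_bound (vec r) ?b (\<Sum>i\<in>UNIV. C i)"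
        using \<open>0 < r\<close> by (intro ps_bound_sum) auto
      then show "\<exists>C. ps_bound (vec r) ?b C" ..
    qed
    moreover have "ps_eval ?b x = (\<Sum>i\<in>UNIV. ps_eval (ps_deriv i a) x * v $ i)" if x: "x \<in> ball 0 R" for x
    proof -
      from x obtain r where r: "norm x < r" "r < R" by (auto dest: dense)
      then have r0: "0 < r" using norm_ge_zero[of x] by linarith
      from b[OF this r(2)] obtain C where C: "\<And>i. ps_bound (vec r) (\<lambda>\<beta>. v $ i * ps_deriv i a \<beta>) (C i)" by blast
      have xr: "\<And>i. \<bar>x $ i\<bar> \<le> vec r $ i" using in_ball_components'[of x r] r by simp
      have "ps_eval (\<lambda>\<beta>. v $ i * ps_deriv i a \<beta>) x = v $ i * ps_eval (ps_deriv i a) x" for i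
        unfolding ps_eval_def by (simp add: mult.assoc infsum_cmult_right')
      with ps_eval_sum[OF finite C xr] show ?thesis by (simp add: mult.commute)
    qed
    ultimately show "Ck_on k (\<lambda>x. \<Sum>i\<in>UNIV. ps_eval (ps_deriv i a) x * v $ i) (ball 0 R)"
      by (rule Ck_on_cong[OF open_ball, rotated])
  qed
qed

lemma analytic_germ_smooth:
  assumes "analytic_germ f"
  shows "\<exists>r>0. smooth_on f (ball 0 r)"
proof -
  from assms obtain a R C where R: "0 < R" "ps_bound (vec R) a C" "\<forall>x\<in>ball 0 R. f x = ps_eval a x"
    unfolding analytic_germ_def by blast
  have "smooth_on (ps_eval a) (ball 0 R)"
    unfolding smooth_on_def using R(2)
    by (intro allI Ck_on_ps_eval exI[of _ C]) (auto intro: ps_bound_mono)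
  then have "smooth_on f (ball 0 R)"
    by (rule smooth_on_cong[OF open_ball, rotated]) (use R in auto)
  with R show ?thesis by blast
qed

section \<open>Transfer between analyticity on Euclidean spaces and coordinate germs\<close>

lemma has_sum_vecI:
  fixes f :: "'a \<Rightarrow> 'b::real_normed_vector ^ 'n"
  assumes "\<And>j. ((\<lambda>x. f x $ j) has_sum s $ j) A"
  shows "(f has_sum s) A"
  using assms unfolding has_sum_def by (intro vec_tendstoI) (simp add: sum_component)

text \<open>Analyticity is defined with multi-indices on \<open>Basis\<close>, the series calculus
  uses vectors over a finite index type. The dictionary is set up once and serves both
  \<open>real ^ 'k\<close> and pairs \<open>(t, x)\<close>.\<close>

locale coordinates =
  fixes e :: "'k::finite \<Rightarrow> 'a::euclidean_space" and emb :: "real ^ 'k \<Rightarrow> 'a"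
  assumes bij_e: "bij_betw e UNIV Basis"
    and emb: "\<And>z. emb z = (\<Sum>k\<in>UNIV. z $ k *\<^sub>R e k)"
begin

definition crd :: "'a \<Rightarrow> real ^ 'k" where
  "crd y = (\<chi> k. y \<bullet> e k)"

lemma crd_emb [simp]: "crd (emb z) = z"
proof -
  have "e k \<in> Basis" for k using bij_e by (auto simp: bij_betw_def)
  then have e: "z $ l * (e l \<bullet> e k) = (if l = k then z $ k else 0)" for k l
    using bij_e by (auto simp: bij_betw_def inj_on_def inner_Basis simp del: inner_same_Basis)
  show ?thesis
    by (simp add: crd_def emb vec_eq_iff inner_sum_left e)
qed

lemma emb_crd [simp]: "emb (crd y) = y"
proof -
  have "emb (crd y) = (\<Sum>b\<in>Basis. (y \<bullet> b) *\<^sub>R b)"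
    unfolding emb crd_def by (simp add: sum.reindex_bij_betw[OF bij_e, of "\<lambda>b. (y \<bullet> b) *\<^sub>R b", symmetric])
  then show ?thesis by (simp add: euclidean_representation)
qed

lemma norm_crd [simp]: "norm (crd y) = norm y"
proof -
  have "(\<Sum>k\<in>UNIV. (y \<bullet> e k)\<^sup>2) = (\<Sum>b\<in>Basis. (y \<bullet> b)\<^sup>2)"
    by (rule sum.reindex_bij_betw[OF bij_e])
  then show ?thesis
    by (simp add: norm_vec_def L2_set_def crd_def) (simp add: norm_eq_sqrt_inner euclidean_inner[of y y] power2_eq_square)
qed

lemma norm_emb [simp]: "norm (emb z) = norm z"
  using norm_crd[of "emb z"] by simp

lemma crd_diff: "crd (x - y) = crd x - crd y"
  by (simp add: crd_def vec_eq_iff inner_diff_left)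

definition ext_mi :: "nat ^ 'k \<Rightarrow> 'a \<Rightarrow> nat" where
  "ext_mi \<beta> = restrict (\<lambda>b. \<beta> $ the_inv e b) Basis"

lemma inj_e: "inj e" using bij_e by (simp add: bij_betw_def)

lemma bij_ext_mi: "bij_betw ext_mi UNIV (Basis \<rightarrow>\<^sub>E UNIV)"
proof (rule bij_betwI[where g = "\<lambda>\<beta>. \<chi> k. \<beta> (e k)"])
  have e: "e k \<in> Basis" for k using bij_e by (auto simp: bij_betw_def)
  show "(\<chi> k. ext_mi \<beta> (e k)) = \<beta>" for \<beta>
    by (simp add: ext_mi_def e vec_eq_iff the_inv_f_f[OF inj_e])
  have inv: "e (the_inv e b) = b" if "b \<in> Basis" for b
    using that bij_e by (intro f_the_inv_into_f) (auto simp: bij_betw_def)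
  show "ext_mi (\<chi> k. \<beta> (e k)) = \<beta>" if "\<beta> \<in> Basis \<rightarrow>\<^sub>E UNIV" for \<beta>
  proof
    show "ext_mi (\<chi> k. \<beta> (e k)) b = \<beta> b" for b
      using PiE_arb[OF that, of b] inv[of b] by (cases "b \<in> Basis") (simp_all add: ext_mi_def)
  qed
qed (auto simp: ext_mi_def)

lemma prod_ext_mi: "(\<Prod>b\<in>Basis. (y \<bullet> b) ^ ext_mi \<beta> b) = mi_power (crd y) \<beta>"
  unfolding mi_power_def prod.reindex_bij_betw[OF bij_e, of "\<lambda>b. (y \<bullet> b) ^ ext_mi \<beta> b", symmetric]
  using bij_e by (intro prod.cong) (auto simp: crd_def ext_mi_def bij_betw_def the_inv_f_f)

lemma real_analytic_at_iff:
  "real_analytic_at f p \<longleftrightarrow> (\<exists>r>0. \<exists>c. \<forall>y\<in>ball p r.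
     ((\<lambda>\<beta>. mi_power (crd (y - p)) \<beta> *\<^sub>R c \<beta>) has_sum f y) UNIV)"
proof -
  have eq: "((\<lambda>\<beta>. (\<Prod>b\<in>Basis. ((y - p) \<bullet> b) ^ \<beta> b) *\<^sub>R c \<beta>) has_sum s) (Basis \<rightarrow>\<^sub>E UNIV)
    \<longleftrightarrow> ((\<lambda>\<beta>. mi_power (crd (y - p)) \<beta> *\<^sub>R c (ext_mi \<beta>)) has_sum s) UNIV" for y c and s :: 'b
    using has_sum_reindex_bij_betw[OF bij_ext_mi,
      of "\<lambda>\<beta>. (\<Prod>b\<in>Basis. ((y - p) \<bullet> b) ^ \<beta> b) *\<^sub>R c \<beta>" s]
    by (simp add: prod_ext_mi)
  have ex: "\<exists>c'. c = (\<lambda>\<beta>. c' (ext_mi \<beta>))" for c :: "nat ^ 'k \<Rightarrow> 'b"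
    using bij_ext_mi by (intro exI[of _ "\<lambda>b. c (the_inv ext_mi b)"]) (auto simp: bij_betw_def the_inv_f_f)
  show ?thesis
    unfolding real_analytic_at_def eq
  proof (intro ex_cong1 conj_cong refl iffI)
    fix r assume "\<exists>c. \<forall>y\<in>ball p r. ((\<lambda>\<beta>. mi_power (crd (y - p)) \<beta> *\<^sub>R c \<beta>) has_sum f y) UNIV"
    then obtain c where "\<forall>y\<in>ball p r. ((\<lambda>\<beta>. mi_power (crd (y - p)) \<beta> *\<^sub>R c \<beta>) has_sum f y) UNIV" ..
    moreover obtain c' where "c = (\<lambda>\<beta>. c' (ext_mi \<beta>))" using ex by blast
    ultimately show "\<exists>c. \<forall>y\<in>ball p r. ((\<lambda>\<beta>. mi_power (crd (y - p)) \<beta> *\<^sub>R c (ext_mi \<beta>)) has_sum f y) UNIV"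
      by (intro exI[of _ c']) simp
  next
    fix r assume "\<exists>c. \<forall>y\<in>ball p r. ((\<lambda>\<beta>. mi_power (crd (y - p)) \<beta> *\<^sub>R c (ext_mi \<beta>)) has_sum f y) UNIV"
    then obtain c where "\<forall>y\<in>ball p r. ((\<lambda>\<beta>. mi_power (crd (y - p)) \<beta> *\<^sub>R c (ext_mi \<beta>)) has_sum f y) UNIV" ..
    then show "\<exists>c. \<forall>y\<in>ball p r. ((\<lambda>\<beta>. mi_power (crd (y - p)) \<beta> *\<^sub>R c \<beta>) has_sum f y) UNIV"
      by (intro exI[of _ "\<lambda>\<beta>. c (ext_mi \<beta>)"])
  qed
qed

text \<open>From left to right, convergence at one point with positive coordinates suffices:
  unordered convergence of a real series is absolute and hence a norm bound. From right to left, the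
  expansion about 0 is re-expanded at every \<open>q\<close> in the ball of half the radius.\<close>

theorem real_analytic_near_iff:
  fixes f :: "'a \<Rightarrow> real ^ 'n"
  shows "real_analytic_near f 0 \<longleftrightarrow> (\<forall>j. analytic_germ (\<lambda>z. f (emb z) $ j))"
proof
  assume "real_analytic_near f 0"
  then have "real_analytic_at f 0" by (auto simp: real_analytic_near_def)
  then obtain r c where r: "r > 0"
    and c: "\<And>y. y \<in> ball 0 r \<Longrightarrow> ((\<lambda>\<beta>. mi_power (crd y) \<beta> *\<^sub>R c \<beta>) has_sum f y) UNIV"
    unfolding real_analytic_at_iff by (metis diff_zero)
  have c': "((\<lambda>\<beta>. c \<beta> $ j * mi_power z \<beta>) has_sum f (emb z) $ j) UNIV" if "z \<in> ball 0 r" for z j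
    using has_sum_bounded_linear[OF bounded_linear_vec_nth[of j] c[of "emb z"]] that
    by (simp add: o_def mult.commute)
  \<comment> \<open>This choice puts the corner \<open>vec \<rho>\<close> of the polydisc strictly
    inside the ball of convergence.\<close>
  define \<rho> where "\<rho> = r / (norm (vec 1 :: real ^ 'k) + 1)"
  have np: "0 < norm (vec 1 :: real ^ 'k) + 1" using norm_ge_zero[of "vec 1 :: real ^ 'k"] by linarith
  have \<rho>: "0 < \<rho>" using r np by (simp add: \<rho>_def)
  have \<rho>': "vec \<rho> \<in> ball (0 :: real ^ 'k) r"
  proof -
    have "norm (vec \<rho> :: real ^ 'k) = \<rho> * norm (vec 1 :: real ^ 'k)"
      using norm_scaleR[of \<rho> "vec 1 :: real ^ 'k"] \<rho> unfolding vec_scaleR by simp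
    also have "\<dots> < \<rho> * (norm (vec 1 :: real ^ 'k) + 1)" using \<rho> by simp
    also have "\<dots> = r" using np by (simp add: \<rho>_def)
    finally show ?thesis by simp
  qed
  show "\<forall>j. analytic_germ (\<lambda>z. f (emb z) $ j)"
  proof
    fix j
    have "(\<lambda>\<beta>. c \<beta> $ j * mi_power (vec \<rho>) \<beta>) summable_on UNIV"
      using c'[OF \<rho>'] has_sum_imp_summable by blast
    then have s: "(\<lambda>\<beta>. norm (c \<beta> $ j * mi_power (vec \<rho>) \<beta>)) summable_on UNIV"
      by (rule summable_on_iff_abs_summable_on_real[THEN iffD1])
    have bd: "ps_bound (vec \<rho>) (\<lambda>\<beta>. c \<beta> $ j) (\<Sum>\<^sub>\<infinity>\<beta>. \<bar>c \<beta> $ j * mi_power (vec \<rho>) \<beta>\<bar>)"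
      unfolding ps_bound_def using sum_abs_le_infsum_abs[OF s] \<rho>
      by (auto simp: abs_mult mi_power_nonneg)
    let ?r = "min \<rho> r"
    show "analytic_germ (\<lambda>z. f (emb z) $ j)"
      unfolding analytic_germ_def
    proof (intro exI conjI ballI)
      show "0 < ?r" using \<rho> r by simp
      show "ps_bound (vec ?r) (\<lambda>\<beta>. c \<beta> $ j) (\<Sum>\<^sub>\<infinity>\<beta>. \<bar>c \<beta> $ j * mi_power (vec \<rho>) \<beta>\<bar>)"
        using \<rho> r by (intro ps_bound_mono[OF bd]) auto
      show "f (emb x) $ j = ps_eval (\<lambda>\<beta>. c \<beta> $ j) x" if "x \<in> ball 0 ?r" for x
        using that by (intro ps_evalI[OF c', symmetric]) auto
    qed
  qed
next
  assume *: "\<forall>j. analytic_germ (\<lambda>z. f (emb z) $ j)"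
  then have "\<exists>a R C. \<forall>j. 0 < R j \<and> ps_bound (vec (R j)) (a j) (C j) \<and>
      (\<forall>x\<in>ball 0 (R j). f (emb x) $ j = ps_eval (a j) x)"
    unfolding analytic_germ_def by metis
  then obtain a R C where a: "\<And>j. 0 < R j" "\<And>j. ps_bound (vec (R j)) (a j) (C j)"
      "\<And>j x. x \<in> ball 0 (R j) \<Longrightarrow> f (emb x) $ j = ps_eval (a j) x"
    by blast
  define r where "r = Min (range R)"
  have r: "0 < r" "\<And>j. r \<le> R j" using a(1) by (auto simp: r_def Min_gr_iff)
  have b: "ps_bound (vec r) (a j) (C j)" for j
    using r by (intro ps_bound_mono[OF a(2)]) auto
  show "real_analytic_near f 0"
    unfolding real_analytic_near_def
  proof (intro exI[of _ "ball 0 (r / 2)"] conjI ballI)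
    fix q :: 'a assume q: "q \<in> ball 0 (r / 2)"
    have qu: "\<bar>crd q $ i\<bar> + vec (r / 2) $ i \<le> vec r $ i" for i
      using in_ball_components'[of "crd q" "r / 2" i] q by simp
    show "real_analytic_at f q"
      unfolding real_analytic_at_iff
    proof (intro exI[of _ "r / 2"] exI[of _ "\<lambda>\<beta>. \<chi> j. ps_shift (crd q) (a j) \<beta>"] conjI ballI)
      fix y assume y: "y \<in> ball q (r / 2)"
      have yq: "\<bar>crd (y - q) $ i\<bar> \<le> vec (r / 2) $ i" for i
        using in_ball_components'[of "crd (y - q)" "r / 2" i] y
        by (simp add: dist_norm norm_minus_commute)
      have "norm y < r"
        using norm_triangle_ineq[of q "y - q"] q y by (simp add: dist_norm norm_minus_commute)
      then have "f y $ j = ps_eval (a j) (crd q + crd (y - q))" for j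
        using a(3)[of "crd y" j] r(2)[of j] by (simp add: crd_diff)
      then have "f y $ j = ps_eval (ps_shift (crd q) (a j)) (crd (y - q))" for j
        using ps_eval_shift[OF b qu yq] by simp
      then have "((\<lambda>\<beta>. ps_shift (crd q) (a j) \<beta> * mi_power (crd (y - q)) \<beta>) has_sum f y $ j) UNIV" for j
        using ps_has_sum[OF ps_shift_bound[OF b qu] yq] r by simp
      then show "((\<lambda>\<beta>. mi_power (crd (y - q)) \<beta> *\<^sub>R (\<chi> j. ps_shift (crd q) (a j) \<beta>)) has_sum f y) UNIV"
        by (intro has_sum_vecI) (simp add: mult.commute)
    qed (use r in auto)
  qed (use r in auto)
qed

end

lemma coordinates_vec: "coordinates (\<lambda>k. axis k 1 :: real ^ 'k) (\<lambda>z. z)"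
proof
  show "bij_betw (\<lambda>k. axis k 1 :: real ^ 'k) UNIV Basis"
    by (auto simp: bij_betw_def inj_on_def axis_eq_axis Basis_vec_def)
  show "z = (\<Sum>k\<in>UNIV. z $ k *\<^sub>R axis k 1)" for z :: "real ^ 'k"
    by (simp add: vec_eq_iff axis_def if_distrib cong: if_cong)
qed

definition pair_axis :: "'m + 'n \<Rightarrow> (real ^ 'm) \<times> (real ^ 'n)" where
  "pair_axis = case_sum (\<lambda>i. (axis i 1, 0)) (\<lambda>j. (0, axis j 1))"

lemma coordinates_pair: "coordinates (pair_axis :: 'm + 'n \<Rightarrow> (real ^ 'm) \<times> (real ^ 'n))
  (\<lambda>z. (\<chi> i. z $ Inl i, \<chi> j. z $ Inr j))"
proof
  show "bij_betw (pair_axis :: 'm + 'n \<Rightarrow> (real ^ 'm) \<times> (real ^ 'n)) UNIV Basis"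
    unfolding bij_betw_def
  proof
    show "inj (pair_axis :: 'm + 'n \<Rightarrow> (real ^ 'm) \<times> (real ^ 'n))"
      by (rule injI) (auto simp: pair_axis_def axis_eq_axis axis_eq_0_iff split: sum.splits)
    show "range (pair_axis :: 'm + 'n \<Rightarrow> _) = Basis"
      by (auto simp: pair_axis_def Basis_prod_def Basis_vec_def UNIV_sum image_Un image_image split: sum.splits)
  qed
  show "(\<chi> i. z $ Inl i, \<chi> j. z $ Inr j) = (\<Sum>k\<in>UNIV. z $ k *\<^sub>R
      (pair_axis k :: (real ^ 'm) \<times> (real ^ 'n)))" for z :: "real ^ ('m + 'n)"
    by (simp add: UNIV_Plus_UNIV[symmetric] sum.Plus pair_axis_def del: UNIV_Plus_UNIV)
       (simp add: prod_eq_iff fst_sum snd_sum vec_eq_iff axis_def if_distrib cong: if_cong)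
qed

lemma real_analytic_near_vec_iff:
  "real_analytic_near (f :: real ^ 'k \<Rightarrow> real ^ 'n) 0 \<longleftrightarrow> (\<forall>j. analytic_germ (\<lambda>x. f x $ j))"
  by (rule coordinates.real_analytic_near_iff[OF coordinates_vec])

lemma real_analytic_near_pair_iff:
  "real_analytic_near (f :: (real ^ 'm) \<times> (real ^ 'k) \<Rightarrow> real ^ 'n) (0, 0) \<longleftrightarrow>
    (\<forall>j. analytic_germ (\<lambda>z. f (\<chi> i. z $ Inl i, \<chi> j. z $ Inr j) $ j))"
  using coordinates.real_analytic_near_iff[OF coordinates_pair, of f] by (simp add: zero_prod_def)

section \<open>Integral curves\<close>

definition integral_curve :: "('a::real_normed_vector \<Rightarrow> 'a) \<Rightarrow> 'a set \<Rightarrow> (real \<Rightarrow> 'a) \<Rightarrow> bool" where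
  "integral_curve Y W \<phi> \<longleftrightarrow>
    (\<forall>s\<in>{0..1}. \<phi> s \<in> W \<and> (\<phi> has_vector_derivative Y (\<phi> s)) (at s within {0..1}))"

lemma integral_curveD:
  assumes "integral_curve Y W \<phi>" "s \<in> {0..1}"
  shows "\<phi> s \<in> W" "(\<phi> has_vector_derivative Y (\<phi> s)) (at s within {0..1})"
  using assms by (auto simp: integral_curve_def)

lemma integral_curve_mono: "integral_curve Y W \<phi> \<Longrightarrow> W \<subseteq> W' \<Longrightarrow> integral_curve Y W' \<phi>"
  by (auto simp: integral_curve_def)

text \<open>The bound is required only at times strictly between 0 and \<open>s\<close>, so that it
  applies up to a first exit time.\<close>

lemma vector_derivative_bound_01:
  fixes f :: "real \<Rightarrow> 'a::real_normed_vector"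
  assumes d: "\<And>s. s \<in> {0..1} \<Longrightarrow> (f has_vector_derivative f' s) (at s within {0..1})"
    and s: "0 \<le> s" "s \<le> 1"
    and b: "\<And>u. 0 < u \<Longrightarrow> u < s \<Longrightarrow> norm (f' u) \<le> M"
  shows "norm (f s - f 0) \<le> M * s"
proof (cases "s = 0")
  case False
  have c: "continuous_on {0..1} f"
    unfolding continuous_on_eq_continuous_within
    using d has_vector_derivative_continuous by blast
  have "norm (f s - f 0) \<le> M * s - M * 0"
  proof (rule differentiable_bound_general[where f' = f' and \<phi> = "\<lambda>u. M * u" and \<phi>' = "\<lambda>_. M"])
    show "continuous_on {0..s} f" using c by (rule continuous_on_subset) (use s in auto)
    show "(f has_vector_derivative f' u) (at u)" if "0 < u" "u < s" for u
      using d[of u] that s at_within_Icc_at[of 0 u 1] by simp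
    show "((\<lambda>u. M * u) has_vector_derivative M) (at u)" for u
      by (auto intro!: derivative_eq_intros simp: has_real_derivative_iff_has_vector_derivative[symmetric])
  qed (use s False b in \<open>auto intro!: continuous_intros\<close>)
  then show ?thesis by simp
qed simp

text \<open>Until the first exit time the speed is at most \<open>r / 4\<close>. A curve that starts
  within \<open>r / 2\<close> is then still within \<open>3 * r / 4\<close> at that time, which
  contradicts the exit. The surrounding set \<open>W\<close> may be arbitrary.\<close>

lemma integral_curve_trapped:
  fixes \<phi> :: "real \<Rightarrow> 'a::euclidean_space"
  assumes \<phi>: "integral_curve Y W \<phi>" and bd: "\<And>y. y \<in> cball 0 r \<Longrightarrow> norm (Y y) \<le> M"
    and M: "M \<le> r / 4" and x: "norm (\<phi> 0) \<le> r / 2" and r: "0 < r" and s: "s \<in> {0..1}"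
  shows "\<phi> s \<in> ball 0 r" "norm (\<phi> s - \<phi> 0) \<le> M"
proof -
  note d = integral_curveD(2)[OF \<phi>]
  have M0: "0 \<le> M" using order_trans[OF norm_ge_zero bd[of 0]] r by simp
  have c: "continuous_on {0..1} \<phi>"
    unfolding continuous_on_eq_continuous_within
    using d has_vector_derivative_continuous by blast
  have ball: "\<phi> s \<in> ball 0 r" if "s \<in> {0..1}" for s
  proof (rule ccontr)
    let ?S = "{u \<in> {0..1}. r \<le> norm (\<phi> u)}"
    assume "\<phi> s \<notin> ball 0 r"
    then have ne: "?S \<noteq> {}" using that by auto
    have "closed ?S"
      by (intro continuous_on_closed_Collect_le continuous_intros c)
    moreover have "bounded ?S" by (rule bounded_subset[of "{0..1}"]) auto
    ultimately have "compact ?S" by (simp add: compact_eq_bounded_closed)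
    then obtain s0 where s0: "s0 \<in> ?S" "\<And>u. u \<in> ?S \<Longrightarrow> s0 \<le> u"
      using compact_attains_inf[OF _ ne] by blast
    have "norm (\<phi> s0 - \<phi> 0) \<le> M * s0"
    proof (rule vector_derivative_bound_01[OF d])
      show "norm (Y (\<phi> u)) \<le> M" if "0 < u" "u < s0" for u
        using s0(2)[of u] that s0(1) by (intro bd) force
    qed (use s0 in auto)
    also have "\<dots> \<le> M * 1" using s0 M0 by (intro mult_left_mono) auto
    finally have "norm (\<phi> s0) \<le> r / 2 + r / 4"
      using norm_triangle_ineq[of "\<phi> 0" "\<phi> s0 - \<phi> 0"] x M by simp
    with s0(1) r show False by auto
  qed
  then show "\<phi> s \<in> ball 0 r" using s .
  have "norm (\<phi> s - \<phi> 0) \<le> M * s"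
  proof (rule vector_derivative_bound_01[OF d])
    show "norm (Y (\<phi> u)) \<le> M" if "0 < u" "u < s" for u
      using ball[of u] that s by (intro bd) auto
  qed (use s in auto)
  also have "\<dots> \<le> M * 1" using s M0 by (intro mult_left_mono) auto
  finally show "norm (\<phi> s - \<phi> 0) \<le> M" by simp
qed

lemma integral_curve_continuous: "integral_curve Y W \<phi> \<Longrightarrow> continuous_on {0..1} \<phi>"
  unfolding continuous_on_eq_continuous_within
  using integral_curveD(2) has_vector_derivative_continuous by blast

text \<open>Over unit time a Lipschitz constant \<open>1/2\<close> replaces Gronwall's inequality.\<close>

lemma integral_curves_close:
  fixes \<phi> \<psi> :: "real \<Rightarrow> 'a::euclidean_space"
  assumes \<phi>: "integral_curve Y S \<phi>" and \<psi>: "integral_curve Z S \<psi>" and eq: "\<phi> 0 = \<psi> 0"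
    and lip: "\<And>y z. y \<in> S \<Longrightarrow> z \<in> S \<Longrightarrow> norm (Z y - Z z) \<le> norm (y - z) / 2"
    and close: "\<And>y. y \<in> S \<Longrightarrow> norm (Y y - Z y) \<le> \<delta>"
    and s: "s \<in> {0..1}"
  shows "norm (\<phi> s - \<psi> s) \<le> 2 * \<delta>"
proof -
  let ?d = "\<lambda>s. norm (\<phi> s - \<psi> s)"
  \<comment> \<open>At a time \<open>m\<close> of maximal distance the mean value inequality gives
    \<open>?d m \<le> ?d m / 2 + \<delta>\<close>; half of the maximum is absorbed into the
    left-hand side.\<close>
  have "continuous_on {0..1} ?d"
    using integral_curve_continuous[OF \<phi>] integral_curve_continuous[OF \<psi>] by (intro continuous_intros)
  then obtain m where m: "m \<in> {0..1}" "\<And>u. u \<in> {0..1} \<Longrightarrow> ?d u \<le> ?d m"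
    using continuous_attains_sup[of "{0..1::real}" ?d] by auto
  have \<delta>: "0 \<le> \<delta>"
    using close[OF integral_curveD(1)[OF \<phi> s]] norm_ge_zero order_trans by blast
  have "norm ((\<phi> m - \<psi> m) - (\<phi> 0 - \<psi> 0)) \<le> (?d m / 2 + \<delta>) * m"
  proof (rule vector_derivative_bound_01[where f = "\<lambda>s. \<phi> s - \<psi> s" and f' = "\<lambda>s. Y (\<phi> s) - Z (\<psi> s)"])
    show "((\<lambda>s. \<phi> s - \<psi> s) has_vector_derivative Y (\<phi> s) - Z (\<psi> s)) (at s within {0..1})"
      if "s \<in> {0..1}" for s
      using that by (intro has_vector_derivative_diff integral_curveD(2)[OF \<phi>] integral_curveD(2)[OF \<psi>])
    fix u assume u: "0 < u" "u < m"
    then have u01: "u \<in> {0..1}" using m by auto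
    have "norm (Y (\<phi> u) - Z (\<psi> u)) \<le> norm (Y (\<phi> u) - Z (\<phi> u)) + norm (Z (\<phi> u) - Z (\<psi> u))"
      by (metis add_diff_eq diff_add_cancel norm_triangle_ineq)
    also have "\<dots> \<le> \<delta> + ?d u / 2"
      using integral_curveD(1)[OF \<phi> u01] integral_curveD(1)[OF \<psi> u01] by (intro add_mono close lip)
    finally show "norm (Y (\<phi> u) - Z (\<psi> u)) \<le> ?d m / 2 + \<delta>" using m(2)[OF u01] by simp
  qed (use m in auto)
  also have "\<dots> \<le> (?d m / 2 + \<delta>) * 1" using m(1) \<delta> by (intro mult_left_mono) auto
  finally have "?d m \<le> 2 * \<delta>" using eq by simp
  with m(2)[OF s] show ?thesis by linarith
qed

text \<open>Picard iteration in the space of bounded continuous functions on the line. The field is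
  first extended by closest-point projection to the ball, which preserves both bounds; the resulting
  curve is trapped in the ball, where the extension agrees with \<open>Y\<close>.\<close>

lemma integral_curve_exists:
  fixes Y :: "'a::euclidean_space \<Rightarrow> 'a"
  assumes r: "0 < r" and x: "norm x \<le> r / 2"
    and bd: "\<And>y. y \<in> cball 0 r \<Longrightarrow> norm (Y y) \<le> r / 4"
    and lip: "\<And>y z. y \<in> cball 0 r \<Longrightarrow> z \<in> cball 0 r \<Longrightarrow> norm (Y y - Y z) \<le> norm (y - z) / 2"
  shows "\<exists>\<phi>. \<phi> 0 = x \<and> integral_curve Y (ball 0 r) \<phi>"
proof -
  define P where "P = closest_point (cball (0::'a) r)"
  have P: "P y \<in> cball 0 r" "norm (P y - P z) \<le> norm (y - z)" for y z
    using r closest_point_in_set[of "cball (0::'a) r"] closest_point_lipschitz[of "cball (0::'a) r" y z]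
    by (auto simp: P_def dist_norm)
  define Z where "Z y = Y (P y)" for y
  have Zb: "norm (Z y) \<le> r / 4" for y using bd[OF P(1)] by (simp add: Z_def)
  have Zl: "norm (Z y - Z z) \<le> norm (y - z) / 2" for y z
    using lip[OF P(1) P(1), of y z] P(2)[of y z] by (simp add: Z_def)
  have Zc: "continuous_on UNIV Z"
    by (rule lipschitz_on_continuous_on[of "1/2"], rule lipschitz_onI) (use Zl in \<open>auto simp: dist_norm\<close>)
  \<comment> \<open>Time is clamped to the unit interval so that the iterates are bounded on the
    whole line. Lipschitz constant 1/2 over unit time makes the iteration a contraction.\<close>
  define c where "c s = max 0 (min 1 s)" for s :: real
  have c: "c s \<in> {0..1}" "continuous_on UNIV c" for s
    unfolding c_def[abs_def] by (auto intro!: continuous_intros)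
  define I where "I g s = x + integral {0..c s} (\<lambda>u. Z (apply_bcontfun g u))" for g :: "real \<Rightarrow>\<^sub>C 'a" and s
  have cont: "continuous_on T (\<lambda>u. Z (apply_bcontfun g u))" for g T
    by (rule continuous_on_compose2[OF Zc]) auto
  have I_mem: "I g \<in> bcontfun" for g
  proof (rule bcontfun_normI)
    have "continuous_on {0..1} (\<lambda>s. integral {0..s} (\<lambda>u. Z (apply_bcontfun g u)))"
      by (intro indefinite_integral_continuous_1 integrable_continuous_real cont)
    then show "continuous_on UNIV (I g)"
      unfolding I_def[abs_def]
      by (intro continuous_intros continuous_on_compose2[OF _ c(2)]) (use c(1) in auto)
    show "norm (I g s) \<le> norm x + r / 4" for s
    proof -
      have "norm (integral {0..c s} (\<lambda>u. Z (apply_bcontfun g u))) \<le> r / 4 * (c s - 0)"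
        using c(1)[of s] by (intro integral_bound cont Zb) auto
      also have "\<dots> \<le> r / 4 * 1" using c(1)[of s] r by (intro mult_left_mono) auto
      finally show ?thesis unfolding I_def
        using norm_triangle_ineq[of x "integral {0..c s} (\<lambda>u. Z (apply_bcontfun g u))"] by simp
    qed
  qed
  define \<Phi> where "\<Phi> g = Bcontfun (I g)" for g
  have \<Phi>: "apply_bcontfun (\<Phi> g) = I g" for g
    using I_mem by (simp add: \<Phi>_def Bcontfun_inverse)
  have "\<exists>!g. \<Phi> g = g"
  proof (rule banach_fix_type[of "1/2"])
    show "\<forall>g h. dist (\<Phi> g) (\<Phi> h) \<le> 1 / 2 * dist g h"
    proof (intro allI dist_bound)
      fix g h :: "real \<Rightarrow>\<^sub>C 'a" and s
      have "norm (I g s - I h s) = norm (integral {0..c s} (\<lambda>u. Z (apply_bcontfun g u) - Z (apply_bcontfun h u)))"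
        unfolding I_def by (subst integral_diff) (auto intro!: integrable_continuous_real cont)
      also have "\<dots> \<le> dist g h / 2 * (c s - 0)"
      proof (rule integral_bound)
        show "norm (Z (apply_bcontfun g u) - Z (apply_bcontfun h u)) \<le> dist g h / 2" for u
          using Zl[of "apply_bcontfun g u" "apply_bcontfun h u"] dist_bounded[of g u h] by (simp add: dist_norm)
      qed (use c(1)[of s] in \<open>auto intro!: continuous_intros cont\<close>)
      also have "\<dots> \<le> dist g h / 2 * 1" using c(1)[of s] by (intro mult_left_mono) auto
      finally show "dist (apply_bcontfun (\<Phi> g) s) (apply_bcontfun (\<Phi> h) s) \<le> 1 / 2 * dist g h"
        by (simp add: \<Phi> dist_norm)
    qed
  qed auto
  then obtain g where "\<Phi> g = g" by blast
  define \<phi> where "\<phi> = apply_bcontfun g"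
  have \<phi>: "\<phi> s = x + integral {0..c s} (\<lambda>u. Z (\<phi> u))" for s
  proof -
    have "\<phi> = I g" using \<Phi>[of g] unfolding \<open>\<Phi> g = g\<close> \<phi>_def .
    then show ?thesis unfolding I_def \<phi>_def by (rule fun_cong)
  qed
  have \<phi>0: "\<phi> 0 = x" by (subst \<phi>) (simp add: c_def)
  have curve: "integral_curve Z UNIV \<phi>"
    unfolding integral_curve_def
  proof (intro ballI conjI UNIV_I)
    fix s :: real assume s: "s \<in> {0..1}"
    have "((\<lambda>s. x + integral {0..s} (\<lambda>u. Z (\<phi> u))) has_vector_derivative Z (\<phi> s)) (at s within {0..1})"
      using integral_has_vector_derivative[OF cont[of "{0..1}" g, folded \<phi>_def] s]
      by (auto intro!: derivative_eq_intros)
    then show "(\<phi> has_vector_derivative Z (\<phi> s)) (at s within {0..1})"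
      by (rule has_vector_derivative_transform[OF s, rotated])
         (subst \<phi>, simp add: c_def)
  qed
  have "\<phi> s \<in> ball 0 r" if "s \<in> {0..1}" for s
    by (rule integral_curve_trapped(1)[OF curve Zb order_refl _ r that]) (use x in \<open>simp add: \<phi>0\<close>)
  moreover have "Z y = Y y" if "y \<in> ball 0 r" for y
    using that by (simp add: Z_def P_def closest_point_self)
  ultimately have "integral_curve Y (ball 0 r) \<phi>"
    using curve by (simp add: integral_curve_def)
  with \<phi>0 show ?thesis by blast
qed

text \<open>The definite description requires uniqueness among all curves in \<open>W\<close>: each
  of them is trapped in the ball, where two curves of the same field from the same point coincide
  (distance bound with \<delta> = 0).\<close>

lemma exp_flow_eq:
  fixes Y :: "'a::euclidean_space \<Rightarrow> 'a"
  assumes r: "0 < r" and W: "ball 0 r \<subseteq> W"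
    and bd: "\<And>y. y \<in> cball 0 r \<Longrightarrow> norm (Y y) \<le> r / 4"
    and lip: "\<And>y z. y \<in> cball 0 r \<Longrightarrow> z \<in> cball 0 r \<Longrightarrow> norm (Y y - Y z) \<le> norm (y - z) / 2"
    and \<phi>: "integral_curve Y (ball 0 r) \<phi>" "norm (\<phi> 0) \<le> r / 2"
  shows "exp_flow W Y (\<phi> 0) = \<phi> 1"
  unfolding exp_flow_def
proof (rule the_equality)
  have "integral_curve Y W \<phi>" using integral_curve_mono[OF \<phi>(1) W] .
  then show "\<exists>\<phi>'. \<phi>' 0 = \<phi> 0 \<and> \<phi>' 1 = \<phi> 1 \<and>
      (\<forall>s\<in>{0..1}. \<phi>' s \<in> W \<and> (\<phi>' has_vector_derivative Y (\<phi>' s)) (at s within {0..1}))"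
    by (intro exI[of _ \<phi>]) (simp add: integral_curve_def)
next
  fix y assume "\<exists>\<psi>. \<psi> 0 = \<phi> 0 \<and> \<psi> 1 = y \<and>
      (\<forall>s\<in>{0..1}. \<psi> s \<in> W \<and> (\<psi> has_vector_derivative Y (\<psi> s)) (at s within {0..1}))"
  then obtain \<psi> where \<psi>: "\<psi> 0 = \<phi> 0" "\<psi> 1 = y" "integral_curve Y W \<psi>"
    unfolding integral_curve_def by blast
  have "\<psi> s \<in> ball 0 r" if "s \<in> {0..1}" for s
    by (rule integral_curve_trapped(1)[OF \<psi>(3) bd order_refl _ r that]) (use \<psi>(1) \<phi>(2) in auto)
  then have "integral_curve Y (ball 0 r) \<psi>" using \<psi>(3) by (simp add: integral_curve_def)
  from integral_curves_close[OF this \<phi>(1) \<psi>(1), of 0 1] lip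
  have "norm (\<psi> 1 - \<phi> 1) \<le> 2 * 0" by auto
  then show "y = \<phi> 1" using \<psi>(2) by simp
qed

section \<open>Fields with polynomial dependence on the parameter\<close>

definition mi_field :: "(nat ^ 'm) set \<Rightarrow> (nat ^ 'm \<Rightarrow> real ^ 'n \<Rightarrow> real ^ 'n) \<Rightarrow> real ^ 'm \<Rightarrow> real ^ 'n \<Rightarrow> real ^ 'n" where
  "mi_field A X t y = (\<Sum>\<alpha>\<in>A. mi_power t \<alpha> *\<^sub>R X \<alpha> y)"

text \<open>One constant bounds size and Lipschitz constant of every subfamily, and a subfamily of
  orders at least \<open>k\<close> gains \<open>norm t ^ k\<close>. Truncations, homogeneous parts
  and higher-order parts are thus estimated uniformly.\<close>

definition field_bounds :: "(nat ^ 'm) set \<Rightarrow> (nat ^ 'm \<Rightarrow> real ^ 'n \<Rightarrow> real ^ 'n) \<Rightarrow> real \<Rightarrow> real \<Rightarrow> bool" where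
  "field_bounds I X r K \<longleftrightarrow> (\<forall>A k t. A \<subseteq> I \<longrightarrow> (\<forall>\<alpha>\<in>A. k \<le> mi_length \<alpha>) \<longrightarrow> norm t \<le> 1 \<longrightarrow>
    (\<forall>y\<in>cball 0 r. norm (mi_field A X t y) \<le> K * norm t ^ k) \<and>
    (\<forall>y\<in>cball 0 r. \<forall>z\<in>cball 0 r.
      norm (mi_field A X t y - mi_field A X t z) \<le> K * norm t ^ k * norm (y - z)))"

lemma field_boundsD:
  assumes "field_bounds I X r K" "A \<subseteq> I" "\<And>\<alpha>. \<alpha> \<in> A \<Longrightarrow> k \<le> mi_length \<alpha>" "norm t \<le> 1" "y \<in> cball 0 r"
  shows "norm (mi_field A X t y) \<le> K * norm t ^ k"
    "z \<in> cball 0 r \<Longrightarrow> norm (mi_field A X t y - mi_field A X t z) \<le> K * norm t ^ k * norm (y - z)"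
proof -
  have "(\<forall>y\<in>cball 0 r. norm (mi_field A X t y) \<le> K * norm t ^ k) \<and>
    (\<forall>y\<in>cball 0 r. \<forall>z\<in>cball 0 r.
      norm (mi_field A X t y - mi_field A X t z) \<le> K * norm t ^ k * norm (y - z))"
    using assms(1-4) unfolding field_bounds_def by blast
  then show "norm (mi_field A X t y) \<le> K * norm t ^ k"
    "z \<in> cball 0 r \<Longrightarrow> norm (mi_field A X t y - mi_field A X t z) \<le> K * norm t ^ k * norm (y - z)"
    using assms(5) by blast+
qed

lemma mi_power_vec: "mi_power (vec c) \<alpha> = c ^ mi_length \<alpha>"
  by (simp add: mi_power_def mi_length_def power_sum)

lemma abs_mi_power_le_norm: "\<bar>mi_power t \<alpha>\<bar> \<le> norm t ^ mi_length \<alpha>"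
proof -
  have "\<bar>mi_power t \<alpha>\<bar> \<le> mi_power (vec (norm t)) \<alpha>"
    by (rule abs_mi_power_le) (simp only: vec_component component_le_norm_cart)
  then show ?thesis by (simp only: mi_power_vec)
qed

lemma smooth_on_lipschitz:
  fixes X :: "real ^ 'n \<Rightarrow> real ^ 'n"
  assumes "smooth_on X W" "cball 0 r \<subseteq> W"
  shows "\<exists>B\<ge>0. (\<forall>y\<in>cball 0 r. norm (X y) \<le> B) \<and>
    (\<forall>y\<in>cball 0 r. \<forall>z\<in>cball 0 r. norm (X y - X z) \<le> B * norm (y - z))"
proof -
  have cont: "continuous_on (cball 0 r) X"
    using assms unfolding smooth_on_def by (meson Ck_on.simps(1) continuous_on_subset)
  have contD: "continuous_on (cball 0 r) (\<lambda>y. frechet_derivative X (at y) v)" for v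
    using smooth_on_frechet[OF assms(1), of v] assms(2) unfolding smooth_on_def
    by (meson Ck_on.simps(1) continuous_on_subset)
  have ex: "\<exists>B\<ge>0. \<forall>y\<in>cball 0 r. norm (f y) \<le> B" if "continuous_on (cball 0 r) f" for f :: "real ^ 'n \<Rightarrow> real ^ 'n"
  proof -
    have "bounded (f ` cball 0 r)"
      by (intro compact_imp_bounded compact_continuous_image that compact_cball)
    then obtain B where "\<forall>y\<in>cball 0 r. norm (f y) \<le> B" unfolding bounded_iff by blast
    then have "0 \<le> max B 0 \<and> (\<forall>y\<in>cball 0 r. norm (f y) \<le> max B 0)"
      by (meson max.cobounded1 max.cobounded2 order_trans)
    then show ?thesis by blast
  qed
  obtain B0 where B0: "0 \<le> B0" "\<forall>y\<in>cball 0 r. norm (X y) \<le> B0" using ex[OF cont] by blast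
  have "\<forall>i. \<exists>B\<ge>0. \<forall>y\<in>cball 0 r. norm (frechet_derivative X (at y) (axis i 1)) \<le> B"
    using ex[OF contD] by blast
  then obtain B1 where B1: "\<And>i. 0 \<le> B1 i"
    "\<And>i y. y \<in> cball 0 r \<Longrightarrow> norm (frechet_derivative X (at y) (axis i 1)) \<le> B1 i"
    by metis
  let ?B = "B0 + (\<Sum>i\<in>UNIV. B1 i)"
  have s: "0 \<le> (\<Sum>i\<in>UNIV. B1 i)" using B1(1) by (simp add: sum_nonneg)
  have der: "(X has_derivative frechet_derivative X (at y)) (at y)" if "y \<in> cball 0 r" for y
    using smooth_on_has_derivative[OF assms(1)] assms(2) that by blast
  have on: "onorm (frechet_derivative X (at y)) \<le> (\<Sum>i\<in>UNIV. B1 i)" if y: "y \<in> cball 0 r" for y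
  proof (rule onorm_bound[OF s])
    fix v
    have "norm (frechet_derivative X (at y) v) = norm (\<Sum>i\<in>UNIV. v $ i *\<^sub>R frechet_derivative X (at y) (axis i 1))"
      by (rule arg_cong[OF bounded_linear_vec_expand[OF has_derivative_bounded_linear[OF der[OF y]]]])
    also have "\<dots> \<le> (\<Sum>i\<in>UNIV. norm v * B1 i)"
    proof (rule sum_norm_le)
      fix i
      show "norm (v $ i *\<^sub>R frechet_derivative X (at y) (axis i 1)) \<le> norm v * B1 i"
        unfolding norm_scaleR real_norm_def
        by (rule mult_mono[OF component_le_norm_cart B1(2)[OF y] norm_ge_zero norm_ge_zero])
    qed
    also have "\<dots> = (\<Sum>i\<in>UNIV. B1 i) * norm v"
      by (simp only: sum_distrib_left mult.commute[of _ "norm v"])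
    finally show "norm (frechet_derivative X (at y) v) \<le> (\<Sum>i\<in>UNIV. B1 i) * norm v" .
  qed
  have lip: "norm (X y - X z) \<le> (\<Sum>i\<in>UNIV. B1 i) * norm (y - z)" if "y \<in> cball 0 r" "z \<in> cball 0 r" for y z
    by (rule differentiable_bound[OF convex_cball has_derivative_at_withinI[OF der] on that])
  show ?thesis
  proof (intro exI[of _ ?B] conjI ballI)
    show "0 \<le> ?B" using B0(1) s by (rule add_nonneg_nonneg)
    show "norm (X y) \<le> ?B" if "y \<in> cball 0 r" for y
      using bspec[OF B0(2) that] s by linarith
    show "norm (X y - X z) \<le> ?B * norm (y - z)" if "y \<in> cball 0 r" "z \<in> cball 0 r" for y z
      using lip[OF that] mult_right_mono[OF _ norm_ge_zero, of "\<Sum>i\<in>UNIV. B1 i" ?B "y - z"] B0(1) by linarith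
  qed
qed

lemma field_bounds_exist:
  fixes X :: "nat ^ 'm \<Rightarrow> real ^ 'n \<Rightarrow> real ^ 'n"
  assumes "finite I" and sm: "\<And>\<alpha>. \<alpha> \<in> I \<Longrightarrow> smooth_on (X \<alpha>) W" "cball 0 r \<subseteq> W"
  shows "\<exists>K\<ge>0. field_bounds I X r K"
proof -
  have "\<forall>\<alpha>\<in>I. \<exists>B\<ge>0. (\<forall>y\<in>cball 0 r. norm (X \<alpha> y) \<le> B) \<and>
    (\<forall>y\<in>cball 0 r. \<forall>z\<in>cball 0 r. norm (X \<alpha> y - X \<alpha> z) \<le> B * norm (y - z))"
    using smooth_on_lipschitz[OF sm] by blast
  then obtain B where B: "\<And>\<alpha>. \<alpha> \<in> I \<Longrightarrow> 0 \<le> B \<alpha>"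
    "\<And>\<alpha> y. \<alpha> \<in> I \<Longrightarrow> y \<in> cball 0 r \<Longrightarrow> norm (X \<alpha> y) \<le> B \<alpha>"
    "\<And>\<alpha> y z. \<alpha> \<in> I \<Longrightarrow> y \<in> cball 0 r \<Longrightarrow> z \<in> cball 0 r \<Longrightarrow> norm (X \<alpha> y - X \<alpha> z) \<le> B \<alpha> * norm (y - z)"
    by metis
  \<comment> \<open>The sum of all individual constants dominates the sum over any
    subfamily.\<close>
  let ?K = "\<Sum>\<alpha>\<in>I. B \<alpha>"
  have K: "0 \<le> ?K" using B(1) by (simp add: sum_nonneg)
  have gen: "norm (\<Sum>\<alpha>\<in>A. mi_power t \<alpha> *\<^sub>R v \<alpha>) \<le> ?K * norm t ^ k * c"
    if A: "A \<subseteq> I" "\<forall>\<alpha>\<in>A. k \<le> mi_length \<alpha>" "norm t \<le> 1" and v: "\<And>\<alpha>. \<alpha> \<in> A \<Longrightarrow> norm (v \<alpha>) \<le> B \<alpha> * c" and c: "0 \<le> c"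
    for A k t c and v :: "nat ^ 'm \<Rightarrow> real ^ 'n"
  proof -
    have "norm (\<Sum>\<alpha>\<in>A. mi_power t \<alpha> *\<^sub>R v \<alpha>) \<le> (\<Sum>\<alpha>\<in>A. norm t ^ k * (B \<alpha> * c))"
    proof (rule sum_norm_le)
      fix \<alpha> assume \<alpha>: "\<alpha> \<in> A"
      have "\<bar>mi_power t \<alpha>\<bar> \<le> norm t ^ mi_length \<alpha>" by (rule abs_mi_power_le_norm)
      also have "\<dots> \<le> norm t ^ k" using A \<alpha> by (intro power_decreasing) auto
      finally show "norm (mi_power t \<alpha> *\<^sub>R v \<alpha>) \<le> norm t ^ k * (B \<alpha> * c)"
        using v[OF \<alpha>] by (simp add: mult_mono)
    qed
    also have "\<dots> = (\<Sum>\<alpha>\<in>A. B \<alpha>) * (norm t ^ k * c)" by (simp add: sum_distrib_left sum_distrib_right mult_ac)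
    also have "\<dots> \<le> ?K * (norm t ^ k * c)"
      using A assms(1) B(1) c by (intro mult_right_mono sum_mono2) auto
    finally show ?thesis by (simp add: mult.assoc)
  qed
  have "field_bounds I X r ?K"
    unfolding field_bounds_def
  proof (intro allI impI conjI ballI)
    fix A k t and y z :: "real ^ 'n"
    assume A: "A \<subseteq> I" "\<forall>\<alpha>\<in>A. k \<le> mi_length \<alpha>" "norm (t :: real ^ 'm) \<le> 1" and y: "y \<in> cball 0 r"
    show "norm (mi_field A X t y) \<le> ?K * norm t ^ k"
      using gen[OF A, of "\<lambda>\<alpha>. X \<alpha> y" 1] B(2)[OF _ y] A(1) by (auto simp: mi_field_def)
    assume z: "z \<in> cball 0 r"
    have "mi_field A X t y - mi_field A X t z = (\<Sum>\<alpha>\<in>A. mi_power t \<alpha> *\<^sub>R (X \<alpha> y - X \<alpha> z))"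
      by (simp add: mi_field_def sum_subtractf scaleR_diff_right)
    then show "norm (mi_field A X t y - mi_field A X t z) \<le> ?K * norm t ^ k * norm (y - z)"
      using gen[OF A, of "\<lambda>\<alpha>. X \<alpha> y - X \<alpha> z" "norm (y - z)"] B(3)[OF _ y z] A(1) by auto
  qed
  with K show ?thesis by blast
qed

text \<open>The smallness of \<rho> turns the bounds of the family into speed at most
  \<open>r / 4\<close> and Lipschitz constant at most 1/2. Admitting \<open>L' \<le> L\<close> gives
  the truncated flows on the same ball with the same constants.\<close>

lemma gamma_map_curve:
  fixes X :: "nat ^ 'm \<Rightarrow> real ^ 'n \<Rightarrow> real ^ 'n"
  assumes fb: "field_bounds (multi_indices L) X r K" and K: "0 \<le> K" and r: "0 < r" and W: "cball 0 r \<subseteq> W"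
    and \<rho>: "0 \<le> \<rho>" "\<rho> \<le> 1" "K * \<rho> \<le> 1 / 2" "K * \<rho> \<le> r / 4" and t: "norm t \<le> \<rho>" and x: "norm x \<le> r / 2"
    and L': "L' \<le> L"
  shows "\<exists>\<phi>. \<phi> 0 = x \<and> integral_curve (mi_field (multi_indices L') X t) (ball 0 r) \<phi> \<and>
    gamma_map W L' X t x = \<phi> 1 \<and> (\<forall>s\<in>{0..1}. norm (\<phi> s - x) \<le> K * norm t)"
proof -
  let ?Y = "mi_field (multi_indices L') X t"
  have A: "multi_indices L' \<subseteq> (multi_indices L :: (nat ^ 'm) set)" "\<And>\<alpha>. \<alpha> \<in> multi_indices L' \<Longrightarrow> 1 \<le> mi_length \<alpha>"
    using L' by (auto simp: multi_indices_def)
  have t1: "norm t \<le> 1" using t \<rho> by linarith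
  have Kt: "K * norm t \<le> K * \<rho>" using K t by (intro mult_left_mono)
  note b = field_boundsD(1)[OF fb A t1]
  have bd: "norm (?Y y) \<le> K * norm t" if "y \<in> cball 0 r" for y
    using b[of y] that by simp
  have bd4: "norm (?Y y) \<le> r / 4" if "y \<in> cball 0 r" for y
    using bd[OF that] Kt \<rho> by linarith
  have lip: "norm (?Y y - ?Y z) \<le> norm (y - z) / 2" if "y \<in> cball 0 r" "z \<in> cball 0 r" for y z
  proof -
    have "norm (?Y y - ?Y z) \<le> K * norm t * norm (y - z)"
      using field_boundsD(2)[OF fb A t1 that] by simp
    also have "\<dots> \<le> 1 / 2 * norm (y - z)" using Kt \<rho> by (intro mult_right_mono) auto
    finally show ?thesis by simp
  qed
  obtain \<phi> where \<phi>: "\<phi> 0 = x" "integral_curve ?Y (ball 0 r) \<phi>"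
    using integral_curve_exists[OF r x bd4 lip] by blast
  have "gamma_map W L' X t x = exp_flow W ?Y (\<phi> 0)"
    by (simp add: gamma_map_def mi_field_def[abs_def] \<phi>(1))
  also have "\<dots> = \<phi> 1"
    using W \<phi> x by (intro exp_flow_eq[OF r _ bd4 lip]) auto
  finally have "gamma_map W L' X t x = \<phi> 1" .
  moreover have "norm (\<phi> s - \<phi> 0) \<le> K * norm t" if "s \<in> {0..1}" for s
    using that \<phi> x Kt \<rho> by (intro integral_curve_trapped(2)[OF \<phi>(2) bd _ _ r]) auto
  ultimately show ?thesis using \<phi> by auto
qed

section \<open>Lie series\<close>

text \<open>The Weierstrass test for the l1-norm: if the norms have bounded sums, coefficientwise
  summation gives a bounded series, and the two orders of summation agree by Fubini.\<close>

lemma ps_series: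
  fixes g :: "nat \<Rightarrow> nat ^ 'i \<Rightarrow> real"
  assumes g: "\<And>k. ps_bound v (g k) (c k)" and v: "\<And>i. 0 \<le> v $ i"
    and c: "\<And>F. finite F \<Longrightarrow> (\<Sum>k\<in>F. c k) \<le> C"
  shows "ps_bound v (\<lambda>\<gamma>. \<Sum>\<^sub>\<infinity>k. g k \<gamma>) C"
    "\<And>z. (\<And>i. \<bar>z $ i\<bar> \<le> v $ i) \<Longrightarrow>
      ((\<lambda>k. ps_eval (g k) z) has_sum ps_eval (\<lambda>\<gamma>. \<Sum>\<^sub>\<infinity>k. g k \<gamma>) z) UNIV"
proof -
  have bd: "(\<Sum>p\<in>G. \<bar>g (fst p) (snd p) * mi_power z (snd p)\<bar>) \<le> C"
    if z: "\<And>i. \<bar>z $ i\<bar> \<le> v $ i" and G: "finite G" for z :: "real ^ 'i" and G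
  proof -
    have "(\<Sum>p\<in>G. \<bar>g (fst p) (snd p) * mi_power z (snd p)\<bar>)
        \<le> (\<Sum>p\<in>fst ` G \<times> snd ` G. \<bar>g (fst p) (snd p) * mi_power z (snd p)\<bar>)"
      using G by (intro sum_mono2 subset_fst_snd) auto
    also have "\<dots> = (\<Sum>k\<in>fst ` G. \<Sum>\<gamma>\<in>snd ` G. \<bar>g k \<gamma> * mi_power z \<gamma>\<bar>)"
      by (simp add: sum.cartesian_product case_prod_unfold)
    also have "\<dots> \<le> (\<Sum>k\<in>fst ` G. c k)"
      using G by (intro sum_mono ps_terms_bounded[OF g z]) auto
    also have "\<dots> \<le> C" using G by (intro c) auto
    finally show ?thesis .
  qed
  have swap: "(\<Sum>p\<in>G. \<bar>T (snd p, fst p)\<bar>) \<le> C"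
    if T: "\<And>G. finite G \<Longrightarrow> (\<Sum>p\<in>G. \<bar>T p\<bar>) \<le> C" and "finite G" for T :: "nat \<times> (nat ^ 'i) \<Rightarrow> real" and G
  proof -
    have "(\<Sum>p\<in>G. \<bar>T (snd p, fst p)\<bar>) = (\<Sum>p\<in>prod.swap ` G. \<bar>T p\<bar>)"
      by (subst sum.reindex) (auto simp: prod.swap_def inj_on_def)
    then show ?thesis using T[of "prod.swap ` G"] that by simp
  qed
  have eq: "(\<Sum>\<^sub>\<infinity>k. g k \<gamma> * mi_power z \<gamma>) = (\<Sum>\<^sub>\<infinity>k. g k \<gamma>) * mi_power z \<gamma>" for \<gamma> and z :: "real ^ 'i"
    by (rule infsum_cmult_left')
  show "ps_bound v (\<lambda>\<gamma>. \<Sum>\<^sub>\<infinity>k. g k \<gamma>) C"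
    unfolding ps_bound_def
  proof (intro allI impI)
    fix F :: "(nat ^ 'i) set" assume F: "finite F"
    have "\<bar>v $ i\<bar> \<le> v $ i" for i using v by simp
    from has_sum_sections(3)[OF swap[OF bd[OF this]] F]
    show "(\<Sum>\<gamma>\<in>F. \<bar>\<Sum>\<^sub>\<infinity>k. g k \<gamma>\<bar> * mi_power v \<gamma>) \<le> C"
      using mi_power_nonneg[OF v] by (simp add: eq abs_mult)
  qed
  fix z :: "real ^ 'i" assume z: "\<And>i. \<bar>z $ i\<bar> \<le> v $ i"
  let ?T = "\<lambda>p. g (fst p) (snd p) * mi_power z (snd p)"
  have "((\<lambda>k. ps_eval (g k) z) has_sum infsum ?T UNIV) UNIV"
    using has_sum_sections(2)[OF bd[OF z]] by (simp add: ps_eval_def)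
  moreover have "infsum ?T UNIV = infsum (\<lambda>p. ?T (snd p, fst p)) UNIV"
  proof -
    have "bij_betw prod.swap (UNIV :: ((nat ^ 'i) \<times> nat) set) UNIV"
      by (rule bij_betwI[where g = prod.swap]) auto
    from infsum_reindex_bij_betw[OF this, of ?T] show ?thesis by (simp add: prod.swap_def)
  qed
  moreover have "infsum (\<lambda>p. ?T (snd p, fst p)) UNIV = ps_eval (\<lambda>\<gamma>. \<Sum>\<^sub>\<infinity>k. g k \<gamma>) z"
    using ps_evalI[OF has_sum_sections(2)[OF swap[OF bd[OF z]], unfolded fst_conv snd_conv eq]] by simp
  ultimately show "((\<lambda>k. ps_eval (g k) z) has_sum ps_eval (\<lambda>\<gamma>. \<Sum>\<^sub>\<infinity>k. g k \<gamma>) z) UNIV" by simp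
qed

lemma analytic_germs_common_radius:
  assumes "finite I" "\<And>i. i \<in> I \<Longrightarrow> analytic_germ (f i)" "0 < R0"
  shows "\<exists>R a M. 0 < R \<and> R \<le> R0 \<and> 0 \<le> M \<and> (\<forall>i\<in>I. ps_bound (vec R) (a i) M \<and> (\<forall>x\<in>ball 0 R. f i x = ps_eval (a i) x))"
proof -
  have "\<forall>i\<in>I. \<exists>R a C. 0 < R \<and> ps_bound (vec R) a C \<and> (\<forall>x\<in>ball 0 R. f i x = ps_eval a x)"
    using assms(2) unfolding analytic_germ_def by blast
  then obtain R a C where *: "\<And>i. i \<in> I \<Longrightarrow> 0 < R i" "\<And>i. i \<in> I \<Longrightarrow> ps_bound (vec (R i)) (a i) (C i)"
    "\<And>i x. i \<in> I \<Longrightarrow> x \<in> ball 0 (R i) \<Longrightarrow> f i x = ps_eval (a i) x"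
    by metis
  let ?R = "Min (insert R0 (R ` I))"
  have R: "0 < ?R" "?R \<le> R0" "\<And>i. i \<in> I \<Longrightarrow> ?R \<le> R i" using assms *(1) by auto
  have "ps_bound (vec ?R) (a i) (\<Sum>i\<in>I. C i)" if "i \<in> I" for i
  proof (rule ps_bound_mono[OF *(2)[OF that]])
    show "0 \<le> vec ?R $ k" for k using R(1) by (simp only: vec_component)
    show "vec ?R $ k \<le> vec (R i) $ k" for k using R(3)[OF that] by (simp only: vec_component)
    show "C i \<le> (\<Sum>i\<in>I. C i)"
      using assms(1) that ps_bound_nonneg[OF *(2)] by (intro member_le_sum) auto
  qed
  moreover have "f i x = ps_eval (a i) x" if "i \<in> I" "x \<in> ball 0 ?R" for i x
  proof -
    have "x \<in> ball 0 (R i)" using that(2) R(3)[OF that(1)] unfolding mem_ball by linarith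
    then show ?thesis by (rule *(3)[OF that(1)])
  qed
  moreover have "0 \<le> (\<Sum>i\<in>I. C i)" using ps_bound_nonneg[OF *(2)] by (intro sum_nonneg) auto
  ultimately show ?thesis using R(1,2) by (intro exI[of _ ?R] exI[of _ a] exI[of _ "\<Sum>i\<in>I. C i"]) auto
qed

definition vfst :: "'a ^ ('m::finite + 'n::finite) \<Rightarrow> 'a ^ 'm" where "vfst z = (\<chi> i. z $ Inl i)"
definition vsnd :: "'a ^ ('m::finite + 'n::finite) \<Rightarrow> 'a ^ 'n" where "vsnd z = (\<chi> j. z $ Inr j)"

lemma vfst_vjoin [simp]: "vfst (vjoin x y) = x" and vsnd_vjoin [simp]: "vsnd (vjoin x y) = y"
  by (simp_all add: vfst_def vsnd_def vec_eq_iff)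

lemma vjoin_vfst_vsnd [simp]: "vjoin (vfst z) (vsnd z) = z"
  by (auto simp: vfst_def vsnd_def vec_eq_iff vjoin_def split: sum.split)

lemma sum_UNIV_sum_type: "(\<Sum>k\<in>UNIV. f k) = (\<Sum>i\<in>UNIV. f (Inl i)) + (\<Sum>j\<in>UNIV. f (Inr j))"
  for f :: "'a::finite + 'b::finite \<Rightarrow> 'c::comm_monoid_add"
  by (simp add: UNIV_Plus_UNIV[symmetric] sum.Plus del: UNIV_Plus_UNIV)

lemma norm_vfst_le: "norm (vfst z) \<le> norm z" and norm_vsnd_le: "norm (vsnd z) \<le> norm z"
  for z :: "real ^ ('m::finite + 'n::finite)"
  unfolding norm_vec_def L2_set_def sum_UNIV_sum_type vfst_def vsnd_def
  by (auto intro!: real_sqrt_le_mono sum_nonneg)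

lemma bounded_linear_vjoin_0: "bounded_linear (vjoin 0 :: real ^ 'n \<Rightarrow> real ^ ('m::finite + 'n::finite))"
  unfolding linear_conv_bounded_linear[symmetric]
  by (rule linearI) (auto simp: vec_eq_iff vjoin_def split: sum.split)

lemma vjoin_vec_nonneg: "0 \<le> a \<Longrightarrow> 0 \<le> b \<Longrightarrow> 0 \<le> (vjoin (vec a) (vec b) :: real ^ ('m::finite + 'n::finite)) $ k"
  and vjoin_vec_pos: "0 < a \<Longrightarrow> 0 < b \<Longrightarrow> 0 < (vjoin (vec a) (vec b) :: real ^ ('m::finite + 'n::finite)) $ k"
  by (cases k; simp)+

lemma vjoin_vec_mono: "a \<le> a' \<Longrightarrow> b \<le> b' \<Longrightarrow>
    (vjoin (vec a) (vec b) :: real ^ ('m::finite + 'n::finite)) $ k \<le> vjoin (vec a') (vec b') $ k"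
  by (cases k) simp_all

text \<open>The sum of \<open>t\<close>^\<alpha> times the series \<open>a \<alpha>\<close> in
  \<open>x\<close>, over \<alpha> in \<open>I\<close>, regarded as one series in
  \<open>(t, x)\<close>.\<close>

definition ps_family :: "(nat ^ 'm) set \<Rightarrow> (nat ^ 'm \<Rightarrow> nat ^ 'n \<Rightarrow> real) \<Rightarrow> nat ^ ('m::finite + 'n::finite) \<Rightarrow> real" where
  "ps_family I a \<gamma> = (if vfst \<gamma> \<in> I then a (vfst \<gamma>) (vsnd \<gamma>) else 0)"

text \<open>No exponent \<alpha> is zero, so every term carries at least one factor \<rho>. Hence
  the norm of the whole field can be made small by shrinking \<rho> with \<open>R\<close> kept
  fixed.\<close>

lemma ps_bound_family:
  fixes M \<rho> R :: real
  assumes I: "finite I" "\<And>\<alpha>. \<alpha> \<in> I \<Longrightarrow> 0 < mi_length \<alpha>"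
    and a: "\<And>\<alpha>. \<alpha> \<in> I \<Longrightarrow> ps_bound (vec R) (a \<alpha>) M" and M: "0 \<le> M"
    and \<rho>: "0 < \<rho>" "\<rho> \<le> 1" and R: "0 < R"
  shows "ps_bound (vjoin (vec \<rho>) (vec R)) (ps_family I a) (\<rho> * (card I * M))"
  unfolding ps_bound_def
proof (intro allI impI)
  fix F :: "(nat ^ ('a + 'b)) set" assume F: "finite F"
  let ?h = "\<lambda>\<alpha> \<beta>. \<bar>a \<alpha> \<beta>\<bar> * (mi_power (vec \<rho>) \<alpha> * mi_power (vec R) \<beta>)"
  let ?J = "(\<lambda>p. vjoin (fst p) (snd p)) ` (I \<times> vsnd ` F)"
  have nn: "0 \<le> mi_power (vec \<rho>) \<alpha>" "0 \<le> mi_power (vec R) \<beta>" for \<alpha> :: "nat ^ 'a" and \<beta> :: "nat ^ 'b"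
    using \<rho> R by (auto intro!: mi_power_nonneg)
  have nn2: "0 \<le> mi_power (vjoin (vec \<rho>) (vec R)) \<gamma>" for \<gamma> :: "nat ^ ('a + 'b)"
    using nn mi_power_vjoin[of "vec \<rho>" "vec R" "vfst \<gamma>" "vsnd \<gamma>"] by simp
  have "(\<Sum>\<gamma>\<in>F. \<bar>ps_family I a \<gamma>\<bar> * mi_power (vjoin (vec \<rho>) (vec R)) \<gamma>)
      = (\<Sum>\<gamma>\<in>{\<gamma>\<in>F. vfst \<gamma> \<in> I}. \<bar>ps_family I a \<gamma>\<bar> * mi_power (vjoin (vec \<rho>) (vec R)) \<gamma>)"
    using F by (intro sum.mono_neutral_right) (auto simp: ps_family_def)
  also have "\<dots> \<le> (\<Sum>\<gamma>\<in>?J. \<bar>ps_family I a \<gamma>\<bar> * mi_power (vjoin (vec \<rho>) (vec R)) \<gamma>)"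
  proof (rule sum_mono2)
    show "{\<gamma>\<in>F. vfst \<gamma> \<in> I} \<subseteq> ?J"
    proof
      fix \<gamma> assume "\<gamma> \<in> {\<gamma>\<in>F. vfst \<gamma> \<in> I}"
      then show "\<gamma> \<in> ?J" by (intro image_eqI[of _ _ "(vfst \<gamma>, vsnd \<gamma>)"]) auto
    qed
  qed (use F I nn2 in auto)
  also have "\<dots> = (\<Sum>p\<in>I \<times> vsnd ` F. ?h (fst p) (snd p))"
    by (subst sum.reindex) (auto simp: inj_on_def ps_family_def mi_power_vjoin intro!: sum.cong)
  also have "\<dots> = (\<Sum>\<alpha>\<in>I. mi_power (vec \<rho>) \<alpha> * (\<Sum>\<beta>\<in>vsnd ` F. \<bar>a \<alpha> \<beta>\<bar> * mi_power (vec R) \<beta>))"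
    by (simp add: sum.cartesian_product[symmetric] case_prod_unfold sum_distrib_left mult_ac
        sum.cartesian_product' )
  also have "\<dots> \<le> (\<Sum>\<alpha>\<in>I. \<rho> * M)"
  proof (rule sum_mono)
    fix \<alpha> assume \<alpha>: "\<alpha> \<in> I"
    have "mi_power (vec \<rho>) \<alpha> \<le> \<rho>"
      using power_decreasing[of 1 "mi_length \<alpha>" \<rho>] I(2)[OF \<alpha>] \<rho> by (simp add: mi_power_vec)
    then show "mi_power (vec \<rho>) \<alpha> * (\<Sum>\<beta>\<in>vsnd ` F. \<bar>a \<alpha> \<beta>\<bar> * mi_power (vec R) \<beta>) \<le> \<rho> * M"
      using ps_boundD[OF a[OF \<alpha>]] F \<rho> nn(2) by (intro mult_mono) (auto intro!: sum_nonneg)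
  qed
  finally show "(\<Sum>\<gamma>\<in>F. \<bar>ps_family I a \<gamma>\<bar> * mi_power (vjoin (vec \<rho>) (vec R)) \<gamma>) \<le> \<rho> * (card I * M)"
    by (simp add: mult.left_commute)
qed

lemma ps_eval_family:
  assumes I: "finite I" and A: "ps_bound (vjoin v w) (ps_family I a) C"
    and v: "\<And>i. 0 < v $ i" and t: "\<And>i. \<bar>t $ i\<bar> \<le> v $ i" and x: "\<And>j. \<bar>x $ j\<bar> \<le> w $ j"
  shows "ps_eval (ps_family I a) (vjoin t x) = (\<Sum>\<alpha>\<in>I. mi_power t \<alpha> * ps_eval (a \<alpha>) x)"
proof (rule has_sum_unique[OF ps_has_sum_split[OF A v t x]])
  show "((\<lambda>\<alpha>. mi_power t \<alpha> * ps_eval (\<lambda>\<beta>. ps_family I a (vjoin \<alpha> \<beta>)) x) has_sum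
      (\<Sum>\<alpha>\<in>I. mi_power t \<alpha> * ps_eval (a \<alpha>) x)) UNIV"
    by (rule has_sum_finite_neutralI[OF I]) (auto simp: ps_family_def ps_eval_zero cong: if_cong intro!: sum.cong)
qed

section \<open>Iterated Lie derivatives of the coordinate functions\<close>

definition ps_coord :: "'i \<Rightarrow> nat ^ 'i \<Rightarrow> real" where
  "ps_coord k \<gamma> = (if \<gamma> = axis k 1 then 1 else 0)"

lemma ps_eval_coord: "ps_eval (ps_coord k) z = z $ k"
  by (subst ps_eval_finite_support[of "{axis k 1}"]) (auto simp: ps_coord_def)

lemma ps_bound_coord:
  assumes "\<And>i. 0 \<le> w $ i"
  shows "ps_bound w (ps_coord k) (w $ k)"
  using ps_bound_finite_support[of "{axis k 1}" "ps_coord k" w] assms by (simp add: ps_coord_def)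

text \<open>The coefficients of \<open>Y\<^sup>k x\<^sub>j\<close>, where the vector field \<open>Y\<close> on the second block of variables has
  the component series \<open>A\<close> and acts as a derivation.\<close>

fun ps_lie :: "('n::finite \<Rightarrow> nat ^ ('m::finite + 'n) \<Rightarrow> real) \<Rightarrow> nat \<Rightarrow> 'n \<Rightarrow> nat ^ ('m + 'n) \<Rightarrow> real" where
  "ps_lie A 0 j = ps_coord (Inr j)"
| "ps_lie A (Suc k) j = (\<lambda>\<gamma>. \<Sum>i\<in>UNIV. ps_mult (A i) (ps_deriv (Inr i) (ps_lie A k j)) \<gamma>)"

text \<open>\<open>real p ^ p / fact p\<close> is a single term of the series of
  \<open>exp (real p)\<close>, and \<open>exp 1 \<le> 3\<close>.\<close>

lemma power_self_le_fact: "real p ^ p \<le> 3 ^ p * fact p"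
proof -
  have "(\<lambda>n. real p ^ n / fact n) sums exp (real p)"
    using exp_converges[of "real p"] by (simp add: divide_inverse mult.commute)
  then have "real p ^ p / fact p \<le> exp (real p)"
    using sum_le_suminf[of "\<lambda>n. real p ^ n / fact n" "{p}"] by (simp add: sums_iff)
  also have "exp (real p) = exp 1 ^ p" by (simp add: exp_of_nat_mult[symmetric])
  also have "\<dots> \<le> 3 ^ p" using exp_le by (intro power_mono) auto
  finally show ?thesis by (simp add: field_simps)
qed

text \<open>The permitted halving of the radii is spread evenly over the \<open>p\<close>
  differentiations: each shrinks by \<theta> = 1 - 1/(2p) and costs a factor of at most
  \<open>p * q\<close>. The resulting \<open>p ^ p\<close> is left for the factorial to
  absorb.\<close>

lemma ps_bound_lie:
  fixes A :: "'n::finite \<Rightarrow> nat ^ ('m::finite + 'n) \<Rightarrow> real" and \<rho> R \<eta> q :: real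
  assumes A: "\<And>i. ps_bound (vjoin (vec \<rho>) (vec R)) (A i) \<eta>" and \<rho>: "0 < \<rho>" and R: "0 < R"
    and \<eta>: "4 * CARD('n) * \<eta> / R \<le> q"
  shows "ps_bound (vjoin (vec (\<rho> / 2)) (vec (R / 2))) (ps_lie A p j) ((p * q) ^ p * R)"
proof (cases "p = 0")
  case True
  have "ps_bound w (ps_coord (Inr j)) (w $ Inr j)" if "w = vjoin (vec (\<rho> / 2)) (vec (R / 2))" for w :: "real ^ ('m + 'n)"
    unfolding that using \<rho> R by (intro ps_bound_coord vjoin_vec_nonneg) auto
  then have "ps_bound (vjoin (vec (\<rho> / 2)) (vec (R / 2)) :: real ^ ('m + 'n)) (ps_coord (Inr j)) (R / 2)"
    by simp
  then show ?thesis
    unfolding True ps_lie.simps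
    by (rule ps_bound_mono) (use R \<rho> vjoin_vec_nonneg[of "\<rho> / 2" "R / 2"] in auto)
next
  case False
  define \<theta> where "\<theta> = 1 - 1 / (2 * real p)"
  define w where "w = (vjoin (vec \<rho>) (vec R) :: real ^ ('m + 'n))"
  have w: "0 < w $ i" for i using \<rho> R by (simp add: w_def vjoin_vec_pos)
  have \<eta>0: "0 \<le> \<eta>" by (rule ps_bound_nonneg[OF A])
  have q0: "0 \<le> q"
  proof -
    have "0 \<le> 4 * CARD('n) * \<eta> / R" using \<eta>0 R by simp
    then show ?thesis using \<eta> by linarith
  qed
  have \<theta>: "0 < \<theta>" "\<theta> < 1" "1 - \<theta> = 1 / (2 * real p)" using False by (auto simp: \<theta>_def field_simps)
  \<comment> \<open>Bernoulli's inequality: all shrinkings together keep at least half of each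
    radius.\<close>
  have \<theta>k: "1 / 2 \<le> \<theta> ^ k" if "k \<le> p" for k
  proof -
    have "1 + real k * (- 1 / (2 * real p)) \<le> (1 + (- 1 / (2 * real p))) ^ k"
      by (rule Bernoulli_inequality) (use False in \<open>simp add: field_simps\<close>)
    moreover have "1 / 2 \<le> 1 + real k * (- 1 / (2 * real p))" using that False by (simp add: field_simps)
    ultimately show ?thesis by (simp add: \<theta>_def)
  qed
  have "ps_bound (\<theta> ^ k *\<^sub>R w) (ps_lie A k j) ((p * q) ^ k * R)" if "k \<le> p" for k
    using that
  proof (induction k)
    case 0
    show ?case using ps_bound_coord[of w "Inr j"] w by (simp add: less_imp_le) (simp add: w_def)
  next
    case (Suc k)
    let ?B = "(p * q) ^ k * R" and ?v = "\<theta> ^ k *\<^sub>R w"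
    have IH: "ps_bound ?v (ps_lie A k j) ?B" using Suc by simp
    have v: "0 < ?v $ i" for i using w \<theta> by simp
    have \<theta>v: "\<theta> *\<^sub>R ?v = \<theta> ^ Suc k *\<^sub>R w" by simp
    have \<theta>vw: "(\<theta> ^ Suc k *\<^sub>R w) $ i \<le> w $ i" "0 \<le> (\<theta> ^ Suc k *\<^sub>R w) $ i" for i
      using w[of i] \<theta> power_le_one[of \<theta> "Suc k"] by (simp_all add: mult_le_cancel_right1 less_imp_le del: power_Suc)
    have B0: "0 \<le> ?B" using R q0 by simp
    \<comment> \<open>The factor \<open>4 * p / R\<close> combines
      \<open>1 / (1 - \<theta>) = 2 * p\<close> with the current radius in \<open>x\<close>, which
      is still at least \<open>R / 2\<close>.\<close>
    have "ps_bound (\<theta> ^ Suc k *\<^sub>R w) (ps_deriv (Inr i) (ps_lie A k j)) (?B * (4 * p / R))" for i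
    proof (rule ps_bound_mono[OF ps_bound_deriv[OF IH \<theta>(1,2) v, of "Inr i"]])
      have "?B / ((1 - \<theta>) * ?v $ Inr i) = ?B * (2 * p / (\<theta> ^ k * R))"
        by (simp add: \<theta>(3) w_def)
      also have "\<dots> \<le> ?B * (2 * p / (1 / 2 * R))"
        using \<theta>k[of k] Suc.prems R B0 by (intro mult_left_mono divide_left_mono mult_right_mono) auto
      finally show "?B / ((1 - \<theta>) * ?v $ Inr i) \<le> ?B * (4 * p / R)" by simp
    qed (use \<theta>v \<theta>vw in auto)
    from ps_bound_mult[OF ps_bound_mono[OF A[folded w_def] \<theta>vw(2,1) order_refl] this \<theta>vw(2)]
    have "ps_bound (\<theta> ^ Suc k *\<^sub>R w) (ps_mult (A i) (ps_deriv (Inr i) (ps_lie A k j))) (\<eta> * (?B * (4 * p / R)))" for i .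
    then have "ps_bound (\<theta> ^ Suc k *\<^sub>R w) (ps_lie A (Suc k) j) (\<Sum>i\<in>(UNIV :: 'n set). \<eta> * (?B * (4 * p / R)))"
      unfolding ps_lie.simps by (rule ps_bound_sum[OF finite _ \<theta>vw(2)])
    moreover have "(\<Sum>i\<in>(UNIV :: 'n set). \<eta> * (?B * (4 * p / R))) \<le> (p * q) ^ Suc k * R"
    proof -
      have "(\<Sum>i\<in>(UNIV :: 'n set). \<eta> * (?B * (4 * p / R))) = (4 * CARD('n) * \<eta> / R) * (p * ?B)" by simp
      also have "\<dots> \<le> q * (p * ?B)" using \<eta> B0 by (intro mult_right_mono) auto
      finally show ?thesis by (simp add: mult_ac)
    qed
    ultimately show ?case using \<theta>vw(2) by (auto intro: ps_bound_mono)
  qed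
  from this[OF order_refl] show ?thesis
  proof (rule ps_bound_mono)
    show "vjoin (vec (\<rho> / 2)) (vec (R / 2)) $ i \<le> (\<theta> ^ p *\<^sub>R w) $ i" for i
      using \<theta>k[of p] mult_right_mono[OF \<theta>k[of p] less_imp_le[OF w[of i]]] by (cases i) (auto simp: w_def)
  qed (use \<rho> R in \<open>auto intro: vjoin_vec_nonneg\<close>)
qed

text \<open>The parameter \<open>t\<close> is frozen along the curve, so only partial derivatives in
  the second block enter the chain rule.\<close>

lemma has_vector_derivative_ps_eval:
  fixes \<phi> :: "real \<Rightarrow> real ^ 'n" and t :: "real ^ 'm"
  assumes f: "ps_bound w f C" and w: "\<And>k. \<bar>vjoin t (\<phi> s) $ k\<bar> < w $ k"
    and \<phi>: "(\<phi> has_vector_derivative y) (at s within S)"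
  shows "((\<lambda>s. ps_eval f (vjoin t (\<phi> s))) has_vector_derivative
    (\<Sum>i\<in>UNIV. ps_eval (ps_deriv (Inr i) f) (vjoin t (\<phi> s)) * y $ i)) (at s within S)"
proof -
  have split: "vjoin t x = vjoin t 0 + vjoin 0 x" for x :: "real ^ 'n"
    by (auto simp: vec_eq_iff vjoin_def split: sum.split)
  have "((\<lambda>s. vjoin t 0 + vjoin 0 (\<phi> s)) has_vector_derivative vjoin 0 y) (at s within S)"
    using bounded_linear.has_vector_derivative[OF bounded_linear_vjoin_0 \<phi>]
    by (auto intro!: derivative_eq_intros)
  then have "((\<lambda>s. vjoin t (\<phi> s)) has_vector_derivative vjoin 0 y) (at s within S)"
    by (simp only: split[symmetric])
  from vector_derivative_diff_chain_within[OF this has_derivative_at_withinI[OF ps_has_derivative[OF f w]]]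
  show ?thesis by (simp add: o_def sum_UNIV_sum_type)
qed

text \<open>The point is taken in half the polydisc because the derivative series is bounded only on
  a smaller polyradius.\<close>

lemma ps_eval_lie_Suc:
  fixes A :: "'n::finite \<Rightarrow> nat ^ ('m::finite + 'n) \<Rightarrow> real"
  assumes A: "\<And>i. ps_bound w (A i) \<eta>" and f: "ps_bound w (ps_lie A k j) C"
    and z: "\<And>i. \<bar>z $ i\<bar> \<le> w $ i / 2" and w: "\<And>i. 0 < w $ i"
  shows "ps_eval (ps_lie A (Suc k) j) z =
    (\<Sum>i\<in>UNIV. ps_eval (ps_deriv (Inr i) (ps_lie A k j)) z * ps_eval (A i) z)"
proof -
  let ?v = "(1 / 2) *\<^sub>R w"
  have v: "0 \<le> ?v $ i" "?v $ i \<le> w $ i" "\<bar>z $ i\<bar> \<le> ?v $ i" for i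
    using w[of i] z[of i] by auto
  have D: "\<exists>C. ps_bound ?v (ps_deriv (Inr i) (ps_lie A k j)) C" for i
    using ps_bound_deriv[OF f, of "1 / 2"] w by fastforce
  then obtain C' where D: "\<And>i. ps_bound ?v (ps_deriv (Inr i) (ps_lie A k j)) (C' i)" by metis
  have A': "ps_bound ?v (A i) \<eta>" for i by (rule ps_bound_mono[OF A v(1,2) order_refl])
  have "ps_eval (ps_lie A (Suc k) j) z = (\<Sum>i\<in>UNIV. ps_eval (ps_mult (A i) (ps_deriv (Inr i) (ps_lie A k j))) z)"
    unfolding ps_lie.simps by (rule ps_eval_sum[OF finite ps_bound_mult[OF A' D v(1)] v(3)])
  also have "\<dots> = (\<Sum>i\<in>UNIV. ps_eval (ps_deriv (Inr i) (ps_lie A k j)) z * ps_eval (A i) z)"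
    using ps_eval_mult[OF A' D v(3)] by (simp add: mult.commute)
  finally show ?thesis .
qed

text \<open>Taylor's formula along an integral curve: the derivatives of \<open>\<phi>\<^sub>j\<close> are the iterated Lie
  derivatives of the \<open>j\<close>-th coordinate, evaluated on the curve.\<close>

lemma lie_series_sums:
  fixes A :: "'n::finite \<Rightarrow> nat ^ ('m::finite + 'n) \<Rightarrow> real" and \<rho> R \<eta> :: real
  assumes A: "\<And>i. ps_bound (vjoin (vec \<rho>) (vec R)) (A i) \<eta>" and \<rho>: "0 < \<rho>" and R: "0 < R"
    and \<eta>: "4 * CARD('n) * \<eta> / R \<le> 1 / 12" and t: "norm t \<le> \<rho> / 8"
    and curve: "integral_curve Y (ball 0 (R / 8)) \<phi>"
    and Y: "\<And>y i. y \<in> ball 0 (R / 8) \<Longrightarrow> Y y $ i = ps_eval (A i) (vjoin t y)"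
  shows "\<And>p. ps_bound (vjoin (vec (\<rho> / 2)) (vec (R / 2))) (ps_lie A p j) (fact p * (R * (1 / 4) ^ p))"
    "(\<lambda>p. ps_eval (ps_lie A p j) (vjoin t (\<phi> 0)) / fact p) sums (\<phi> 1 $ j)"
proof -
  let ?w = "vjoin (vec (\<rho> / 2)) (vec (R / 2)) :: real ^ ('m + 'n)"
  show B: "ps_bound ?w (ps_lie A p j) (fact p * (R * (1 / 4) ^ p))" for p
  proof (rule ps_bound_mono[OF ps_bound_lie[OF A \<rho> R \<eta>]])
    \<comment> \<open>Origin of 1/12: with \<open>p ^ p \<le> 3 ^ p * fact p\<close> it leaves the
      ratio 3/12 = 1/4 of a convergent geometric series.\<close>
    have "(real p * (1 / 12)) ^ p * R = real p ^ p * ((1 / 12) ^ p * R)"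
      by (simp only: power_mult_distrib mult.assoc)
    also have "\<dots> \<le> (3 ^ p * fact p) * ((1 / 12) ^ p * R)"
      using R by (intro mult_right_mono power_self_le_fact) auto
    also have "\<dots> = fact p * (R * (3 * (1 / 12)) ^ p)" unfolding power_mult_distrib by (simp only: mult_ac)
    finally show "(real p * (1 / 12)) ^ p * R \<le> fact p * (R * (1 / 4) ^ p)" by simp
  qed (use \<rho> R in \<open>auto intro: vjoin_vec_nonneg\<close>)
  have w: "0 < ?w $ k" for k using \<rho> R by (simp add: vjoin_vec_pos)
  \<comment> \<open>Both \<open>\<rho> / 8\<close> and \<open>R / 8\<close> are a quarter of the
    halved radii, so the curve stays well inside the polydisc on which the Lie derivatives are
    bounded.\<close>
  have zb: "\<bar>vjoin t (\<phi> s) $ k\<bar> \<le> ?w $ k / 4" if s: "s \<in> {0..1}" for s k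
  proof (cases k)
    case (Inl i)
    then show ?thesis using component_le_norm_cart[of t i] t by simp
  next
    case (Inr i)
    then show ?thesis using component_le_norm_cart[of "\<phi> s" i] integral_curveD(1)[OF curve s] by simp
  qed
  have zw: "\<bar>vjoin t (\<phi> s) $ k\<bar> < ?w $ k" "\<bar>vjoin t (\<phi> s) $ k\<bar> \<le> ?w $ k / 2" "\<bar>vjoin t (\<phi> s) $ k\<bar> \<le> ?w $ k"
    if s: "s \<in> {0..1}" for s k
    using zb[OF s, of k] w[of k] by linarith+
  have A': "ps_bound ?w (A i) \<eta>" for i
    by (rule ps_bound_mono[OF A]) (use \<rho> R in \<open>auto intro: vjoin_vec_nonneg vjoin_vec_mono\<close>)
  let ?D = "\<lambda>k s. ps_eval (ps_lie A k j) (vjoin t (\<phi> s))"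
  have D: "(?D k has_vector_derivative ?D (Suc k) s) (at s within {0..1})" if s: "s \<in> {0..1}" for k s
  proof -
    have "(?D k has_vector_derivative
        (\<Sum>i\<in>UNIV. ps_eval (ps_deriv (Inr i) (ps_lie A k j)) (vjoin t (\<phi> s)) * Y (\<phi> s) $ i)) (at s within {0..1})"
      by (rule has_vector_derivative_ps_eval[OF B zw(1)[OF s] integral_curveD(2)[OF curve s]])
    then show ?thesis
      using ps_eval_lie_Suc[OF A' B zw(2)[OF s] w] Y[OF integral_curveD(1)[OF curve s]] by simp
  qed
  \<comment> \<open>Taylor's formula with integral remainder. The factorials \<open>fact p\<close>
    and \<open>fact (p - 1)\<close> leave a factor \<open>p\<close>, and
    \<open>p * (1 / 4) ^ p\<close> still tends to 0.\<close>
  have bound: "\<bar>\<phi> 1 $ j - (\<Sum>k<p. ?D k 0 / fact k)\<bar> \<le> real p * (R * (1 / 4) ^ p)" if p: "0 < p" for p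
  proof -
    have "((\<lambda>s. ((1 - s) ^ (p - 1) / fact (p - 1)) *\<^sub>R ?D p s) has_integral
        ?D 0 1 - (\<Sum>k<p. ((1 - 0) ^ k / fact k) *\<^sub>R ?D k 0)) {0..1}"
      by (rule Taylor_has_integral[OF p]) (use D in auto)
    then have I: "((\<lambda>s. ((1 - s) ^ (p - 1) / fact (p - 1)) *\<^sub>R ?D p s) has_integral
        \<phi> 1 $ j - (\<Sum>k<p. ?D k 0 / fact k)) {0..1}"
      by (simp add: ps_eval_coord)
    have "norm (\<phi> 1 $ j - (\<Sum>k<p. ?D k 0 / fact k)) \<le> real p * (R * (1 / 4) ^ p) * measure lborel (cbox 0 (1::real))"
    proof (rule has_integral_bound[OF _ I[folded box_real]])
      show "0 \<le> real p * (R * (1 / 4) ^ p)" using R by simp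
      fix s :: real assume "s \<in> cbox 0 1"
      then have s: "s \<in> {0..1}" by simp
      have "\<bar>(1 - s) ^ (p - 1)\<bar> \<le> 1" using s by (simp add: power_le_one)
      moreover have "\<bar>?D p s\<bar> \<le> fact p * (R * (1 / 4) ^ p)" by (rule abs_ps_eval_le[OF B zw(3)[OF s]])
      ultimately have "\<bar>(1 - s) ^ (p - 1)\<bar> * \<bar>?D p s\<bar> \<le> 1 * (fact p * (R * (1 / 4) ^ p))"
        by (intro mult_mono) auto
      also have "\<dots> = fact (p - 1) * (real p * (R * (1 / 4) ^ p))"
        using fact_reduce[OF p, where 'a = real] by (simp add: mult_ac)
      finally show "norm (((1 - s) ^ (p - 1) / fact (p - 1)) *\<^sub>R ?D p s) \<le> real p * (R * (1 / 4) ^ p)"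
        by (simp add: abs_mult divide_le_eq mult_ac)
    qed
    then show ?thesis by simp
  qed
  have "(\<lambda>p. real p * (R * (1 / 4) ^ p)) \<longlonglongrightarrow> 0"
    using tendsto_mult_left[OF powser_times_n_limit_0[of "1/4 :: real"], of R] by (simp add: mult_ac)
  then have "(\<lambda>p. \<phi> 1 $ j - (\<Sum>k<p. ?D k 0 / fact k)) \<longlonglongrightarrow> 0"
    by (rule Lim_null_comparison[rotated]) (use bound in \<open>auto intro!: eventually_sequentiallyI[of 1]\<close>)
  then have "(\<lambda>p. \<phi> 1 $ j - (\<phi> 1 $ j - (\<Sum>k<p. ?D k 0 / fact k))) \<longlonglongrightarrow> \<phi> 1 $ j - 0"
    by (intro tendsto_diff tendsto_const)
  then show "(\<lambda>p. ps_eval (ps_lie A p j) (vjoin t (\<phi> 0)) / fact p) sums (\<phi> 1 $ j)"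
    by (simp add: sums_def)
qed

lemma sum_geometric_quarter_le: "finite F \<Longrightarrow> (\<Sum>k\<in>F. (1 / 4 :: real) ^ k) \<le> 4 / 3"
  using sum_le_suminf[of "\<lambda>k. (1 / 4 :: real) ^ k" F] by (simp add: suminf_geometric)

text \<open>The denominator \<open>A + 1\<close> admits \<open>A = 0\<close> in the choice of small
  constants.\<close>

lemma mult_le_of_le_divide: "0 \<le> A \<Longrightarrow> 0 \<le> \<rho> \<Longrightarrow> \<rho> \<le> b / (A + 1) \<Longrightarrow> A * \<rho> \<le> b" for A b \<rho> :: real
  by (simp add: field_simps)

text \<open>For small parameters each coordinate of the flow is the sum of its Lie series. The norms
  of the terms, divided by factorials, decay geometrically on a fixed polydisc in
  \<open>(t, x)\<close>, so the sum is again a convergent power series.\<close>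

theorem gamma_map_analytic:
  fixes X :: "nat ^ 'm \<Rightarrow> real ^ 'n \<Rightarrow> real ^ 'n"
  assumes W: "open W" "0 \<in> W" and sm: "\<And>\<alpha>. \<alpha> \<in> multi_indices L \<Longrightarrow> smooth_on (X \<alpha>) W"
    and an: "\<And>\<alpha>. \<alpha> \<in> multi_indices L \<Longrightarrow> real_analytic_near (X \<alpha>) 0"
  shows "real_analytic_near (\<lambda>(t, x). gamma_map W L X t x) (0, 0)"
proof -
  let ?I = "multi_indices L :: (nat ^ 'm) set"
  obtain R0 where R0: "0 < R0" "cball 0 R0 \<subseteq> W"
    using W open_contains_cball by blast
  have germ: "analytic_germ (\<lambda>x. X (fst p) x $ snd p)" if "p \<in> ?I \<times> UNIV" for p
    using an that unfolding real_analytic_near_vec_iff by auto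
  let ?Q = "\<lambda>R b M. 0 < R \<and> R \<le> R0 \<and> 0 \<le> M \<and> (\<forall>p\<in>?I \<times> UNIV. ps_bound (vec R) (b p) M \<and>
      (\<forall>x\<in>ball 0 R. X (fst p) x $ snd p = ps_eval (b p) x))"
  have "\<exists>R b M. ?Q R b M"
    by (rule analytic_germs_common_radius[OF finite_cartesian_product[OF finite_multi_indices finite] germ R0(1)])
  then obtain R where "\<exists>b M. ?Q R b M" ..
  then obtain b where "\<exists>M. ?Q R b M" ..
  then obtain M where Rb: "?Q R b M" ..
  have R: "0 < R" "R \<le> R0" and M: "0 \<le> M" using Rb by blast+
  have bp: "ps_bound (vec R) (b p) M \<and> (\<forall>x\<in>ball 0 R. X (fst p) x $ snd p = ps_eval (b p) x)"
    if "p \<in> ?I \<times> UNIV" for p using Rb that by blast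
  have b: "ps_bound (vec R) (b (\<alpha>, j)) M"
    "x \<in> ball 0 R \<Longrightarrow> X \<alpha> x $ j = ps_eval (b (\<alpha>, j)) x" if "\<alpha> \<in> ?I" for \<alpha> j x
    using bp[of "(\<alpha>, j)"] that by auto
  define r where "r = R / 8"
  have r: "0 < r" "cball 0 r \<subseteq> W" using R R0 by (auto simp: r_def)
  have "\<exists>K\<ge>0. field_bounds ?I X r K"
    by (rule field_bounds_exist[OF finite_multi_indices _ r(2)]) (rule sm)
  then obtain K where K: "0 \<le> K" "field_bounds ?I X r K" by (elim exE conjE) (rule that)
  define Q where "Q = 4 * CARD('n) * (card ?I * M) / R"
  have Q: "0 \<le> Q" using M R by (simp add: Q_def)
  \<comment> \<open>The four entries serve, in order, the bounds for powers of \<rho>, the Lipschitz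
    constant 1/2, the speed \<open>r / 4\<close> and the constant 1/12 of the Lie series.\<close>
  define \<rho> where "\<rho> = Min {1, (1 / 2) / (K + 1), (r / 4) / (K + 1), (1 / 12) / (Q + 1)}"
  have \<rho>: "0 < \<rho>" using K(1) Q r(1) by (simp add: \<rho>_def)
  have \<rho>_le: "\<rho> \<le> 1" "\<rho> \<le> (1 / 2) / (K + 1)" "\<rho> \<le> (r / 4) / (K + 1)" "\<rho> \<le> (1 / 12) / (Q + 1)"
    unfolding \<rho>_def by (rule Min_le; simp)+
  have \<rho>2: "K * \<rho> \<le> 1 / 2" "K * \<rho> \<le> r / 4" "Q * \<rho> \<le> 1 / 12"
    using mult_le_of_le_divide[OF K(1) _ \<rho>_le(2)] mult_le_of_le_divide[OF K(1) _ \<rho>_le(3)] mult_le_of_le_divide[OF Q _ \<rho>_le(4)] \<rho>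
    by simp_all
  define \<eta> where "\<eta> = \<rho> * (card ?I * M)"
  define A where "A j = ps_family ?I (\<lambda>\<alpha>. b (\<alpha>, j))" for j
  have A: "ps_bound (vjoin (vec \<rho>) (vec R)) (A j) \<eta>" for j
    unfolding A_def \<eta>_def
    by (rule ps_bound_family[OF finite_multi_indices _ b(1) M \<rho> \<rho>_le(1) R(1)]) (auto simp: multi_indices_def)
  have \<eta>: "4 * CARD('n) * \<eta> / R \<le> 1 / 12"
    using \<rho>2(3) by (simp add: \<eta>_def Q_def mult_ac)
  \<comment> \<open>The coefficientwise sum of the Lie series; it is the candidate expansion of the
    flow.\<close>
  define \<Gamma> where "\<Gamma> j \<gamma> = (\<Sum>\<^sub>\<infinity>k. ps_lie A k j \<gamma> / fact k)" for j \<gamma>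
  have "analytic_germ (\<lambda>z. gamma_map W L X (vfst z) (vsnd z) $ j)" for j
  proof -
    let ?w = "vjoin (vec (\<rho> / 2)) (vec (R / 2)) :: real ^ ('m + 'n)"
    define \<sigma> where "\<sigma> = min (\<rho> / 8) (r / 2)"
    have \<sigma>: "0 < \<sigma>" "\<sigma> \<le> \<rho> / 8" "\<sigma> \<le> r / 2" using \<rho> r by (auto simp: \<sigma>_def)
    have flow: "\<exists>\<phi>. \<phi> 0 = x \<and> integral_curve (mi_field ?I X t) (ball 0 (R / 8)) \<phi> \<and> gamma_map W L X t x = \<phi> 1"
      if "norm t \<le> \<sigma>" "norm x \<le> \<sigma>" for t x
      using gamma_map_curve[OF K(2,1) r _ \<rho>_le(1) \<rho>2(1,2) _ _ order_refl, of t x] that \<sigma> \<rho>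
      unfolding r_def by fastforce
    have Y: "mi_field ?I X t y $ i = ps_eval (A i) (vjoin t y)"
      if "norm t \<le> \<sigma>" "y \<in> ball 0 (R / 8)" for t y i
    proof -
      have yR: "y \<in> ball 0 R" using that R by simp
      have "ps_eval (A i) (vjoin t y) = (\<Sum>\<alpha>\<in>?I. mi_power t \<alpha> * ps_eval (b (\<alpha>, i)) y)"
        unfolding A_def
      proof (rule ps_eval_family[OF finite_multi_indices A[unfolded A_def]])
        show "\<bar>t $ k\<bar> \<le> vec \<rho> $ k" for k
          using component_le_norm_cart[of t k] that \<sigma> \<rho> by simp
        show "\<bar>y $ k\<bar> \<le> vec R $ k" for k by (rule in_ball_components'[OF yR])
      qed (use \<rho> in simp)
      then show ?thesis using b(2)[OF _ yR] by (simp add: mi_field_def sum_component)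
    qed
    have sums: "(\<lambda>p. ps_eval (ps_lie A p j) (vjoin t x) / fact p) sums (gamma_map W L X t x $ j)"
      and B: "\<And>p. ps_bound ?w (ps_lie A p j) (fact p * (R * (1 / 4) ^ p))"
      if n: "norm t \<le> \<sigma>" "norm x \<le> \<sigma>" for t :: "real ^ 'm" and x :: "real ^ 'n"
    proof -
      obtain \<phi> where \<phi>: "\<phi> 0 = x" "integral_curve (mi_field ?I X t) (ball 0 (R / 8)) \<phi>"
        "gamma_map W L X t x = \<phi> 1" using flow[OF n] by blast
      have "norm t \<le> \<rho> / 8" using n \<sigma> by linarith
      note * = lie_series_sums[OF A \<rho> R(1) \<eta> this \<phi>(2) Y[OF n(1)], where j = j]
      show "(\<lambda>p. ps_eval (ps_lie A p j) (vjoin t x) / fact p) sums (gamma_map W L X t x $ j)"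
        using *(2) \<phi> by simp
      show "ps_bound ?w (ps_lie A p j) (fact p * (R * (1 / 4) ^ p))" for p by (rule *(1))
    qed
    \<comment> \<open>The bounds do not mention the point, so they may be read off from the
      trajectory with \<open>t = 0\<close> and \<open>x = 0\<close>.\<close>
    have B': "ps_bound ?w (\<lambda>\<gamma>. ps_lie A p j \<gamma> / fact p) (R * (1 / 4) ^ p)" for p
      using ps_bound_cmult[OF B[of 0 0 p], of "1 / fact p"] \<sigma>(1) by simp
    have w: "0 \<le> ?w $ k" for k using \<rho> R by (simp add: vjoin_vec_nonneg)
    have c: "(\<Sum>k\<in>F. R * (1 / 4) ^ k) \<le> R * (4 / 3)" if "finite F" for F
      unfolding sum_distrib_left[symmetric] using R sum_geometric_quarter_le[OF that] by (intro mult_left_mono) auto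
    have \<Gamma>b: "ps_bound ?w (\<Gamma> j) (R * (4 / 3))"
      unfolding \<Gamma>_def[abs_def] by (rule ps_series(1)[OF B' w c])
    show ?thesis
      unfolding analytic_germ_def
    proof (intro exI conjI ballI)
      show "0 < \<sigma>" by (rule \<sigma>(1))
      have \<sigma>w: "vec \<sigma> $ k \<le> ?w $ k" for k
        using \<sigma> \<rho> r R(1) by (cases k) (auto simp: r_def)
      show "ps_bound (vec \<sigma>) (\<Gamma> j) (R * (4 / 3))"
        by (rule ps_bound_mono[OF \<Gamma>b _ \<sigma>w order_refl]) (use \<sigma> in simp)
      fix z :: "real ^ ('m + 'n)" assume z: "z \<in> ball 0 \<sigma>"
      have n: "norm (vfst z) \<le> \<sigma>" "norm (vsnd z) \<le> \<sigma>"
        using norm_vfst_le[of z] norm_vsnd_le[of z] z by auto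
      have "\<bar>z $ k\<bar> \<le> ?w $ k" for k
        using in_ball_components'[OF z, of k] \<sigma>w[of k] by linarith
      from ps_series(2)[OF B' w c this]
      have "((\<lambda>k. ps_eval (\<lambda>\<gamma>. ps_lie A k j \<gamma> / fact k) z) has_sum ps_eval (\<Gamma> j) z) UNIV"
        unfolding \<Gamma>_def[abs_def] .
      then have "(\<lambda>k. ps_eval (\<lambda>\<gamma>. ps_lie A k j \<gamma> / fact k) z) sums ps_eval (\<Gamma> j) z"
        by (rule has_sum_imp_sums)
      moreover have "ps_eval (\<lambda>\<gamma>. ps_lie A k j \<gamma> / fact k) z = ps_eval (ps_lie A k j) z / fact k" for k
        unfolding ps_eval_def by (simp add: divide_inverse mult.assoc mult.left_commute[of _ "inverse _"] infsum_cmult_right' infsum_cmult_left' mult.commute[of _ "inverse _"])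
      ultimately show "gamma_map W L X (vfst z) (vsnd z) $ j = ps_eval (\<Gamma> j) z"
        using sums[OF n] by (simp add: sums_iff)
    qed
  qed
  then show ?thesis
    by (simp add: real_analytic_near_pair_iff vfst_def vsnd_def)
qed

section \<open>Recovering the fields from the flow\<close>

text \<open>For distinct primes \<open>p\<close> an injective encoding that turns addition of
  exponents into multiplication. Comparison of keys is then a total order on monomials compatible
  with products.\<close>

definition mi_key :: "('k \<Rightarrow> nat) \<Rightarrow> nat ^ 'k \<Rightarrow> nat" where
  "mi_key p \<beta> = (\<Prod>i\<in>UNIV. p i ^ (\<beta> $ i))"

lemma distinct_primes_exist: "\<exists>p :: 'k::finite \<Rightarrow> nat. inj p \<and> (\<forall>i. prime (p i))"
proof -
  obtain B :: "nat set" where B: "finite B" "card B = CARD('k)" "B \<subseteq> {p. prime p}"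
    using infinite_arbitrarily_large[OF primes_infinite] by blast
  then obtain p where "bij_betw p (UNIV :: 'k set) B"
    using finite_same_card_bij[of "UNIV :: 'k set" B] by auto
  with B(3) show ?thesis by (intro exI[of _ p]) (auto simp: bij_betw_def)
qed

lemma mi_key_add: "mi_key p (\<alpha> + \<beta>) = mi_key p \<alpha> * mi_key p \<beta>"
  by (simp add: mi_key_def power_add prod.distrib)

context
  fixes p :: "'k::finite \<Rightarrow> nat"
  assumes inj: "inj p" and prime: "\<And>i. prime (p i)"
begin

lemma mi_key_pos: "0 < mi_key p \<beta>"
  unfolding mi_key_def using prime by (simp add: prime_gt_0_nat)

lemma multiplicity_mi_key: "multiplicity (p i) (mi_key p \<beta>) = \<beta> $ i"
proof -
  have "mi_key p \<beta> = (\<Prod>q\<in>range p. q ^ (\<beta> $ the_inv p q))"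
    unfolding mi_key_def by (subst prod.reindex[OF inj]) (simp add: the_inv_f_f[OF inj])
  also have "multiplicity (p i) \<dots> = \<beta> $ i"
    by (subst multiplicity_prod_prime_powers) (auto simp: prime the_inv_f_f[OF inj])
  finally show ?thesis .
qed

lemma mi_key_inject: "mi_key p \<alpha> = mi_key p \<beta> \<longleftrightarrow> \<alpha> = \<beta>"
  by (metis multiplicity_mi_key vec_eq_iff)

lemma mi_power_mi_key: "mi_power (\<chi> i. (1 / real (p i)) ^ s) \<beta> = (1 / real (mi_key p \<beta>)) ^ s"
proof -
  have "mi_power (\<chi> i. (1 / real (p i)) ^ s) \<beta> = (\<Prod>i\<in>UNIV. ((1 / real (p i)) ^ (\<beta> $ i)) ^ s)"
    by (simp only: mi_power_def vec_lambda_beta power_mult[symmetric] mult.commute)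
  also have "\<dots> = (\<Prod>i\<in>UNIV. (1 / real (p i)) ^ (\<beta> $ i)) ^ s"
    by (rule prod_power_distrib[symmetric])
  also have "(\<Prod>i\<in>UNIV. (1 / real (p i)) ^ (\<beta> $ i)) = 1 / real (mi_key p \<beta>)"
    by (simp add: mi_key_def power_divide prod_dividef)
  finally show ?thesis .
qed

end

text \<open>Along \<open>t\<^sub>i = p\<^sub>i\<^sup>-\<^sup>s\<close> with distinct primes \<open>p\<^sub>i\<close>, the monomials have pairwise different rates of decay
  by unique factorization.\<close>

lemma polynomial_eq_0:
  fixes D :: "nat ^ 'm \<Rightarrow> real"
  assumes B: "finite B" and zero: "\<And>t :: real ^ 'm. (\<Sum>\<alpha>\<in>B. D \<alpha> * mi_power t \<alpha>) = 0" and \<alpha>: "\<alpha> \<in> B"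
  shows "D \<alpha> = 0"
proof (rule ccontr)
  assume "D \<alpha> \<noteq> 0"
  obtain p :: "'m \<Rightarrow> nat" where p: "inj p" "\<And>i. prime (p i)" using distinct_primes_exist by blast
  note key = mi_key_pos[OF p] mi_key_inject[OF p] mi_power_mi_key[OF p]
  \<comment> \<open>The least key belongs to the slowest decay. After division by this monomial all
    other terms tend to 0 and only the coefficient at \<open>\<alpha>0\<close> survives in the
    limit.\<close>
  obtain \<alpha>0 where \<alpha>0: "\<alpha>0 \<in> B" "D \<alpha>0 \<noteq> 0" "\<And>\<beta>. \<beta> \<in> B \<Longrightarrow> D \<beta> \<noteq> 0 \<Longrightarrow> mi_key p \<alpha>0 \<le> mi_key p \<beta>"
    using ex_has_least_nat[of "\<lambda>\<beta>. \<beta> \<in> B \<and> D \<beta> \<noteq> 0" \<alpha> "mi_key p"] \<open>D \<alpha> \<noteq> 0\<close> \<alpha> by blast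
  let ?q = "\<lambda>\<beta>. real (mi_key p \<alpha>0) / real (mi_key p \<beta>)"
  have "(\<lambda>s. \<Sum>\<beta>\<in>B. D \<beta> * ?q \<beta> ^ s) \<longlonglongrightarrow> (\<Sum>\<beta>\<in>B. if \<beta> = \<alpha>0 then D \<beta> else 0)"
  proof (rule tendsto_sum)
    fix \<beta> assume \<beta>: "\<beta> \<in> B"
    show "(\<lambda>s. D \<beta> * ?q \<beta> ^ s) \<longlonglongrightarrow> (if \<beta> = \<alpha>0 then D \<beta> else 0)"
    proof (cases "\<beta> = \<alpha>0 \<or> D \<beta> = 0")
      case True
      then show ?thesis using key(1)[of \<alpha>0] by (auto simp: power_divide)
    next
      case False
      then have "mi_key p \<alpha>0 < mi_key p \<beta>"
        using \<alpha>0(3)[OF \<beta>] key(2)[of \<alpha>0 \<beta>] by (auto simp: le_less)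
      then have "?q \<beta> < 1" by simp
      then have "(\<lambda>s. ?q \<beta> ^ s) \<longlonglongrightarrow> 0" by (intro LIMSEQ_realpow_zero) auto
      from tendsto_mult_left[OF this, of "D \<beta>"] show ?thesis using False by simp
    qed
  qed
  moreover have "(\<Sum>\<beta>\<in>B. D \<beta> * ?q \<beta> ^ s) = 0" for s
  proof -
    have "(\<Sum>\<beta>\<in>B. D \<beta> * ?q \<beta> ^ s) = real (mi_key p \<alpha>0) ^ s * (\<Sum>\<beta>\<in>B. D \<beta> * mi_power (\<chi> i. (1 / real (p i)) ^ s) \<beta>)"
      unfolding key(3) by (simp add: sum_distrib_left power_divide mult_ac)
    then show ?thesis using zero by simp
  qed
  ultimately have "(\<Sum>\<beta>\<in>B. if \<beta> = \<alpha>0 then D \<beta> else 0) = 0"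
    by (simp only: LIMSEQ_const_iff)
  then show False using \<alpha>0 B by simp
qed

section \<open>Comparison of Taylor coefficients\<close>

lemma finite_mi_length_less: "finite {\<gamma> :: nat ^ 'm. mi_length \<gamma> < k}"
proof (rule finite_subset)
  show "{\<gamma> :: nat ^ 'm. mi_length \<gamma> < k} \<subseteq> insert 0 (multi_indices k)"
    by (auto simp: multi_indices_def zero_less_iff_neq_zero simp del: neq0_conv)
qed (simp add: finite_multi_indices)

text \<open>The nonvanishing part of lowest degree \<open>m \<le> k\<close> is a homogeneous
  polynomial \<open>Q\<close>. On a ray, both the smallness assumption and the Taylor remainder are
  of order \<open>m + 1\<close>, so \<open>Q\<close> vanishes on every ray and hence has zero
  coefficients.\<close>

lemma taylor_coefficients_eq_0:
  fixes D :: "nat ^ 'm \<Rightarrow> real"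
  assumes D: "ps_bound (vec R) D C" and R: "0 < R" and \<epsilon>: "0 < \<epsilon>"
    and small: "\<And>t. norm t < \<epsilon> \<Longrightarrow> \<bar>ps_eval D t\<bar> \<le> E * norm t ^ Suc k" and \<alpha>: "mi_length \<alpha> \<le> k"
  shows "D \<alpha> = 0"
proof (rule ccontr)
  assume "D \<alpha> \<noteq> 0"
  then obtain \<alpha>0 where \<alpha>0: "D \<alpha>0 \<noteq> 0" "\<And>\<beta>. D \<beta> \<noteq> 0 \<Longrightarrow> mi_length \<alpha>0 \<le> mi_length \<beta>"
    using ex_has_least_nat[of "\<lambda>\<beta>. D \<beta> \<noteq> 0" \<alpha> mi_length] by blast
  define m where "m = mi_length \<alpha>0"
  have mk: "m \<le> k" using \<alpha>0(2)[OF \<open>D \<alpha> \<noteq> 0\<close>] \<alpha> by (simp add: m_def)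
  let ?B = "{\<gamma> :: nat ^ 'm. mi_length \<gamma> < Suc m}"
  define Q where "Q t = (\<Sum>\<gamma>\<in>?B. D \<gamma> * mi_power t \<gamma>)" for t
  \<comment> \<open>By minimality of \<open>m\<close>, the coefficients of length below
    \<open>m\<close> vanish, so only terms of length exactly \<open>m\<close> contribute.\<close>
  have hom: "Q (l *\<^sub>R t) = l ^ m * Q t" for l t
    unfolding Q_def sum_distrib_left
  proof (rule sum.cong[OF refl])
    fix \<gamma> :: "nat ^ 'm" assume "\<gamma> \<in> ?B"
    then have "D \<gamma> = 0 \<or> mi_length \<gamma> = m" using \<alpha>0(2)[of \<gamma>]
      by (cases "D \<gamma> = 0") (auto simp: m_def)
    then show "D \<gamma> * mi_power (l *\<^sub>R t) \<gamma> = l ^ m * (D \<gamma> * mi_power t \<gamma>)"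
      by (auto simp: mi_power_scale)
  qed
  have "Q t = 0" for t
  proof -
    define T where "T = norm t + 1"
    have T: "1 \<le> T" "norm t < T" by (auto simp: T_def)
    \<comment> \<open>The constants of the assumed estimate and of the remainder of order
      \<open>m + 1\<close>, with the power of the ray parameter factored out.\<close>
    define E' where "E' = \<bar>E\<bar> * T ^ Suc k + (T / R) ^ Suc m * C"
    define l0 where "l0 = Min {1, \<epsilon> / T, R / T}"
    have l0: "0 < l0" "l0 \<le> 1" "l0 \<le> \<epsilon> / T" "l0 \<le> R / T" using T R \<epsilon> by (auto simp: l0_def)
    have le: "\<bar>Q t\<bar> \<le> l * E'" if l: "0 < l" "l < l0" for l
    proof -
      have "l * T < l0 * T" using l T by (intro mult_strict_right_mono) auto
      moreover have "l0 * T \<le> \<epsilon>" "l0 * T \<le> R" using l0 T by (auto simp: field_simps)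
      ultimately have lT: "l * T < \<epsilon>" "l * T \<le> R" by linarith+
      have n: "norm (l *\<^sub>R t) \<le> l * T" using l T by simp
      have "\<bar>(l *\<^sub>R t) $ i\<bar> \<le> (l * T / R) * vec R $ i" for i
        using component_le_norm_cart[of "l *\<^sub>R t" i] n R by simp
      from ps_eval_remainder[OF D _ _ _ this, of "Suc m"]
      have "\<bar>ps_eval D (l *\<^sub>R t) - Q (l *\<^sub>R t)\<bar> \<le> (l * T / R) ^ Suc m * C"
        using l T R lT unfolding Q_def by simp
      moreover have "\<bar>ps_eval D (l *\<^sub>R t)\<bar> \<le> \<bar>E\<bar> * (l * T) ^ Suc k"
      proof -
        have "\<bar>ps_eval D (l *\<^sub>R t)\<bar> \<le> E * norm (l *\<^sub>R t) ^ Suc k"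
          by (rule small) (use n lT in linarith)
        also have "\<dots> \<le> \<bar>E\<bar> * norm (l *\<^sub>R t) ^ Suc k" by (intro mult_right_mono) auto
        also have "\<dots> \<le> \<bar>E\<bar> * (l * T) ^ Suc k" using n by (intro mult_left_mono power_mono) auto
        finally show ?thesis .
      qed
      moreover have "l ^ Suc k \<le> l ^ Suc m" using l l0 mk by (intro power_decreasing) auto
      then have "\<bar>E\<bar> * (l * T) ^ Suc k \<le> l ^ Suc m * (\<bar>E\<bar> * T ^ Suc k)"
        unfolding power_mult_distrib using T mult_right_mono[of "l ^ Suc k" "l ^ Suc m" "\<bar>E\<bar> * T ^ Suc k"]
        by (simp add: mult_ac del: power_Suc)
      ultimately have "\<bar>Q (l *\<^sub>R t)\<bar> \<le> l ^ Suc m * (\<bar>E\<bar> * T ^ Suc k) + (l * T / R) ^ Suc m * C"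
        by linarith
      also have "(l * T / R) ^ Suc m * C = l ^ Suc m * ((T / R) ^ Suc m * C)"
        unfolding times_divide_eq_right[symmetric] power_mult_distrib by (simp only: mult.assoc)
      finally have "l ^ m * \<bar>Q t\<bar> \<le> l ^ m * (l * E')"
        using l by (simp add: hom E'_def abs_mult distrib_left mult_ac)
      then show ?thesis using l by simp
    qed
    have "((\<lambda>l. l * E') \<longlongrightarrow> 0 * E') (at_right 0)" by (intro tendsto_intros)
    moreover have "\<forall>\<^sub>F l in at_right 0. \<bar>Q t\<bar> \<le> l * E'"
      using eventually_at_right_less[of "0::real"] eventually_at_right_real[OF l0(1)]
      by eventually_elim (auto intro: le)
    ultimately have "\<bar>Q t\<bar> \<le> 0 * E'" by (rule tendsto_lowerbound) simp
    then show "Q t = 0" by simp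
  qed
  then have "D \<alpha>0 = 0"
    by (intro polynomial_eq_0[of ?B D, folded Q_def, OF finite_mi_length_less]) (simp_all add: m_def)
  with \<alpha>0 show False by simp
qed

text \<open>Evaluating the second block inside its polyradius does not increase the norm: the
  weighted double family is summed by sections, with the same constant.\<close>

lemma ps_bound_partial_eval:
  assumes a: "ps_bound (vjoin v w) a C" and v: "\<And>i. 0 \<le> v $ i" and x: "\<And>j. \<bar>x $ j\<bar> \<le> w $ j"
  shows "ps_bound v (\<lambda>\<alpha>. ps_eval (\<lambda>\<beta>. a (vjoin \<alpha> \<beta>)) x) C"
  unfolding ps_bound_def
proof (intro allI impI)
  let ?T = "\<lambda>p. a (vjoin (fst p) (snd p)) * mi_power (vjoin v x) (vjoin (fst p) (snd p))"
  have T: "(\<Sum>p\<in>G. \<bar>?T p\<bar>) \<le> C" if G: "finite G" for G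
  proof -
    have z: "\<bar>vjoin v x $ k\<bar> \<le> vjoin v w $ k" for k using v x by (cases k) auto
    have "(\<Sum>p\<in>G. \<bar>?T p\<bar>) = (\<Sum>\<gamma>\<in>(\<lambda>p. vjoin (fst p) (snd p)) ` G. \<bar>a \<gamma> * mi_power (vjoin v x) \<gamma>\<bar>)"
      by (subst sum.reindex) (auto simp: inj_on_def)
    also have "\<dots> \<le> C" using G by (intro ps_terms_bounded[OF a z]) auto
    finally show ?thesis .
  qed
  fix F :: "(nat ^ 'a) set" assume F: "finite F"
  have "(\<Sum>\<^sub>\<infinity>\<beta>. ?T (\<alpha>, \<beta>)) = ps_eval (\<lambda>\<beta>. a (vjoin \<alpha> \<beta>)) x * mi_power v \<alpha>" for \<alpha>
    unfolding ps_eval_def infsum_cmult_left'[symmetric] by (simp add: mi_power_vjoin mult_ac)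
  with has_sum_sections(3)[OF T F]
  show "(\<Sum>\<alpha>\<in>F. \<bar>ps_eval (\<lambda>\<beta>. a (vjoin \<alpha> \<beta>)) x\<bar> * mi_power v \<alpha>) \<le> C"
    using mi_power_nonneg[OF v] by (simp add: abs_mult)
qed

lemma norm_vjoin_le: "norm (vjoin t x) \<le> norm t + norm x" for t :: "real ^ 'm" and x :: "real ^ 'n"
proof -
  have "(norm (vjoin t x))\<^sup>2 = (norm t)\<^sup>2 + (norm x)\<^sup>2"
    unfolding norm_vec_def L2_set_def sum_UNIV_sum_type by (simp add: sum_nonneg)
  also have "\<dots> \<le> (norm t + norm x)\<^sup>2" by (simp add: power2_sum)
  finally show ?thesis by (rule power2_le_imp_le) simp
qed

lemma mi_field_Un: "finite A \<Longrightarrow> finite B \<Longrightarrow> A \<inter> B = {} \<Longrightarrow>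
    mi_field (A \<union> B) X t y = mi_field A X t y + mi_field B X t y"
  unfolding mi_field_def by (rule sum.union_disjoint)

text \<open>The full and the truncated curve differ by order \<open>k + 1\<close> in
  \<open>t\<close>. Since the lower-order fields have Lipschitz constant of order 1, and the fields
  of order \<open>k + 1\<close> are integrated along a curve that moves by order 1, all deviations
  from the straight contribution of order \<open>k + 1\<close> have order
  \<open>k + 2\<close>.\<close>

lemma gamma_map_truncation:
  fixes X :: "nat ^ 'm \<Rightarrow> real ^ 'n \<Rightarrow> real ^ 'n"
  assumes fb: "field_bounds (multi_indices L) X r K" and K: "0 \<le> K" and r: "0 < r" and W: "cball 0 r \<subseteq> W"
    and \<rho>: "0 \<le> \<rho>" "\<rho> \<le> 1" "K * \<rho> \<le> 1 / 2" "K * \<rho> \<le> r / 4" and t: "norm t \<le> \<rho>" and x: "norm x \<le> r / 2"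
    and k: "k < L"
  shows "norm (gamma_map W L X t x - gamma_map W k X t x - mi_field {\<alpha>. mi_length \<alpha> = Suc k} X t x)
    \<le> (3 * K\<^sup>2 + K) * norm t ^ Suc (Suc k)"
proof -
  obtain \<phi> where \<phi>: "\<phi> 0 = x" "integral_curve (mi_field (multi_indices L) X t) (ball 0 r) \<phi>"
    "gamma_map W L X t x = \<phi> 1" "\<And>s. s \<in> {0..1} \<Longrightarrow> norm (\<phi> s - x) \<le> K * norm t"
    using gamma_map_curve[OF fb K r W \<rho> t x order_refl] by blast
  obtain \<psi> where \<psi>: "\<psi> 0 = x" "integral_curve (mi_field (multi_indices k) X t) (ball 0 r) \<psi>"
    "gamma_map W k X t x = \<psi> 1"
    using gamma_map_curve[OF fb K r W \<rho> t x less_imp_le[OF k]] by blast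
  have t1: "norm t \<le> 1" using t \<rho> by linarith
  let ?A = "multi_indices k :: (nat ^ 'm) set" and ?B = "{\<alpha> :: nat ^ 'm. mi_length \<alpha> = Suc k}"
    and ?C = "{\<alpha> :: nat ^ 'm. Suc k < mi_length \<alpha> \<and> mi_length \<alpha> \<le> L}"
  have sub: "?A \<subseteq> multi_indices L" "?B \<subseteq> multi_indices L" "?C \<subseteq> multi_indices L" "?B \<union> ?C \<subseteq> multi_indices L"
    using k by (auto simp: multi_indices_def)
  note fin = finite_subset[OF sub(1) finite_multi_indices] finite_subset[OF sub(2) finite_multi_indices]
    finite_subset[OF sub(3) finite_multi_indices]
  have L: "multi_indices L = ?A \<union> (?B \<union> ?C)" using k by (auto simp: multi_indices_def)
  have Y: "mi_field (multi_indices L) X t y = mi_field ?A X t y + (mi_field ?B X t y + mi_field ?C X t y)" for y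
    unfolding L using fin by (subst mi_field_Un mi_field_Un; auto simp: multi_indices_def)+
  have BC: "mi_field (?B \<union> ?C) X t y = mi_field ?B X t y + mi_field ?C X t y" for y
    using fin by (intro mi_field_Un) auto
  have x': "x \<in> cball 0 r" using x r by simp
  have Kt: "K * norm t \<le> 1 / 2" using mult_left_mono[OF t K] \<rho>(3) by linarith
  have A_lip: "norm (mi_field ?A X t y - mi_field ?A X t z) \<le> K * norm t * norm (y - z)"
    if "y \<in> ball 0 r" "z \<in> ball 0 r" for y z
    using field_boundsD(2)[OF fb sub(1) _ t1, of 1 y z] that by (auto simp: multi_indices_def)
  have close: "norm (\<phi> s - \<psi> s) \<le> 2 * (K * norm t ^ Suc k)" if "s \<in> {0..1}" for s
  proof (rule integral_curves_close[OF \<phi>(2) \<psi>(2) _ _ _ that])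
    show "\<phi> 0 = \<psi> 0" using \<phi> \<psi> by simp
    fix y z assume yz: "y \<in> ball (0 :: real ^ 'n) r" "z \<in> ball (0 :: real ^ 'n) r"
    have "K * norm t * norm (y - z) \<le> 1 / 2 * norm (y - z)" using Kt by (intro mult_right_mono) auto
    with A_lip[OF yz] show "norm (mi_field ?A X t y - mi_field ?A X t z) \<le> norm (y - z) / 2" by simp
  next
    fix y assume y: "y \<in> ball (0 :: real ^ 'n) r"
    have "norm (mi_field (?B \<union> ?C) X t y) \<le> K * norm t ^ Suc k"
      by (rule field_boundsD(1)[OF fb sub(4) _ t1]) (use y in auto)
    then show "norm (mi_field (multi_indices L) X t y - mi_field ?A X t y) \<le> K * norm t ^ Suc k"
      by (simp add: Y BC)
  qed
  let ?M = "(3 * K\<^sup>2 + K) * norm t ^ Suc (Suc k)"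
  \<comment> \<open>The three error terms contribute \<open>2 * K\<^sup>2\<close> from the
    lower-order fields on the two curves, \<open>K\<^sup>2\<close> from the motion of \<phi> away
    from \<open>x\<close>, and \<open>K\<close> from the fields of higher order.\<close>
  let ?f = "\<lambda>s. \<phi> s - \<psi> s - s *\<^sub>R mi_field ?B X t x"
  let ?f' = "\<lambda>s. mi_field (multi_indices L) X t (\<phi> s) - mi_field ?A X t (\<psi> s) - mi_field ?B X t x"
  have "norm (?f 1 - ?f 0) \<le> ?M * 1"
  proof (rule vector_derivative_bound_01[where f' = ?f'])
    show "(?f has_vector_derivative ?f' s) (at s within {0..1})" if "s \<in> {0..1}" for s
      by (intro has_vector_derivative_diff integral_curveD(2)[OF \<phi>(2) that] integral_curveD(2)[OF \<psi>(2) that])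
         (auto intro!: derivative_eq_intros)
    fix s :: real assume "0 < s" "s < 1"
    then have s: "s \<in> {0..1}" by simp
    note in_r = integral_curveD(1)[OF \<phi>(2) s] integral_curveD(1)[OF \<psi>(2) s]
    have 1: "norm (mi_field ?A X t (\<phi> s) - mi_field ?A X t (\<psi> s)) \<le> K * norm t * (2 * (K * norm t ^ Suc k))"
      using A_lip[OF in_r] mult_left_mono[OF close[OF s], of "K * norm t"] K by (meson mult_nonneg_nonneg norm_ge_zero order_trans)
    have "norm (mi_field ?B X t (\<phi> s) - mi_field ?B X t x) \<le> K * norm t ^ Suc k * norm (\<phi> s - x)"
      by (rule field_boundsD(2)[OF fb sub(2) _ t1 _ x']) (use in_r in auto)
    also have "\<dots> \<le> K * norm t ^ Suc k * (K * norm t)"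
      using \<phi>(4)[OF s] K by (intro mult_left_mono) auto
    finally have 2: "norm (mi_field ?B X t (\<phi> s) - mi_field ?B X t x) \<le> K * norm t ^ Suc k * (K * norm t)" .
    have 3: "norm (mi_field ?C X t (\<phi> s)) \<le> K * norm t ^ Suc (Suc k)"
      by (rule field_boundsD(1)[OF fb sub(3) _ t1]) (use in_r in auto)
    have "?f' s = (mi_field ?A X t (\<phi> s) - mi_field ?A X t (\<psi> s)) +
        ((mi_field ?B X t (\<phi> s) - mi_field ?B X t x) + mi_field ?C X t (\<phi> s))" by (simp add: Y)
    also have "norm \<dots> \<le> K * norm t * (2 * (K * norm t ^ Suc k)) + (K * norm t ^ Suc k * (K * norm t) + K * norm t ^ Suc (Suc k))"
      by (intro norm_triangle_le add_mono 1 2 3)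
    also have "\<dots> = ?M" by (simp add: power2_eq_square algebra_simps)
    finally show "norm (?f' s) \<le> ?M" .
  qed auto
  then show ?thesis using \<phi>(1,3) \<psi>(1,3) by simp
qed

text \<open>The truncated flow is analytic by the induction hypothesis, so the difference of the two
  flows has one joint expansion in \<open>(t, x)\<close>. Its section at \<alpha> is the power
  series of \<open>X \<alpha>\<close>.\<close>

theorem fields_analytic_of_gamma_map:
  fixes X :: "nat ^ 'm \<Rightarrow> real ^ 'n \<Rightarrow> real ^ 'n"
  assumes W: "open W" "0 \<in> W" and sm: "\<And>\<alpha>. \<alpha> \<in> multi_indices L \<Longrightarrow> smooth_on (X \<alpha>) W"
    and an: "real_analytic_near (\<lambda>(t, x). gamma_map W L X t x) (0, 0)"
  shows "k \<le> L \<Longrightarrow> \<alpha> \<in> multi_indices k \<Longrightarrow> real_analytic_near (X \<alpha>) 0"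
proof (induction k arbitrary: \<alpha>)
  case 0
  then have False unfolding multi_indices_def mem_Collect_eq by linarith
  then show ?case ..
next
  case (Suc k)
  show ?case
  proof (cases "mi_length \<alpha> = Suc k")
    case False
    then have "\<alpha> \<in> multi_indices k" using Suc.prems by (auto simp: multi_indices_def)
    with Suc show ?thesis by simp
  next
    case \<alpha>: True
    have sub: "multi_indices k \<subseteq> (multi_indices L :: (nat ^ 'm) set)" using Suc.prems by (auto simp: multi_indices_def)
    have an': "real_analytic_near (\<lambda>(t, x). gamma_map W k X t x) (0, 0)"
      by (rule gamma_map_analytic[OF W]) (use sm sub Suc in auto)
    obtain r where r: "0 < r" "cball 0 r \<subseteq> W" using W open_contains_cball by blast
    have "\<exists>K\<ge>0. field_bounds (multi_indices L) X r K"
      by (rule field_bounds_exist[OF finite_multi_indices _ r(2)]) (rule sm)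
    then obtain K where K: "0 \<le> K" "field_bounds (multi_indices L) X r K" by (elim exE conjE) (rule that)
    define \<rho> where "\<rho> = Min {1, (1 / 2) / (K + 1), (r / 4) / (K + 1)}"
    have \<rho>: "0 < \<rho>" using K(1) r(1) by (simp add: \<rho>_def)
    have \<rho>_le: "\<rho> \<le> 1" "\<rho> \<le> (1 / 2) / (K + 1)" "\<rho> \<le> (r / 4) / (K + 1)"
      unfolding \<rho>_def by (rule Min_le; simp)+
    have \<rho>2: "K * \<rho> \<le> 1 / 2" "K * \<rho> \<le> r / 4"
      using mult_le_of_le_divide[OF K(1) _ \<rho>_le(2)] mult_le_of_le_divide[OF K(1) _ \<rho>_le(3)] \<rho> by simp_all
    let ?B = "{\<alpha> :: nat ^ 'm. mi_length \<alpha> = Suc k}"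
    have finB: "finite ?B" by (rule finite_subset[OF _ finite_mi_length_less[of "Suc (Suc k)"]]) auto
    have "analytic_germ (\<lambda>x. X \<alpha> x $ j)" for j
    proof -
      have "analytic_germ (\<lambda>z. gamma_map W L X (vfst z) (vsnd z) $ j)"
        "analytic_germ (\<lambda>z. gamma_map W k X (vfst z) (vsnd z) $ j)"
        using an an' unfolding real_analytic_near_pair_iff vfst_def vsnd_def by simp_all
      from analytic_germ_diff[OF this] obtain a R C where R: "0 < R" and a: "ps_bound (vec R) a C"
        and eq: "\<And>z. z \<in> ball 0 R \<Longrightarrow> gamma_map W L X (vfst z) (vsnd z) $ j - gamma_map W k X (vfst z) (vsnd z) $ j = ps_eval a z"
        unfolding analytic_germ_def by blast
      have "vec R = (vjoin (vec R) (vec R) :: real ^ ('m + 'n))" by (auto simp: vec_eq_iff vjoin_def split: sum.split)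
      with a have a: "ps_bound (vjoin (vec R) (vec R)) a C" by simp
      \<comment> \<open>With \<open>norm t < R / 2\<close> the joint point stays in the ball of
        radius \<open>R\<close>; the bound \<open>r / 2\<close> keeps \<open>x\<close> admissible as
        an initial point.\<close>
      define \<sigma> where "\<sigma> = min (R / 2) (r / 2)"
      have \<sigma>: "0 < \<sigma>" "\<sigma> \<le> R / 2" "\<sigma> \<le> r / 2" using R r by (auto simp: \<sigma>_def)
      have eval: "X \<alpha> x $ j = ps_eval (\<lambda>\<beta>. a (vjoin \<alpha> \<beta>)) x" if x: "x \<in> ball 0 \<sigma>" for x
      proof -
        have xR: "\<bar>x $ i\<bar> \<le> vec R $ i" for i
          using in_ball_components'[OF x, of i] \<sigma> R by simp
        \<comment> \<open>For fixed \<open>x\<close>, \<open>D0\<close> lists the Taylor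
          coefficients in \<open>t\<close> of the difference of the flows, and \<open>D1\<close>
          subtracts the homogeneous part of order \<open>k + 1\<close>. Their sum is the series of
          an error of order \<open>k + 2\<close>, so its coefficient at \<alpha> vanishes.\<close>
        define D0 where "D0 \<gamma> = ps_eval (\<lambda>\<beta>. a (vjoin \<gamma> \<beta>)) x" for \<gamma>
        define D1 where "D1 \<gamma> = (if \<gamma> \<in> ?B then - (X \<gamma> x $ j) else 0)" for \<gamma>
        have D0: "ps_bound (vec R) D0 C" unfolding D0_def[abs_def]
          by (rule ps_bound_partial_eval[OF a _ xR]) (use R in simp)
        have D1: "ps_bound (vec R) D1 (\<Sum>\<gamma>\<in>?B. \<bar>D1 \<gamma>\<bar> * mi_power (vec R) \<gamma>)"
          by (rule ps_bound_finite_support[OF finB]) (use R in \<open>auto simp: D1_def\<close>)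
        define D where "D \<gamma> = D0 \<gamma> + D1 \<gamma>" for \<gamma>
        have D: "ps_bound (vec R) D (C + (\<Sum>\<gamma>\<in>?B. \<bar>D1 \<gamma>\<bar> * mi_power (vec R) \<gamma>))"
          unfolding D_def[abs_def] by (rule ps_bound_add[OF D0 D1]) (use R in simp)
        have "D \<alpha> = 0"
        proof (rule taylor_coefficients_eq_0[OF D R])
          show "0 < min \<rho> (R / 2)" using \<rho> R by simp
          show "mi_length \<alpha> \<le> Suc k" using \<alpha> by simp
          fix t :: "real ^ 'm" assume t: "norm t < min \<rho> (R / 2)"
          have tR: "\<bar>t $ i\<bar> \<le> vec R $ i" for i
            using component_le_norm_cart[of t i] t R by simp
          have "norm (vjoin t x) < R"
          proof -
            have "norm (vjoin t x) \<le> norm t + norm x" by (rule norm_vjoin_le)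
            then show ?thesis using t x \<sigma> by simp
          qed
          then have "ps_eval a (vjoin t x) = gamma_map W L X t x $ j - gamma_map W k X t x $ j"
            using eq[of "vjoin t x"] by simp
          moreover have "ps_eval D0 t = ps_eval a (vjoin t x)"
            using ps_has_sum_split[OF a _ tR xR] R by (intro ps_evalI) (simp add: D0_def mult.commute)
          moreover have "ps_eval D1 t = - (mi_field ?B X t x $ j)"
            by (subst ps_eval_finite_support[OF finB])
               (auto simp: D1_def mi_field_def sum_component sum_negf[symmetric] mult.commute intro!: sum.cong)
          moreover have "ps_eval D t = ps_eval D0 t + ps_eval D1 t"
            unfolding D_def[abs_def] by (rule ps_eval_add[OF D0 D1 tR])
          ultimately have "ps_eval D t = (gamma_map W L X t x - gamma_map W k X t x - mi_field ?B X t x) $ j"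
            by simp
          also have "\<bar>\<dots>\<bar> \<le> norm (gamma_map W L X t x - gamma_map W k X t x - mi_field ?B X t x)"
            by (rule component_le_norm_cart)
          also have "\<dots> \<le> (3 * K\<^sup>2 + K) * norm t ^ Suc (Suc k)"
            using \<rho> t x \<sigma> Suc.prems
            by (intro gamma_map_truncation[OF K(2,1) r _ \<rho>_le(1) \<rho>2]) auto
          finally show "\<bar>ps_eval D t\<bar> \<le> (3 * K\<^sup>2 + K) * norm t ^ Suc (Suc k)" .
        qed
        then show ?thesis using \<alpha> by (simp add: D_def D0_def D1_def)
      qed
      show ?thesis
        unfolding analytic_germ_def
      proof (intro exI conjI ballI)
        show "0 < \<sigma>" by (rule \<sigma>(1))
        show "ps_bound (vec \<sigma>) (\<lambda>\<beta>. a (vjoin \<alpha> \<beta>)) (C / mi_power (vec R) \<alpha>)"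
          by (rule ps_bound_mono[OF ps_bound_section[OF a] _ _ order_refl]) (use \<sigma> R in auto)
      qed (rule eval)
    qed
    then show ?thesis by (simp add: real_analytic_near_vec_iff)
  qed
qed

section \<open>Division of vector-valued power series\<close>

lemma mono_subseq_nat: "\<exists>g :: nat \<Rightarrow> nat. strict_mono g \<and> mono (\<lambda>n. f (g n))" for f :: "nat \<Rightarrow> nat"
proof -
  obtain g where g: "strict_mono g" "monoseq (\<lambda>n. f (g n))" using seq_monosub[of f] by blast
  show ?thesis
  proof (cases "incseq (\<lambda>n. f (g n))")
    case True
    with g show ?thesis by blast
  next
    case False
    then have dec: "decseq (\<lambda>n. f (g n))" using g(2) by (simp add: monoseq_iff)
    obtain N where N: "\<And>n. f (g N) \<le> f (g n)" using ex_has_least_nat[of "\<lambda>_. True" 0 "\<lambda>n. f (g n)"] by auto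
    have "f (g (N + n)) = f (g N)" for n
      using decseqD[OF dec, of N "N + n"] N[of "N + n"] by simp
    then have "mono (\<lambda>n. f (g (N + n)))" by (simp add: mono_def)
    moreover have "strict_mono (\<lambda>n. g (N + n))" using g(1) by (simp add: strict_mono_def)
    ultimately show ?thesis by (intro exI[of _ "\<lambda>n. g (N + n)"]) simp
  qed
qed

lemma mono_subseq_finite:
  fixes f :: "nat \<Rightarrow> 'k \<Rightarrow> nat"
  assumes "finite I"
  shows "\<exists>g :: nat \<Rightarrow> nat. strict_mono g \<and> (\<forall>i\<in>I. mono (\<lambda>n :: nat. f (g n) i))"
  using assms
proof (induction I)
  case empty
  show ?case by (intro exI[of _ "\<lambda>n. n"]) (simp add: strict_mono_def)
next
  case (insert i I)
  then obtain g :: "nat \<Rightarrow> nat" where g: "strict_mono g" "\<forall>i\<in>I. mono (\<lambda>n :: nat. f (g n) i)" by blast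
  obtain h :: "nat \<Rightarrow> nat" where h: "strict_mono h" "mono (\<lambda>n :: nat. f (g (h n)) i)"
    using mono_subseq_nat[of "\<lambda>n. f (g n) i"] by blast
  have "mono (\<lambda>n :: nat. f (g (h n)) k)" if "k \<in> I" for k
    using g(2) that strict_mono_mono[OF h(1)] by (simp add: mono_def)
  moreover have "strict_mono (\<lambda>n. g (h n))" using g(1) h(1) by (simp add: strict_mono_def)
  ultimately show ?case using h(2) by (intro exI[of _ "\<lambda>n. g (h n)"]) auto
qed

text \<open>The minimal elements suffice. Infinitely many of them would contain a sequence that is
  monotone in every coordinate, hence two distinct comparable minimal elements. Below every element
  lies a minimal one, namely one of least length.\<close>

lemma dickson:
  fixes E :: "(nat ^ 'k) set"
  shows "\<exists>B\<subseteq>E. finite B \<and> (\<forall>x\<in>E. \<exists>y\<in>B. y \<le> x)"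
proof -
  define B where "B = {x \<in> E. \<forall>y\<in>E. y \<le> x \<longrightarrow> y = x}"
  have "finite B"
  proof (rule ccontr)
    assume "infinite B"
    then have "\<exists>f :: nat \<Rightarrow> nat ^ 'k. inj f \<and> range f \<subseteq> B"
      by (simp only: infinite_iff_countable_subset)
    then obtain f :: "nat \<Rightarrow> nat ^ 'k" where f: "inj f" "range f \<subseteq> B" by blast
    obtain g :: "nat \<Rightarrow> nat" where g: "strict_mono g" "\<And>i. mono (\<lambda>n :: nat. f (g n) $ i)"
      using mono_subseq_finite[OF finite[of UNIV], of "\<lambda>n i. f n $ i"] by auto
    have "f (g 0) \<le> f (g 1)" using g(2) by (simp add: less_eq_vec_def mono_def)
    moreover have "f (g 0) \<in> E" "\<forall>y\<in>E. y \<le> f (g 1) \<longrightarrow> y = f (g 1)" using f(2) unfolding B_def by auto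
    ultimately have "f (g 0) = f (g 1)" by blast
    then have "g 0 = g 1" using f(1) by (simp add: inj_eq)
    then show False using g(1) strict_mono_eq[of g 0 1] by simp
  qed
  moreover have "\<exists>y\<in>B. y \<le> x" if x: "x \<in> E" for x
  proof -
    obtain y where y: "y \<in> E \<and> y \<le> x" "\<And>z. z \<in> E \<and> z \<le> x \<Longrightarrow> mi_length y \<le> mi_length z"
      using ex_has_least_nat[of "\<lambda>y. y \<in> E \<and> y \<le> x" x mi_length] x by blast
    have "z = y" if z: "z \<in> E" "z \<le> y" for z
    proof (rule ccontr)
      assume "z \<noteq> y"
      then obtain i where "z $ i \<noteq> y $ i" by (auto simp: vec_eq_iff)
      then have "mi_length z < mi_length y"
        unfolding mi_length_def using z(2)
        by (intro sum_strict_mono_ex1) (auto simp: less_eq_vec_def intro!: exI[of _ i] le_neq_implies_less)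
      moreover have "z \<le> x" using z y order_trans by blast
      ultimately show False using y(2)[of z] z by simp
    qed
    then show ?thesis using y by (auto simp: B_def)
  qed
  ultimately show ?thesis by (intro exI[of _ B]) (auto simp: B_def)
qed

text \<open>Monomials \<open>x\<^sup>\<beta> e\<^sub>j\<close> of vector-valued power series are ordered by an additive integer key, injective
  by unique factorization. With weights \<open>key\<^sup>-\<^sup>s\<close>, i.e. on a polydisc of radii \<open>p\<^sub>i\<^sup>-\<^sup>s\<close>, the leading term of a
  convergent series dominates once \<open>s\<close> is large, so that division by leading terms converges.\<close>

locale monomial_key =
  fixes p :: "'n::finite + 'j::finite \<Rightarrow> nat"
  assumes inj_p: "inj p" and prime_p: "\<And>k. prime (p k)"
begin

definition skey :: "nat ^ 'n \<Rightarrow> nat" where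
  "skey = mi_key (\<lambda>i. p (Inl i))"

text \<open>The primes with index \<open>Inl\<close> encode the exponent; a single prime with index
  \<open>Inr\<close> marks the component.\<close>

definition key :: "(nat ^ 'n) \<times> 'j \<Rightarrow> nat" where
  "key q = skey (fst q) * p (Inr (snd q))"

definition wt :: "nat \<Rightarrow> (nat ^ 'n) \<times> 'j \<Rightarrow> real" where
  "wt s q = (1 / real (key q)) ^ s"

definition swt :: "nat \<Rightarrow> nat ^ 'n \<Rightarrow> real" where
  "swt s \<beta> = (1 / real (skey \<beta>)) ^ s"

definition vbound :: "nat \<Rightarrow> ((nat ^ 'n) \<times> 'j \<Rightarrow> real) \<Rightarrow> real \<Rightarrow> bool" where
  "vbound s h C \<longleftrightarrow> (\<forall>F. finite F \<longrightarrow> (\<Sum>q\<in>F. \<bar>h q\<bar> * wt s q) \<le> C)"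

text \<open>Leading means lowest: at every scale the least key carries the largest weight, as is
  appropriate for power series at the origin.\<close>

definition lead :: "((nat ^ 'n) \<times> 'j \<Rightarrow> real) \<Rightarrow> (nat ^ 'n) \<times> 'j \<Rightarrow> bool" where
  "lead h q \<longleftrightarrow> h q \<noteq> 0 \<and> (\<forall>q'. key q' < key q \<longrightarrow> h q' = 0)"

lemma skey_pos: "0 < skey \<beta>"
  unfolding skey_def using inj_p prime_p by (intro mi_key_pos) (auto simp: inj_def)

lemma key_pos: "0 < key q"
  using skey_pos prime_p by (simp add: key_def prime_gt_0_nat)

lemma skey_add: "skey (\<alpha> + \<beta>) = skey \<alpha> * skey \<beta>"
  by (simp add: skey_def mi_key_add)

lemma key_add: "key (\<alpha> + \<beta>, j) = skey \<alpha> * key (\<beta>, j)"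
  by (simp add: key_def skey_add)

lemma inj_key: "key q = key q' \<Longrightarrow> q = q'"
proof -
  have "key q = mi_key p (vjoin (fst q) (axis (snd q) 1))" for q
  proof -
    have "(\<Prod>j\<in>UNIV. p (Inr j) ^ (axis (snd q) 1 $ j)) = (\<Prod>j\<in>UNIV. if snd q = j then p (Inr j) else 1)"
      by (intro prod.cong) (auto simp: axis_def)
    then show ?thesis
      by (simp add: key_def skey_def mi_key_def prod_UNIV_sum_type)
  qed
  moreover assume "key q = key q'"
  ultimately have "vjoin (fst q) (axis (snd q) (1::nat)) = vjoin (fst q') (axis (snd q') 1)"
    using mi_key_inject[OF inj_p prime_p] by metis
  then show "q = q'" by (simp add: prod_eq_iff axis_eq_axis)
qed

lemma finite_key_le: "finite {q. key q \<le> N}"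
proof -
  have "inj key" using inj_key by (rule injI)
  then have "finite (key -` {..N})" by (intro finite_vimageI) auto
  then show ?thesis by (simp add: vimage_def)
qed

lemma wt_pos: "0 < wt s q" and swt_pos: "0 < swt s \<beta>"
  using key_pos skey_pos by (simp_all add: wt_def swt_def)

lemma wt_nonneg [simp]: "0 \<le> wt s q" and swt_nonneg [simp]: "0 \<le> swt s \<beta>"
  using wt_pos swt_pos less_imp_le by blast+

lemma wt_add: "wt s (\<alpha> + \<beta>, j) = swt s \<alpha> * wt s (\<beta>, j)"
  by (simp add: wt_def swt_def key_add power_mult_distrib[symmetric])

lemma swt_eq: "swt s \<beta> = mi_power (\<chi> i. (1 / real (p (Inl i))) ^ s) \<beta>"
  unfolding swt_def skey_def using inj_p prime_p
  by (subst mi_power_mi_key) (auto simp: inj_def)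

lemma wt_mono: "s \<le> s' \<Longrightarrow> wt s' q \<le> wt s q"
  using key_pos[of q] unfolding wt_def by (intro power_decreasing) auto

lemma wt_le_swt: "wt s q \<le> swt s (fst q)"
proof -
  have "skey (fst q) \<le> key q" using prime_p[of "Inr (snd q)"] by (simp add: key_def prime_gt_0_nat Suc_leI)
  then show ?thesis
    unfolding wt_def swt_def using key_pos skey_pos by (intro power_mono divide_left_mono) auto
qed

lemma vboundD: "vbound s h C \<Longrightarrow> finite F \<Longrightarrow> (\<Sum>q\<in>F. \<bar>h q\<bar> * wt s q) \<le> C"
  by (simp add: vbound_def)

lemma vbound_mono:
  assumes "vbound s h C" "s \<le> s'"
  shows "vbound s' h C"
  unfolding vbound_def
proof (intro allI impI)
  fix F :: "((nat ^ 'n) \<times> 'j) set" assume "finite F"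
  have "(\<Sum>q\<in>F. \<bar>h q\<bar> * wt s' q) \<le> (\<Sum>q\<in>F. \<bar>h q\<bar> * wt s q)"
    using assms by (intro sum_mono mult_left_mono wt_mono) auto
  also have "\<dots> \<le> C" using vboundD[OF assms(1) \<open>finite F\<close>] .
  finally show "(\<Sum>q\<in>F. \<bar>h q\<bar> * wt s' q) \<le> C" .
qed

text \<open>Keys are integers, so every other key in the support exceeds the leading key by at least
  one. Raising the scale by \<open>m\<close> therefore shrinks the tail relative to the leading
  weight by the factor \<open>(?k / (?k + 1)) ^ m\<close>.\<close>

lemma tail_small:
  assumes g: "vbound s0 g C" and q0: "lead g q0" and \<epsilon>: "0 < \<epsilon>"
  shows "\<exists>s1. \<forall>s\<ge>s1. \<forall>F. finite F \<longrightarrow> q0 \<notin> F \<longrightarrow> (\<Sum>q\<in>F. \<bar>g q\<bar> * wt s q) \<le> \<epsilon> * wt s q0"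
proof -
  let ?k = "real (key q0)"
  have k: "0 < ?k" using key_pos by simp
  have C: "0 \<le> C" using vboundD[OF g, of "{}"] by simp
  have "(\<lambda>m. C * (?k / (?k + 1)) ^ m) \<longlonglongrightarrow> C * 0"
    using k by (intro tendsto_intros LIMSEQ_realpow_zero) auto
  moreover have "0 < \<epsilon> * (1 / ?k) ^ s0" using \<epsilon> k by simp
  ultimately have "\<forall>\<^sub>F m in sequentially. C * (?k / (?k + 1)) ^ m < \<epsilon> * (1 / ?k) ^ s0"
    by (intro order_tendstoD(2)) auto
  then obtain m1 where m1: "\<And>m. m1 \<le> m \<Longrightarrow> C * (?k / (?k + 1)) ^ m < \<epsilon> * (1 / ?k) ^ s0"
    by (auto simp: eventually_sequentially)
  show ?thesis
  proof (intro exI[of _ "s0 + m1"] allI impI)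
    fix s F assume s: "s0 + m1 \<le> s" and F: "finite F" "q0 \<notin> F"
    define m where "m = s - s0"
    have m: "s = s0 + m" "m1 \<le> m" using s by (auto simp: m_def)
    have "\<bar>g q\<bar> * wt s q \<le> (1 / (?k + 1)) ^ m * (\<bar>g q\<bar> * wt s0 q)" if "q \<in> F" for q
    proof (cases "g q = 0")
      case False
      have "key q0 \<noteq> key q" using that F inj_key by metis
      moreover have "\<not> key q < key q0" using q0 False unfolding lead_def by blast
      ultimately have "key q0 + 1 \<le> key q" by linarith
      then have "?k + 1 \<le> real (key q)" by linarith
      then have "(1 / real (key q)) ^ m \<le> (1 / (?k + 1)) ^ m"
        using k by (intro power_mono divide_left_mono) auto
      then have "wt s q \<le> (1 / (?k + 1)) ^ m * wt s0 q"
        using wt_pos[of s0 q] by (simp add: wt_def m(1) power_add mult.commute mult_left_mono)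
      then have "\<bar>g q\<bar> * wt s q \<le> \<bar>g q\<bar> * ((1 / (?k + 1)) ^ m * wt s0 q)" by (intro mult_left_mono) auto
      then show ?thesis by (simp only: mult_ac)
    qed simp
    then have "(\<Sum>q\<in>F. \<bar>g q\<bar> * wt s q) \<le> (1 / (?k + 1)) ^ m * (\<Sum>q\<in>F. \<bar>g q\<bar> * wt s0 q)"
      unfolding sum_distrib_left by (intro sum_mono)
    also have "\<dots> \<le> (1 / (?k + 1)) ^ m * C"
      using vboundD[OF g F(1)] k by (intro mult_left_mono) auto
    also have "\<dots> = (1 / ?k) ^ m * (C * (?k / (?k + 1)) ^ m)"
      using k by (simp add: power_divide field_simps)
    also have "\<dots> \<le> (1 / ?k) ^ m * (\<epsilon> * (1 / ?k) ^ s0)"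
      using m1[OF m(2)] k by (intro mult_left_mono) auto
    also have "\<dots> = \<epsilon> * wt s q0" by (simp add: wt_def m(1) power_add mult_ac)
    finally show "(\<Sum>q\<in>F. \<bar>g q\<bar> * wt s q) \<le> \<epsilon> * wt s q0" .
  qed
qed

text \<open>Divisibility of monomials of the free module: same component and componentwise smaller
  exponent.\<close>

definition covers :: "(nat ^ 'n) \<times> 'j \<Rightarrow> (nat ^ 'n) \<times> 'j \<Rightarrow> bool" where
  "covers q0 q \<longleftrightarrow> fst q0 \<le> fst q \<and> snd q0 = snd q"

lemma covers_iff: "covers q0 q \<longleftrightarrow> (\<exists>\<gamma>. q = (\<gamma> + fst q0, snd q0))"
proof
  assume "covers q0 q"
  then have "q = ((fst q - fst q0) + fst q0, snd q0)"
    by (auto simp: covers_def prod_eq_iff vec_eq_iff less_eq_vec_def)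
  then show "\<exists>\<gamma>. q = (\<gamma> + fst q0, snd q0)" by blast
qed (auto simp: covers_def less_eq_vec_def)

end

text \<open>The scale is fixed so that the tail of each divisor weighs at most half of its leading
  term. This half is the contraction factor of the division.\<close>

locale division = monomial_key p for p :: "'n::finite + 'j::finite \<Rightarrow> nat" +
  fixes I :: "'i set" and g :: "'i \<Rightarrow> (nat ^ 'n) \<times> 'j \<Rightarrow> real" and b :: "'i \<Rightarrow> (nat ^ 'n) \<times> 'j"
    and s :: nat
  assumes fin_I: "finite I" and lead_g: "\<And>i. i \<in> I \<Longrightarrow> lead (g i) (b i)"
    and tail_le: "\<And>i F. i \<in> I \<Longrightarrow> finite F \<Longrightarrow> b i \<notin> F \<Longrightarrow>
      (\<Sum>q\<in>F. \<bar>g i q\<bar> * wt s q) \<le> \<bar>g i (b i)\<bar> / 2 * wt s (b i)"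
begin

text \<open>Several leading monomials may divide \<open>q\<close>; one of them is chosen. The sets
  of monomials assigned to different divisors are disjoint, so their weights add up without
  multiplicity.\<close>

definition owner :: "(nat ^ 'n) \<times> 'j \<Rightarrow> 'i option" where
  "owner q = (if \<exists>i\<in>I. covers (b i) q then Some (SOME i. i \<in> I \<and> covers (b i) q) else None)"

lemma owner_Some: "owner q = Some i \<Longrightarrow> i \<in> I \<and> covers (b i) q"
  unfolding owner_def by (auto split: if_splits intro: someI2_ex)

lemma owner_None: "owner q = None \<longleftrightarrow> (\<forall>i\<in>I. \<not> covers (b i) q)"
  by (simp add: owner_def)

definition shift :: "'i \<Rightarrow> nat ^ 'n \<Rightarrow> (nat ^ 'n) \<times> 'j" where
  "shift i \<gamma> = (\<gamma> + fst (b i), snd (b i))"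

text \<open>If the monomials assigned to \<open>i\<close> are to be produced by the leading term of
  \<open>g i\<close> alone, these are the quotient coefficients.\<close>

definition cf :: "((nat ^ 'n) \<times> 'j \<Rightarrow> real) \<Rightarrow> 'i \<Rightarrow> nat ^ 'n \<Rightarrow> real" where
  "cf e i \<gamma> = (if owner (shift i \<gamma>) = Some i then e (shift i \<gamma>) / g i (b i) else 0)"

definition tail :: "'i \<Rightarrow> (nat ^ 'n) \<times> 'j \<Rightarrow> real" where
  "tail i q = (if q = b i then 0 else g i q)"

text \<open>The contribution of the tails when the quotients read off from \<open>e\<close> multiply
  the divisors. A solution of \<open>e = h - red e\<close> makes leading parts, tails and the
  unassigned part of \<open>e\<close> add up to \<open>h\<close>.\<close>

definition red :: "((nat ^ 'n) \<times> 'j \<Rightarrow> real) \<Rightarrow> (nat ^ 'n) \<times> 'j \<Rightarrow> real" where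
  "red e q = (\<Sum>i\<in>I. \<Sum>r\<in>mi_fiber (fst q). cf e i (fst r) * tail i (snd r, snd q))"

lemma key_shift_less:
  assumes "i \<in> I" "r \<in> mi_fiber (fst q)" "tail i (snd r, snd q) \<noteq> 0"
  shows "key (shift i (fst r)) < key q"
proof -
  have "key (b i) \<noteq> key (snd r, snd q)" using assms(3) inj_key[of "b i" "(snd r, snd q)"] unfolding tail_def by metis
  moreover have "\<not> key (snd r, snd q) < key (b i)"
    using lead_g[OF assms(1)] assms(3) by (auto simp: tail_def lead_def split: if_splits)
  ultimately have "key (b i) < key (snd r, snd q)" by linarith
  then have "skey (fst r) * key (b i) < skey (fst r) * key (snd r, snd q)" using skey_pos by simp
  moreover have "key (shift i (fst r)) = skey (fst r) * key (b i)"
    unfolding shift_def key_add by simp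
  moreover have "key q = skey (fst r) * key (snd r, snd q)"
    using key_add[of "fst r" "snd r" "snd q"] assms(2) by simp
  ultimately show ?thesis by simp
qed

text \<open>The system is triangular: \<open>red e q\<close> involves \<open>e\<close> only at
  monomials of smaller key. It is solved by well-founded recursion; the guard in \<Phi> makes the
  dependence explicit and changes nothing, because the guarded terms vanish otherwise.\<close>

lemma ex_reduced: "\<exists>e. \<forall>q. e q = h q - red e q"
proof -
  define \<Phi> where "\<Phi> e q = h q - (\<Sum>i\<in>I. \<Sum>r\<in>mi_fiber (fst q).
    (if key (shift i (fst r)) < key q then cf e i (fst r) else 0) * tail i (snd r, snd q))" for e q
  have adm: "adm_wf (Wellfounded.measure key) \<Phi>"
    unfolding adm_wf_def
  proof (intro allI impI)
    fix e e' :: "(nat ^ 'n) \<times> 'j \<Rightarrow> real" and q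
    assume "\<forall>z. (z, q) \<in> Wellfounded.measure key \<longrightarrow> e z = e' z"
    then have less: "key z < key q \<Longrightarrow> e z = e' z" for z by (simp only: in_measure)
    have "(if key (shift i (fst r)) < key q then cf e i (fst r) else 0) =
      (if key (shift i (fst r)) < key q then cf e' i (fst r) else 0)" for i and r :: "(nat ^ 'n) \<times> (nat ^ 'n)"
      by (rule if_cong[OF refl _ refl]) (simp only: cf_def less)
    then show "\<Phi> e q = \<Phi> e' q" by (simp only: \<Phi>_def)
  qed
  define e where "e = wfrec (Wellfounded.measure key) \<Phi>"
  have fix_e: "e = \<Phi> e" unfolding e_def by (rule wfrec_fixpoint[OF wf_measure adm])
  have eq: "(if key (shift i (fst r)) < key q then cf e i (fst r) else 0) * tail i (snd r, snd q)
      = cf e i (fst r) * tail i (snd r, snd q)" if "i \<in> I" "r \<in> mi_fiber (fst q)" for i q r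
    using key_shift_less[OF that] by (cases "tail i (snd r, snd q) = 0") auto
  have "\<Phi> e q = h q - red e q" for q
    unfolding \<Phi>_def red_def by (simp only: eq cong: sum.cong)
  then have "e q = h q - red e q" for q by (rule trans[OF fun_cong[OF fix_e]])
  then show ?thesis by blast
qed

lemma inj_shift: "inj (shift i)"
  by (rule injI) (simp add: shift_def)

lemma wt_shift: "wt s (shift i \<gamma>) = swt s \<gamma> * wt s (b i)"
  unfolding shift_def wt_add by simp

lemma sum_cf_le:
  assumes i: "i \<in> I" and G: "finite G"
  shows "(\<Sum>\<gamma>\<in>G. \<bar>cf e i \<gamma>\<bar> * swt s \<gamma>) * (\<bar>g i (b i)\<bar> * wt s (b i))
    \<le> (\<Sum>q | q \<in> shift i ` G \<and> owner q = Some i. \<bar>e q\<bar> * wt s q)"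
proof -
  have g0: "g i (b i) \<noteq> 0" using lead_g[OF i] by (simp add: lead_def)
  let ?G = "{\<gamma> \<in> G. owner (shift i \<gamma>) = Some i}"
  have "(\<Sum>\<gamma>\<in>G. \<bar>cf e i \<gamma>\<bar> * swt s \<gamma>) * (\<bar>g i (b i)\<bar> * wt s (b i))
      = (\<Sum>\<gamma>\<in>?G. \<bar>cf e i \<gamma>\<bar> * swt s \<gamma>) * (\<bar>g i (b i)\<bar> * wt s (b i))"
    using G by (intro arg_cong2[of _ _ _ _ "(*)"] sum.mono_neutral_right) (auto simp: cf_def)
  also have "\<dots> = (\<Sum>\<gamma>\<in>?G. \<bar>e (shift i \<gamma>)\<bar> * wt s (shift i \<gamma>))"
    unfolding sum_distrib_right using g0 by (intro sum.cong) (auto simp: cf_def wt_shift abs_divide)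
  also have "\<dots> = (\<Sum>q\<in>shift i ` ?G. \<bar>e q\<bar> * wt s q)"
    by (subst sum.reindex) (auto intro: inj_on_subset[OF inj_shift])
  also have "shift i ` ?G = {q. q \<in> shift i ` G \<and> owner q = Some i}" by auto
  finally show ?thesis by simp
qed

text \<open>Each quotient weighs as much as its share of \<open>e\<close> divided by the leading
  weight, and the tail brings back at most half of that weight. \<open>F\<close> is closed under
  smaller keys because these are the places where \<open>red\<close> reads \<open>e\<close>.\<close>

lemma red_bound:
  assumes F: "\<And>q q'. q \<in> F \<Longrightarrow> key q' \<le> key q \<Longrightarrow> q' \<in> F" "finite F"
  shows "(\<Sum>q\<in>F. \<bar>red e q\<bar> * wt s q) \<le> (\<Sum>q\<in>F. \<bar>e q\<bar> * wt s q) / 2"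
proof -
  define f where "f i \<gamma> = (if shift i \<gamma> \<in> F then cf e i \<gamma> * swt s \<gamma> else 0)" for i \<gamma>
  define A where "A i = (\<Sum>\<gamma>\<in>shift i -` F. \<bar>cf e i \<gamma>\<bar> * swt s \<gamma>)" for i
  have finG: "finite (shift i -` F)" for i by (rule finite_vimageI[OF F(2) inj_shift])
  have f: "(\<Sum>\<gamma>\<in>G. \<bar>f i \<gamma>\<bar>) \<le> A i" if "finite G" for i G
  proof -
    have "(\<Sum>\<gamma>\<in>G. \<bar>f i \<gamma>\<bar>) = (\<Sum>\<gamma>\<in>G \<inter> shift i -` F. \<bar>f i \<gamma>\<bar>)"
      using that by (intro sum.mono_neutral_right) (auto simp: f_def)
    also have "\<dots> \<le> (\<Sum>\<gamma>\<in>shift i -` F. \<bar>f i \<gamma>\<bar>)" using finG by (intro sum_mono2) auto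
    also have "\<dots> = A i"
      unfolding A_def using swt_pos[of s] by (intro sum.cong) (auto simp: f_def abs_mult less_imp_le)
    finally show ?thesis .
  qed
  have t: "(\<Sum>q\<in>G. \<bar>tail i q * wt s q\<bar>) \<le> \<bar>g i (b i)\<bar> / 2 * wt s (b i)" if i: "i \<in> I" and G: "finite G" for i G
  proof -
    have "(\<Sum>q\<in>G. \<bar>tail i q * wt s q\<bar>) = (\<Sum>q\<in>G - {b i}. \<bar>g i q\<bar> * wt s q)"
      using G wt_pos[of s] by (intro sum.mono_neutral_cong_right) (auto simp: tail_def abs_mult less_imp_le)
    also have "\<dots> \<le> \<bar>g i (b i)\<bar> / 2 * wt s (b i)" using i G by (intro tail_le) auto
    finally show ?thesis .
  qed
  \<comment> \<open>A product term is re-indexed by its quotient exponent and tail monomial, which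
    makes the double sum a subsum of a product of two sums.\<close>
  let ?\<phi> = "\<lambda>x. (fst (snd x), (snd (snd x), snd (fst x)))"
  let ?S = "SIGMA q:F. mi_fiber (fst q)"
  have finS: "finite ?S" using F by auto
  have inner: "(\<Sum>q\<in>F. \<Sum>r\<in>mi_fiber (fst q). \<bar>cf e i (fst r) * tail i (snd r, snd q)\<bar> * wt s q)
      \<le> A i * (\<bar>g i (b i)\<bar> / 2 * wt s (b i))" if i: "i \<in> I" for i
  proof -
    have "(\<Sum>q\<in>F. \<Sum>r\<in>mi_fiber (fst q). \<bar>cf e i (fst r) * tail i (snd r, snd q)\<bar> * wt s q)
        = (\<Sum>x\<in>?S. \<bar>cf e i (fst (snd x)) * tail i (snd (snd x), snd (fst x))\<bar> * wt s (fst x))"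
      using F by (subst sum.Sigma) (auto simp: case_prod_unfold)
    also have "\<dots> = (\<Sum>x\<in>?S. \<bar>f i (fst (?\<phi> x)) * (tail i (snd (?\<phi> x)) * wt s (snd (?\<phi> x)))\<bar>)"
    proof (rule sum.cong[OF refl])
      fix x assume "x \<in> ?S"
      then have x: "fst x \<in> F" "fst (snd x) + snd (snd x) = fst (fst x)" by auto
      show "\<bar>cf e i (fst (snd x)) * tail i (snd (snd x), snd (fst x))\<bar> * wt s (fst x)
        = \<bar>f i (fst (?\<phi> x)) * (tail i (snd (?\<phi> x)) * wt s (snd (?\<phi> x)))\<bar>"
      proof (cases "tail i (snd (snd x), snd (fst x)) = 0")
        case False
        then have "key (shift i (fst (snd x))) < key (fst x)"
          using x(2) by (intro key_shift_less[OF i]) auto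
        then have "shift i (fst (snd x)) \<in> F" using F(1)[OF x(1)] less_imp_le by blast
        moreover have "wt s (fst x) = swt s (fst (snd x)) * wt s (snd (snd x), snd (fst x))"
          using wt_add[of s "fst (snd x)" "snd (snd x)" "snd (fst x)"] x(2) by simp
        ultimately show ?thesis
          using wt_pos[of s "(snd (snd x), snd (fst x))"] swt_pos[of s "fst (snd x)"]
          by (simp add: f_def abs_mult less_imp_le)
      qed simp
    qed
    also have "\<dots> = (\<Sum>y\<in>?\<phi> ` ?S. \<bar>f i (fst y) * (tail i (snd y) * wt s (snd y))\<bar>)"
      by (subst sum.reindex) (auto simp: inj_on_def prod_eq_iff)
    also have "\<dots> \<le> A i * (\<bar>g i (b i)\<bar> / 2 * wt s (b i))"
      using finS by (intro sum_abs_prod_le[where f = "f i" and g = "\<lambda>q. tail i q * wt s q"] f t[OF i]) auto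
    finally show ?thesis .
  qed
  have "(\<Sum>q\<in>F. \<bar>red e q\<bar> * wt s q)
      \<le> (\<Sum>q\<in>F. \<Sum>i\<in>I. \<Sum>r\<in>mi_fiber (fst q). \<bar>cf e i (fst r) * tail i (snd r, snd q)\<bar> * wt s q)"
  proof (rule sum_mono)
    fix q
    have "\<bar>red e q\<bar> \<le> (\<Sum>i\<in>I. \<Sum>r\<in>mi_fiber (fst q). \<bar>cf e i (fst r) * tail i (snd r, snd q)\<bar>)"
      unfolding red_def by (intro order_trans[OF sum_abs] sum_mono sum_abs)
    then show "\<bar>red e q\<bar> * wt s q \<le> (\<Sum>i\<in>I. \<Sum>r\<in>mi_fiber (fst q). \<bar>cf e i (fst r) * tail i (snd r, snd q)\<bar> * wt s q)"
      unfolding sum_distrib_right[symmetric] using wt_pos[of s q] by (intro mult_right_mono) auto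
  qed
  also have "\<dots> = (\<Sum>i\<in>I. \<Sum>q\<in>F. \<Sum>r\<in>mi_fiber (fst q). \<bar>cf e i (fst r) * tail i (snd r, snd q)\<bar> * wt s q)"
    by (rule sum.swap)
  also have "\<dots> \<le> (\<Sum>i\<in>I. (\<Sum>q | q \<in> F \<and> owner q = Some i. \<bar>e q\<bar> * wt s q) / 2)"
  proof (rule sum_mono)
    fix i assume i: "i \<in> I"
    have "A i * (\<bar>g i (b i)\<bar> * wt s (b i)) \<le> (\<Sum>q | q \<in> shift i ` (shift i -` F) \<and> owner q = Some i. \<bar>e q\<bar> * wt s q)"
      unfolding A_def by (rule sum_cf_le[OF i finG])
    also have "\<dots> \<le> (\<Sum>q | q \<in> F \<and> owner q = Some i. \<bar>e q\<bar> * wt s q)"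
      using F(2) by (intro sum_mono2) auto
    finally show "(\<Sum>q\<in>F. \<Sum>r\<in>mi_fiber (fst q). \<bar>cf e i (fst r) * tail i (snd r, snd q)\<bar> * wt s q)
        \<le> (\<Sum>q | q \<in> F \<and> owner q = Some i. \<bar>e q\<bar> * wt s q) / 2"
      using inner[OF i] by simp
  qed
  also have "\<dots> = (\<Sum>q\<in>(\<Union>i\<in>I. {q. q \<in> F \<and> owner q = Some i}). \<bar>e q\<bar> * wt s q) / 2"
    unfolding sum_divide_distrib[symmetric] using F(2) fin_I
    by (subst sum.UNION_disjoint) auto
  also have "\<dots> \<le> (\<Sum>q\<in>F. \<bar>e q\<bar> * wt s q) / 2"
    using F(2) by (intro divide_right_mono sum_mono2) auto
  finally show ?thesis .
qed

text \<open>The contraction yields norm(e) \<le> C + norm(e) / 2 on finite sets, hence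
  \<open>2 * C\<close> without any convergence assumed beforehand. Quotients and remainder are
  pieces of \<open>e\<close> and inherit the bound at the same scale.\<close>

theorem division:
  assumes h: "vbound s h C"
  shows "\<exists>c R. (\<forall>i\<in>I. \<exists>D. ps_bound (\<chi> k. (1 / real (p (Inl k))) ^ s) (c i) D) \<and> (\<exists>D. vbound s R D) \<and>
    (\<forall>q. (\<exists>i\<in>I. covers (b i) q) \<longrightarrow> R q = 0) \<and>
    (\<forall>\<beta> j. h (\<beta>, j) = (\<Sum>i\<in>I. ps_mult (c i) (\<lambda>\<beta>. g i (\<beta>, j)) \<beta>) + R (\<beta>, j))"
proof -
  obtain e where e: "\<And>q. e q = h q - red e q" using ex_reduced by blast
  have abs_e: "\<bar>e q\<bar> \<le> \<bar>h q\<bar> + \<bar>red e q\<bar>" for q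
    using abs_triangle_ineq4[of "h q" "red e q"] by (simp only: e[of q])
  have e_bound: "vbound s e (2 * C)"
    unfolding vbound_def
  proof (intro allI impI)
    fix F :: "((nat ^ 'n) \<times> 'j) set" assume F: "finite F"
    \<comment> \<open>The estimate needs a set closed under smaller keys; an initial segment of keys
      is finite, so subtracting half of the sum is legitimate.\<close>
    define N where "N = Max (insert 0 (key ` F))"
    let ?G = "{q. key q \<le> N}"
    have FG: "F \<subseteq> ?G" using F by (auto simp: N_def)
    have "(\<Sum>q\<in>?G. \<bar>e q\<bar> * wt s q) \<le> (\<Sum>q\<in>?G. \<bar>h q\<bar> * wt s q + \<bar>red e q\<bar> * wt s q)"
      unfolding distrib_right[symmetric]
      by (intro sum_mono mult_right_mono abs_e) auto
    also have "\<dots> \<le> C + (\<Sum>q\<in>?G. \<bar>e q\<bar> * wt s q) / 2"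
      unfolding sum.distrib using finite_key_le
      by (intro add_mono vboundD[OF h] red_bound) (auto intro: order_trans)
    finally have "(\<Sum>q\<in>?G. \<bar>e q\<bar> * wt s q) \<le> 2 * C" by simp
    moreover have "(\<Sum>q\<in>F. \<bar>e q\<bar> * wt s q) \<le> (\<Sum>q\<in>?G. \<bar>e q\<bar> * wt s q)"
      using FG finite_key_le by (intro sum_mono2) auto
    ultimately show "(\<Sum>q\<in>F. \<bar>e q\<bar> * wt s q) \<le> 2 * C" by linarith
  qed
  \<comment> \<open>The remainder is the part of \<open>e\<close> at monomials divisible by no
    leading monomial.\<close>
  define R where "R q = (if owner q = None then e q else 0)" for q
  have "vbound s R (2 * C)"
    unfolding vbound_def
  proof (intro allI impI)
    fix F :: "((nat ^ 'n) \<times> 'j) set" assume F: "finite F"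
    have "(\<Sum>q\<in>F. \<bar>R q\<bar> * wt s q) \<le> (\<Sum>q\<in>F. \<bar>e q\<bar> * wt s q)"
      by (intro sum_mono mult_right_mono) (auto simp: R_def)
    also have "\<dots> \<le> 2 * C" by (rule vboundD[OF e_bound F])
    finally show "(\<Sum>q\<in>F. \<bar>R q\<bar> * wt s q) \<le> 2 * C" .
  qed
  moreover have "\<exists>D. ps_bound (\<chi> k. (1 / real (p (Inl k))) ^ s) (cf e i) D" if i: "i \<in> I" for i
  proof -
    have pos: "0 < \<bar>g i (b i)\<bar> * wt s (b i)" using lead_g[OF i] wt_pos by (simp add: lead_def)
    have "ps_bound (\<chi> k. (1 / real (p (Inl k))) ^ s) (cf e i) (2 * C / (\<bar>g i (b i)\<bar> * wt s (b i)))"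
      unfolding ps_bound_def swt_eq[symmetric] pos_le_divide_eq[OF pos]
    proof (intro allI impI)
      fix G :: "(nat ^ 'n) set" assume G: "finite G"
      show "(\<Sum>\<gamma>\<in>G. \<bar>cf e i \<gamma>\<bar> * swt s \<gamma>) * (\<bar>g i (b i)\<bar> * wt s (b i)) \<le> 2 * C"
        using G by (intro order_trans[OF sum_cf_le[OF i G]] vboundD[OF e_bound]) auto
    qed
    then show ?thesis by blast
  qed
  moreover have "h (\<beta>, j) = (\<Sum>i\<in>I. ps_mult (cf e i) (\<lambda>\<beta>. g i (\<beta>, j)) \<beta>) + R (\<beta>, j)" for \<beta> j
  proof -
    let ?q = "(\<beta>, j)"
    have one: "ps_mult (cf e i) (\<lambda>\<beta>. g i (\<beta>, j)) \<beta> =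
      (\<Sum>r\<in>mi_fiber \<beta>. cf e i (fst r) * tail i (snd r, j)) + (if owner ?q = Some i then e ?q else 0)" if i: "i \<in> I" for i
    proof -
      have g0: "g i (b i) \<noteq> 0" using lead_g[OF i] by (simp add: lead_def)
      have "ps_mult (cf e i) (\<lambda>\<beta>. g i (\<beta>, j)) \<beta> = (\<Sum>r\<in>mi_fiber \<beta>. cf e i (fst r) * tail i (snd r, j)
          + (if (snd r, j) = b i then cf e i (fst r) * g i (b i) else 0))"
        unfolding ps_mult_def by (intro sum.cong) (auto simp: tail_def)
      also have "\<dots> = (\<Sum>r\<in>mi_fiber \<beta>. cf e i (fst r) * tail i (snd r, j))
          + (\<Sum>r\<in>mi_fiber \<beta>. if (snd r, j) = b i then cf e i (fst r) * g i (b i) else 0)"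
        by (rule sum.distrib)
      also have "(\<Sum>r\<in>mi_fiber \<beta>. if (snd r, j) = b i then cf e i (fst r) * g i (b i) else 0)
          = (if owner ?q = Some i then e ?q else 0)"
      proof (cases "covers (b i) ?q")
        case True
        then obtain \<gamma> where \<gamma>: "?q = (\<gamma> + fst (b i), snd (b i))" unfolding covers_iff by blast
        have "(\<Sum>r\<in>mi_fiber \<beta>. if (snd r, j) = b i then cf e i (fst r) * g i (b i) else 0)
            = (\<Sum>r\<in>mi_fiber \<beta>. if r = (\<gamma>, fst (b i)) then cf e i \<gamma> * g i (b i) else 0)"
          using \<gamma> by (intro sum.cong) (auto simp: prod_eq_iff)
        also have "\<dots> = cf e i \<gamma> * g i (b i)" using \<gamma> by simp
        also have "\<dots> = (if owner ?q = Some i then e ?q else 0)"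
          using g0 \<gamma> by (simp add: cf_def shift_def)
        finally show ?thesis .
      next
        case False
        have "owner ?q \<noteq> Some i" using owner_Some False by blast
        moreover have "(snd r, j) \<noteq> b i" if r: "r \<in> mi_fiber \<beta>" for r
        proof
          assume "(snd r, j) = b i"
          then have "?q = (fst r + fst (b i), snd (b i))" using r by (auto simp: prod_eq_iff)
          with False show False unfolding covers_iff by blast
        qed
        ultimately show ?thesis by simp
      qed
      finally show ?thesis .
    qed
    have "(\<Sum>i\<in>I. if owner ?q = Some i then e ?q else 0) = (if owner ?q = None then 0 else e ?q)"
    proof (cases "owner ?q")
      case (Some i)
      then show ?thesis using owner_Some[OF Some] fin_I by simp
    qed simp
    then have "(\<Sum>i\<in>I. ps_mult (cf e i) (\<lambda>\<beta>. g i (\<beta>, j)) \<beta>) = red e ?q + (if owner ?q = None then 0 else e ?q)"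
      using one by (simp add: sum.distrib red_def)
    then show ?thesis using e[of ?q] by (simp add: R_def)
  qed
  moreover have "\<forall>q. (\<exists>i\<in>I. covers (b i) q) \<longrightarrow> R q = 0" by (auto simp: R_def owner_None)
  ultimately show ?thesis by (intro exI[of _ "cf e"] exI[of _ R]) blast
qed

end

section \<open>Finite generation\<close>

definition analytic_field :: "(real ^ 'n \<Rightarrow> real ^ 'n) \<Rightarrow> bool" where
  "analytic_field f \<longleftrightarrow> (\<forall>j. analytic_germ (\<lambda>x. f x $ j))"

lemma has_derivative_vecI:
  fixes f :: "real ^ 'm \<Rightarrow> real ^ 'n"
  assumes "\<And>j. ((\<lambda>x. f x $ j) has_derivative (\<lambda>h. f' h $ j)) (at a)"
  shows "(f has_derivative f') (at a)"
proof (subst has_derivative_componentwise_within, rule ballI)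
  fix b :: "real ^ 'n" assume "b \<in> Basis"
  then obtain j where b: "b = axis j 1" by (auto simp: Basis_vec_def)
  show "((\<lambda>x. f x \<bullet> b) has_derivative (\<lambda>x. f' x \<bullet> b)) (at a)"
    using assms[of j] by (simp add: b inner_axis)
qed

lemma analytic_field_derivative:
  assumes "analytic_field (f :: real ^ 'n \<Rightarrow> real ^ 'n)"
  shows "\<exists>f'. (\<forall>j i. analytic_germ (f' j i)) \<and>
    (\<forall>\<^sub>F x in nhds 0. (f has_derivative (\<lambda>h. \<chi> j. \<Sum>i\<in>UNIV. f' j i x * h $ i)) (at x))"
proof -
  have "\<exists>f'. (\<forall>i. analytic_germ (f' i)) \<and>
    (\<forall>\<^sub>F x in nhds 0. ((\<lambda>x. f x $ j) has_derivative (\<lambda>h. \<Sum>i\<in>UNIV. f' i x * h $ i)) (at x))" for j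
  proof -
    have "analytic_germ (\<lambda>x. f x $ j)" using assms by (simp add: analytic_field_def)
    then obtain f' where "\<And>i. analytic_germ (f' i)"
      "\<forall>\<^sub>F x in nhds 0. ((\<lambda>x. f x $ j) has_derivative (\<lambda>h. \<Sum>i\<in>UNIV. f' i x * h $ i)) (at x)"
      by (rule analytic_germ_derivative) (rule that)
    then show ?thesis by (intro exI[of _ f'] conjI allI)
  qed
  then have "\<exists>f'. \<forall>j. (\<forall>i. analytic_germ (f' j i)) \<and>
    (\<forall>\<^sub>F x in nhds 0. ((\<lambda>x. f x $ j) has_derivative (\<lambda>h. \<Sum>i\<in>UNIV. f' j i x * h $ i)) (at x))"
    by (intro choice allI)
  then obtain f' where f': "\<And>j i. analytic_germ (f' j i)"
    "\<And>j. \<forall>\<^sub>F x in nhds 0. ((\<lambda>x. f x $ j) has_derivative (\<lambda>h. \<Sum>i\<in>UNIV. f' j i x * h $ i)) (at x)"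
    by blast
  have "\<forall>\<^sub>F x in nhds 0. \<forall>j. ((\<lambda>x. f x $ j) has_derivative (\<lambda>h. \<Sum>i\<in>UNIV. f' j i x * h $ i)) (at x)"
    using f'(2) by (rule eventually_all_finite)
  then have "\<forall>\<^sub>F x in nhds 0. (f has_derivative (\<lambda>h. \<chi> j. \<Sum>i\<in>UNIV. f' j i x * h $ i)) (at x)"
    by eventually_elim (rule has_derivative_vecI, simp)
  with f'(1) show ?thesis by blast
qed

lemma analytic_field_lie_bracket:
  assumes "analytic_field X" "analytic_field (Y :: real ^ 'n \<Rightarrow> real ^ 'n)"
  shows "analytic_field (lie_bracket X Y)"
proof -
  obtain X' where X': "\<And>j i. analytic_germ (X' j i)"
    "\<forall>\<^sub>F x in nhds 0. (X has_derivative (\<lambda>h. \<chi> j. \<Sum>i\<in>UNIV. X' j i x * h $ i)) (at x)"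
    using analytic_field_derivative[OF assms(1)] by blast
  obtain Y' where Y': "\<And>j i. analytic_germ (Y' j i)"
    "\<forall>\<^sub>F x in nhds 0. (Y has_derivative (\<lambda>h. \<chi> j. \<Sum>i\<in>UNIV. Y' j i x * h $ i)) (at x)"
    using analytic_field_derivative[OF assms(2)] by blast
  have XY: "analytic_germ (\<lambda>x. X x $ i)" "analytic_germ (\<lambda>x. Y x $ i)" for i
    using assms by (auto simp: analytic_field_def)
  show ?thesis
    unfolding analytic_field_def
  proof
    fix j
    have "\<forall>\<^sub>F x in nhds 0. (\<Sum>i\<in>UNIV. Y' j i x * X x $ i) - (\<Sum>i\<in>UNIV. X' j i x * Y x $ i) = lie_bracket X Y x $ j"
      using X'(2) Y'(2)
    proof eventually_elim
      case (elim x)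
      show ?case
        unfolding lie_bracket_def frechet_derivative_at[OF elim(1), symmetric]
          frechet_derivative_at[OF elim(2), symmetric] by simp
    qed
    then show "analytic_germ (\<lambda>x. lie_bracket X Y x $ j)"
      by (rule analytic_germ_cong)
         (intro analytic_germ_diff analytic_germ_sum analytic_germ_mult X' Y' XY)
  qed
qed

text \<open>Graded spans occur in two forms: for germs, with analytic coefficients and the filter
  \<open>nhds 0\<close>, and on a fixed open set \<open>U\<close>, with smooth coefficients and the
  filter \<open>principal U\<close>.\<close>

locale coefficient_class =
  fixes Q :: "(real ^ 'n \<Rightarrow> real) \<Rightarrow> bool" and G :: "(real ^ 'n) filter"
  assumes Q_const: "\<And>r. Q (\<lambda>x. r)"
    and Q_add: "\<And>f g. Q f \<Longrightarrow> Q g \<Longrightarrow> Q (\<lambda>x. f x + g x)"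
    and Q_mult: "\<And>f g. Q f \<Longrightarrow> Q g \<Longrightarrow> Q (\<lambda>x. f x * g x)"
begin

definition graded_span :: "((real ^ 'n \<Rightarrow> real ^ 'n) \<times> (nat ^ 'v)) set \<Rightarrow> nat ^ 'v \<Rightarrow>
    (real ^ 'n \<Rightarrow> real ^ 'n) \<Rightarrow> bool" where
  "graded_span F d f \<longleftrightarrow> (\<exists>c. (\<forall>y\<in>F. Q (c y)) \<and>
    (\<forall>\<^sub>F x in G. f x = (\<Sum>y | y \<in> F \<and> snd y \<le> d. c y x *\<^sub>R fst y x)))"

lemma graded_spanI:
  assumes "\<And>y. y \<in> F \<Longrightarrow> Q (c y)"
    "\<forall>\<^sub>F x in G. f x = (\<Sum>y | y \<in> F \<and> snd y \<le> d. c y x *\<^sub>R fst y x)"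
  shows "graded_span F d f"
  using assms unfolding graded_span_def by blast

lemma graded_spanE:
  assumes "graded_span F d f"
  obtains c where "\<And>y. y \<in> F \<Longrightarrow> Q (c y)"
    "\<forall>\<^sub>F x in G. f x = (\<Sum>y | y \<in> F \<and> snd y \<le> d. c y x *\<^sub>R fst y x)"
  using assms unfolding graded_span_def by blast

lemma graded_span_mono:
  assumes "graded_span F d f" "finite F'" "F \<subseteq> F'" "d \<le> d'"
  shows "graded_span F' d' f"
proof -
  obtain c where c: "\<And>y. y \<in> F \<Longrightarrow> Q (c y)"
    "\<forall>\<^sub>F x in G. f x = (\<Sum>y | y \<in> F \<and> snd y \<le> d. c y x *\<^sub>R fst y x)"
    using assms(1) by (rule graded_spanE) (rule that)
  define c' where "c' y = (if y \<in> F \<and> snd y \<le> d then c y else (\<lambda>x. 0))" for y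
  have "(\<Sum>y | y \<in> F \<and> snd y \<le> d. c y x *\<^sub>R fst y x) = (\<Sum>y | y \<in> F' \<and> snd y \<le> d'. c' y x *\<^sub>R fst y x)" for x
    using assms(2-4) by (intro sum.mono_neutral_cong_left) (auto simp: c'_def intro: order_trans)
  with c(2) have "\<forall>\<^sub>F x in G. f x = (\<Sum>y | y \<in> F' \<and> snd y \<le> d'. c' y x *\<^sub>R fst y x)" by simp
  moreover have "Q (c' y)" for y
    using c(1) by (simp add: c'_def Q_const)
  ultimately show ?thesis by (intro graded_spanI)
qed

lemma graded_span_add:
  assumes "graded_span F d f" "graded_span F d g"
  shows "graded_span F d (\<lambda>x. f x + g x)"
proof -
  obtain c where c: "\<And>y. y \<in> F \<Longrightarrow> Q (c y)"
    "\<forall>\<^sub>F x in G. f x = (\<Sum>y | y \<in> F \<and> snd y \<le> d. c y x *\<^sub>R fst y x)"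
    using assms(1) by (rule graded_spanE) (rule that)
  obtain c' where c': "\<And>y. y \<in> F \<Longrightarrow> Q (c' y)"
    "\<forall>\<^sub>F x in G. g x = (\<Sum>y | y \<in> F \<and> snd y \<le> d. c' y x *\<^sub>R fst y x)"
    using assms(2) by (rule graded_spanE) (rule that)
  show ?thesis
  proof (rule graded_spanI[where c = "\<lambda>y x. c y x + c' y x"])
    show "\<forall>\<^sub>F x in G. f x + g x = (\<Sum>y | y \<in> F \<and> snd y \<le> d. (c y x + c' y x) *\<^sub>R fst y x)"
      using c(2) c'(2) by eventually_elim (simp add: scaleR_add_left sum.distrib)
  qed (intro Q_add c c')
qed

lemma graded_span_scale:
  assumes "graded_span F d f" "Q g"
  shows "graded_span F d (\<lambda>x. g x *\<^sub>R f x)"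
proof -
  obtain c where c: "\<And>y. y \<in> F \<Longrightarrow> Q (c y)"
    "\<forall>\<^sub>F x in G. f x = (\<Sum>y | y \<in> F \<and> snd y \<le> d. c y x *\<^sub>R fst y x)"
    using assms(1) by (rule graded_spanE) (rule that)
  show ?thesis
  proof (rule graded_spanI[where c = "\<lambda>y x. g x * c y x"])
    show "\<forall>\<^sub>F x in G. g x *\<^sub>R f x = (\<Sum>y | y \<in> F \<and> snd y \<le> d. (g x * c y x) *\<^sub>R fst y x)"
      using c(2) by eventually_elim (simp add: scaleR_sum_right)
  qed (intro Q_mult c assms(2))
qed

lemma graded_span_zero: "graded_span F d (\<lambda>x. 0)"
  by (rule graded_spanI[where c = "\<lambda>y x. 0"]) (auto intro: Q_const)

lemma graded_span_sum:
  "(\<And>i. i \<in> I \<Longrightarrow> graded_span F d (f i)) \<Longrightarrow> graded_span F d (\<lambda>x. \<Sum>i\<in>I. f i x)"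
  by (induction I rule: infinite_finite_induct) (auto intro: graded_span_add graded_span_zero)

lemma graded_span_member:
  assumes "finite F" "y \<in> F" "snd y \<le> d"
  shows "graded_span F d (fst y)"
proof (rule graded_spanI[where c = "\<lambda>z x. if z = y then 1 else 0"])
  have "(\<Sum>z | z \<in> F \<and> snd z \<le> d. (if z = y then 1 else 0) *\<^sub>R fst z x) = fst y x" for x
  proof -
    have "(\<Sum>z | z \<in> F \<and> snd z \<le> d. (if z = y then 1 else 0) *\<^sub>R fst z x)
        = (\<Sum>z | z \<in> F \<and> snd z \<le> d. if z = y then fst z x else 0)"
      by (rule sum.cong) auto
    then show ?thesis using assms by simp
  qed
  then show "\<forall>\<^sub>F x in G. fst y x = (\<Sum>z | z \<in> F \<and> snd z \<le> d. (if z = y then 1 else 0) *\<^sub>R fst z x)"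
    by simp
qed (rule Q_const)

lemma graded_span_cong:
  assumes "\<forall>\<^sub>F x in G. f x = g x" "graded_span F d f"
  shows "graded_span F d g"
proof -
  obtain c where c: "\<And>y. y \<in> F \<Longrightarrow> Q (c y)"
    "\<forall>\<^sub>F x in G. f x = (\<Sum>y | y \<in> F \<and> snd y \<le> d. c y x *\<^sub>R fst y x)"
    using assms(2) by (rule graded_spanE) (rule that)
  have "\<forall>\<^sub>F x in G. g x = (\<Sum>y | y \<in> F \<and> snd y \<le> d. c y x *\<^sub>R fst y x)"
    using c(2) assms(1) by eventually_elim simp
  with c(1) show ?thesis by (rule graded_spanI)
qed

end

interpretation germ: coefficient_class analytic_germ "nhds 0"
  by unfold_locales (rule analytic_germ_const analytic_germ_add analytic_germ_mult; assumption?)+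

section \<open>Division of analytic germs\<close>

lemma ps_eval_analytic_germ:
  assumes "ps_bound w a C" "\<And>i. 0 < w $ i"
  shows "analytic_germ (ps_eval a)"
proof -
  define r where "r = Min (range (\<lambda>i. w $ i))"
  have r: "0 < r" "\<And>i. r \<le> w $ i" using assms(2) by (auto simp: r_def Min_gr_iff)
  have "ps_bound (vec r) a C" by (rule ps_bound_mono[OF assms(1)]) (use r in auto)
  with r(1) show ?thesis unfolding analytic_germ_def by blast
qed

lemma eventually_components_le:
  assumes "\<And>i. 0 < w $ i"
  shows "\<forall>\<^sub>F x in nhds (0 :: real ^ 'n). \<forall>i. \<bar>x $ i\<bar> \<le> w $ i"
proof (rule eventually_all_finite)
  fix i
  have "((\<lambda>x :: real ^ 'n. \<bar>x $ i\<bar>) \<longlongrightarrow> \<bar>(0 :: real ^ 'n) $ i\<bar>) (nhds 0)"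
    by (intro tendsto_intros) (simp add: filterlim_ident)
  then have "\<forall>\<^sub>F x in nhds (0 :: real ^ 'n). \<bar>x $ i\<bar> < w $ i"
    using assms[of i] by (intro order_tendstoD(2)) auto
  then show "\<forall>\<^sub>F x in nhds (0 :: real ^ 'n). \<bar>x $ i\<bar> \<le> w $ i"
    by eventually_elim simp
qed

context monomial_key
begin

lemma vbound_component:
  assumes "vbound s h C"
  shows "ps_bound (\<chi> k. (1 / real (p (Inl k))) ^ s) (\<lambda>\<beta>. h (\<beta>, j)) (C / wt s (0, j))"
  unfolding ps_bound_def swt_eq[symmetric] pos_le_divide_eq[OF wt_pos]
proof (intro allI impI)
  fix F :: "(nat ^ 'n) set" assume F: "finite F"
  have "(\<Sum>\<beta>\<in>F. \<bar>h (\<beta>, j)\<bar> * swt s \<beta>) * wt s (0, j) = (\<Sum>\<beta>\<in>F. \<bar>h (\<beta>, j)\<bar> * wt s (\<beta> + 0, j))"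
    unfolding sum_distrib_right wt_add by (simp only: mult.assoc)
  also have "\<dots> = (\<Sum>q\<in>(\<lambda>\<beta>. (\<beta>, j)) ` F. \<bar>h q\<bar> * wt s q)"
    by (subst sum.reindex) (auto simp: inj_on_def)
  also have "\<dots> \<le> C" using F by (intro vboundD[OF assms]) auto
  finally show "(\<Sum>\<beta>\<in>F. \<bar>h (\<beta>, j)\<bar> * swt s \<beta>) * wt s (0, j) \<le> C" .
qed

lemma radius_pos: "0 < (\<chi> k. (1 / real (p (Inl k))) ^ s) $ i"
  using prime_p[of "Inl i"] by (simp add: prime_gt_0_nat)

lemma vbound_of_components:
  fixes R M :: real
  assumes a: "\<And>j. ps_bound (vec R) (a j) M" and R: "0 < R"
  shows "\<exists>s C. vbound s (\<lambda>q. a (snd q) (fst q)) C"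
proof -
  \<comment> \<open>All primes are at least 2, so this scale puts every radius below
    \<open>R\<close>.\<close>
  obtain s where s: "(1 / 2 :: real) ^ s < R" using real_arch_pow_inv[OF R, of "1 / 2"] by auto
  have le: "swt s \<beta> \<le> mi_power (vec R) \<beta>" for \<beta>
    unfolding swt_eq
  proof (rule mi_power_mono)
    fix i
    show "0 \<le> (\<chi> k. (1 / real (p (Inl k))) ^ s) $ i" using radius_pos[of s i] by simp
    have "(1 / real (p (Inl i))) ^ s \<le> (1 / 2) ^ s"
      using prime_ge_2_nat[OF prime_p[of "Inl i"]] by (intro power_mono divide_left_mono) auto
    with s show "(\<chi> k. (1 / real (p (Inl k))) ^ s) $ i \<le> vec R $ i" by simp
  qed
  have "vbound s (\<lambda>q. a (snd q) (fst q)) (\<Sum>j\<in>(UNIV :: 'j set). M)"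
    unfolding vbound_def
  proof (intro allI impI)
    fix F :: "((nat ^ 'n) \<times> 'j) set" assume F: "finite F"
    have "(\<Sum>q\<in>F. \<bar>a (snd q) (fst q)\<bar> * wt s q) \<le> (\<Sum>q\<in>fst ` F \<times> UNIV. \<bar>a (snd q) (fst q)\<bar> * wt s q)"
      using F by (intro sum_mono2) (auto intro: rev_image_eqI)
    also have "\<dots> \<le> (\<Sum>q\<in>fst ` F \<times> UNIV. \<bar>a (snd q) (fst q)\<bar> * mi_power (vec R) (fst q))"
      by (intro sum_mono mult_left_mono order_trans[OF wt_le_swt le]) auto
    also have "\<dots> = (\<Sum>\<beta>\<in>fst ` F. \<Sum>j\<in>UNIV. \<bar>a j \<beta>\<bar> * mi_power (vec R) \<beta>)"
      by (simp add: sum.cartesian_product case_prod_unfold)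
    also have "\<dots> = (\<Sum>j\<in>UNIV. \<Sum>\<beta>\<in>fst ` F. \<bar>a j \<beta>\<bar> * mi_power (vec R) \<beta>)"
      by (rule sum.swap)
    also have "\<dots> \<le> (\<Sum>j\<in>(UNIV :: 'j set). M)"
      using F by (intro sum_mono ps_boundD[OF a]) auto
    finally show "(\<Sum>q\<in>F. \<bar>a (snd q) (fst q)\<bar> * wt s q) \<le> (\<Sum>j\<in>(UNIV :: 'j set). M)" .
  qed
  then show ?thesis by blast
qed

text \<open>The scale is left open: a bound at one scale holds at all larger ones, and division
  chooses the scale only later.\<close>

definition represents :: "((nat ^ 'n) \<times> 'j \<Rightarrow> real) \<Rightarrow> (real ^ 'n \<Rightarrow> real ^ 'j) \<Rightarrow> bool" where
  "represents a f \<longleftrightarrow> (\<exists>s C. vbound s a C) \<and> (\<forall>\<^sub>F x in nhds 0. \<forall>j. f x $ j = ps_eval (\<lambda>\<beta>. a (\<beta>, j)) x)"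

lemma analytic_represents:
  assumes "\<And>j. analytic_germ (\<lambda>x. f x $ j)"
  shows "\<exists>a. represents a f"
proof -
  have "\<exists>R a M. 0 < R \<and> R \<le> 1 \<and> 0 \<le> M \<and> (\<forall>j\<in>UNIV. ps_bound (vec R) (a j) M \<and> (\<forall>x\<in>ball 0 R. f x $ j = ps_eval (a j) x))"
    by (rule analytic_germs_common_radius[OF finite]) (auto intro: assms)
  then obtain R a M where R: "0 < R" and a: "\<And>j. ps_bound (vec R) (a j) M"
    and eq: "\<And>j x. x \<in> ball 0 R \<Longrightarrow> f x $ j = ps_eval (a j) x" by blast
  have "\<forall>\<^sub>F x in nhds (0 :: real ^ 'n). x \<in> ball 0 R" using R by (intro eventually_nhds_in_open) auto
  then have "\<forall>\<^sub>F x in nhds 0. \<forall>j. f x $ j = ps_eval (a j) x" by eventually_elim (auto intro: eq)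
  with vbound_of_components[OF a R] show ?thesis
    unfolding represents_def by (intro exI[of _ "\<lambda>q. a (snd q) (fst q)"]) simp
qed

lemma ex_lead: "h q \<noteq> 0 \<Longrightarrow> \<exists>q0. lead h q0"
  using ex_has_least_nat[of "\<lambda>q. h q \<noteq> 0" q key] unfolding lead_def by (metis not_less)

text \<open>All requirements on the scale hold from some point on. Finitely many divisors and the
  dividend thus share one scale, at which the division of coefficients is evaluated on a common
  polydisc.\<close>

lemma germ_division:
  assumes I: "finite I" and lead: "\<And>i. i \<in> I \<Longrightarrow> lead (a i) (b i)"
    and rep: "\<And>i. i \<in> I \<Longrightarrow> represents (a i) (fi i)" and h: "represents h f"
  shows "\<exists>c R. (\<forall>i\<in>I. analytic_germ (c i)) \<and> represents R (\<lambda>x. f x - (\<Sum>i\<in>I. c i x *\<^sub>R fi i x)) \<and>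
    (\<forall>q. (\<exists>i\<in>I. covers (b i) q) \<longrightarrow> R q = 0)"
proof -
  have ev_bound: "\<forall>\<^sub>F s in sequentially. \<exists>C. vbound s a C" if "\<exists>s C. vbound s a C" for a
    using that vbound_mono unfolding eventually_sequentially by meson
  have "\<forall>\<^sub>F s in sequentially. (\<exists>C. vbound s (a i) C) \<and> (\<forall>F. finite F \<longrightarrow> b i \<notin> F \<longrightarrow>
      (\<Sum>q\<in>F. \<bar>a i q\<bar> * wt s q) \<le> \<bar>a i (b i)\<bar> / 2 * wt s (b i))" if i: "i \<in> I" for i
  proof -
    obtain s0 C where "vbound s0 (a i) C" using rep[OF i] unfolding represents_def by blast
    moreover have "0 < \<bar>a i (b i)\<bar> / 2" using lead[OF i] unfolding lead_def by simp
    ultimately have "\<forall>\<^sub>F s in sequentially. \<forall>F. finite F \<longrightarrow> b i \<notin> F \<longrightarrow>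
      (\<Sum>q\<in>F. \<bar>a i q\<bar> * wt s q) \<le> \<bar>a i (b i)\<bar> / 2 * wt s (b i)"
      using tail_small[OF _ lead[OF i]] unfolding eventually_sequentially by blast
    moreover have "\<forall>\<^sub>F s in sequentially. \<exists>C. vbound s (a i) C"
      using rep[OF i] unfolding represents_def by (intro ev_bound) blast
    ultimately show ?thesis by eventually_elim simp
  qed
  then have "\<forall>\<^sub>F s in sequentially. \<forall>i\<in>I. (\<exists>C. vbound s (a i) C) \<and> (\<forall>F. finite F \<longrightarrow> b i \<notin> F \<longrightarrow>
      (\<Sum>q\<in>F. \<bar>a i q\<bar> * wt s q) \<le> \<bar>a i (b i)\<bar> / 2 * wt s (b i))"
    using I by (simp add: eventually_ball_finite)
  moreover have "\<forall>\<^sub>F s in sequentially. \<exists>C. vbound s h C"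
    using h unfolding represents_def by (intro ev_bound) blast
  ultimately have "\<forall>\<^sub>F s in sequentially. (\<forall>i\<in>I. (\<exists>C. vbound s (a i) C) \<and> (\<forall>F. finite F \<longrightarrow> b i \<notin> F \<longrightarrow>
      (\<Sum>q\<in>F. \<bar>a i q\<bar> * wt s q) \<le> \<bar>a i (b i)\<bar> / 2 * wt s (b i))) \<and> (\<exists>C. vbound s h C)"
    by (rule eventually_conj)
  then obtain s where s: "\<forall>i\<in>I. (\<exists>C. vbound s (a i) C) \<and> (\<forall>F. finite F \<longrightarrow> b i \<notin> F \<longrightarrow>
      (\<Sum>q\<in>F. \<bar>a i q\<bar> * wt s q) \<le> \<bar>a i (b i)\<bar> / 2 * wt s (b i))" "\<exists>C. vbound s h C"
    using eventually_happens'[OF sequentially_bot] by blast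
  obtain C where hC: "vbound s h C" using s(2) by blast
  interpret division p I a b s
    by unfold_locales (use I lead s(1) in blast)+
  let ?w = "\<chi> k. (1 / real (p (Inl k))) ^ s"
  obtain c R DR where c: "\<forall>i\<in>I. \<exists>D. ps_bound ?w (c i) D" and DR: "vbound s R DR"
    and R: "\<forall>q. (\<exists>i\<in>I. covers (b i) q) \<longrightarrow> R q = 0"
    and eq: "\<forall>\<beta> j. h (\<beta>, j) = (\<Sum>i\<in>I. ps_mult (c i) (\<lambda>\<beta>. a i (\<beta>, j)) \<beta>) + R (\<beta>, j)"
    using division[OF hC] by (elim exE conjE) (rule that)
  obtain D where D: "\<And>i. i \<in> I \<Longrightarrow> ps_bound ?w (c i) (D i)" using c by metis
  have "\<forall>i\<in>I. \<exists>C. vbound s (a i) C" using s(1) by blast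
  then obtain A where A: "\<And>i. i \<in> I \<Longrightarrow> vbound s (a i) (A i)" by metis
  have w: "0 \<le> ?w $ i" for i using radius_pos[of s i] by (rule less_imp_le)
  have "\<forall>\<^sub>F x in nhds 0. \<forall>i\<in>I. \<forall>j. fi i x $ j = ps_eval (\<lambda>\<beta>. a i (\<beta>, j)) x"
    using I rep unfolding represents_def by (simp add: eventually_ball_finite)
  moreover have "\<forall>\<^sub>F x in nhds 0. \<forall>j. f x $ j = ps_eval (\<lambda>\<beta>. h (\<beta>, j)) x"
    using h unfolding represents_def by blast
  moreover have "\<forall>\<^sub>F x in nhds 0. \<forall>i. \<bar>x $ i\<bar> \<le> ?w $ i"
    by (rule eventually_components_le[OF radius_pos])
  ultimately have "\<forall>\<^sub>F x in nhds 0. \<forall>j. (f x - (\<Sum>i\<in>I. ps_eval (c i) x *\<^sub>R fi i x)) $ j = ps_eval (\<lambda>\<beta>. R (\<beta>, j)) x"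
  proof eventually_elim
    case (elim x)
    have x: "\<bar>x $ i\<bar> \<le> ?w $ i" for i using elim(3) by blast
    show ?case
    proof
      fix j
      note ca = ps_bound_mult[OF D vbound_component[OF A, of _ j] w]
      have "ps_eval (\<lambda>\<beta>. h (\<beta>, j)) x = ps_eval (\<lambda>\<beta>. (\<Sum>i\<in>I. ps_mult (c i) (\<lambda>\<beta>. a i (\<beta>, j)) \<beta>) + R (\<beta>, j)) x"
        using eq by simp
      also have "\<dots> = ps_eval (\<lambda>\<beta>. \<Sum>i\<in>I. ps_mult (c i) (\<lambda>\<beta>. a i (\<beta>, j)) \<beta>) x + ps_eval (\<lambda>\<beta>. R (\<beta>, j)) x"
        by (rule ps_eval_add[OF ps_bound_sum[OF I ca w] vbound_component[OF DR] x])
      also have "ps_eval (\<lambda>\<beta>. \<Sum>i\<in>I. ps_mult (c i) (\<lambda>\<beta>. a i (\<beta>, j)) \<beta>) x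
          = (\<Sum>i\<in>I. ps_eval (ps_mult (c i) (\<lambda>\<beta>. a i (\<beta>, j))) x)"
        by (rule ps_eval_sum[OF I ca x])
      also have "\<dots> = (\<Sum>i\<in>I. ps_eval (c i) x * fi i x $ j)"
      proof (rule sum.cong[OF refl])
        fix i assume i: "i \<in> I"
        have "ps_eval (ps_mult (c i) (\<lambda>\<beta>. a i (\<beta>, j))) x = ps_eval (c i) x * ps_eval (\<lambda>\<beta>. a i (\<beta>, j)) x"
          by (rule ps_eval_mult[OF D[OF i] vbound_component[OF A[OF i]] x])
        then show "ps_eval (ps_mult (c i) (\<lambda>\<beta>. a i (\<beta>, j))) x = ps_eval (c i) x * fi i x $ j"
          using elim(1) i by simp
      qed
      finally show "(f x - (\<Sum>i\<in>I. ps_eval (c i) x *\<^sub>R fi i x)) $ j = ps_eval (\<lambda>\<beta>. R (\<beta>, j)) x"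
        using elim(2) by (simp add: sum_component)
    qed
  qed
  then have "represents R (\<lambda>x. f x - (\<Sum>i\<in>I. ps_eval (c i) x *\<^sub>R fi i x))"
    unfolding represents_def using DR by blast
  moreover have "\<forall>i\<in>I. analytic_germ (ps_eval (c i))"
    using ps_eval_analytic_germ[OF D radius_pos] by blast
  ultimately show ?thesis using R by (intro exI[of _ "\<lambda>i. ps_eval (c i)"] exI[of _ R] conjI)
qed

end

text \<open>The degree \<open>d\<close> is treated as the exponent of additional variables: Dickson's lemma is applied to
  the pairs (degree, leading exponent).\<close>

theorem germ_finite_generation:
  fixes S :: "((real ^ 'n \<Rightarrow> real ^ 'n) \<times> (nat ^ 'v)) set"
  assumes S: "\<And>y. y \<in> S \<Longrightarrow> analytic_field (fst y)"
  shows "\<exists>F\<subseteq>S. finite F \<and> (\<forall>y\<in>S. germ.graded_span F (snd y) (fst y))"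
proof -
  obtain p :: "'n + 'n \<Rightarrow> nat" where p: "inj p" "\<And>k. prime (p k)" using distinct_primes_exist by blast
  interpret monomial_key p by unfold_locales (use p in auto)
  \<comment> \<open>The germs in the module of degree \<open>d\<close>: spans of finitely many
    elements of \<open>S\<close> whose degrees are at most \<open>d\<close>.\<close>
  define M where "M d f \<longleftrightarrow> (\<exists>F\<subseteq>S. finite F \<and> germ.graded_span F d f)" for d :: "nat ^ 'v" and f
  \<comment> \<open>One set per component, because divisibility of monomials preserves the
    component. Degree and leading exponent are joined into a single multi-index, so that its
    componentwise order compares both at once.\<close>
  define E where "E j = {z :: nat ^ ('v + 'n). \<exists>a f. lead a (vsnd z, j) \<and> represents a f \<and> M (vfst z) f}" for j
  have "\<exists>B\<subseteq>E j. finite B \<and> (\<forall>x\<in>E j. \<exists>y\<in>B. y \<le> x)" for j by (rule dickson)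
  then obtain B where B: "\<And>j. B j \<subseteq> E j" "\<And>j. finite (B j)" "\<And>j x. x \<in> E j \<Longrightarrow> \<exists>y\<in>B j. y \<le> x"
    by metis
  define I where "I = Sigma UNIV B"
  have finI: "finite I" unfolding I_def using B(2) by auto
  have "\<forall>i\<in>I. \<exists>a f F. lead a (vsnd (snd i), fst i) \<and> represents a f \<and> F \<subseteq> S \<and> finite F \<and> germ.graded_span F (vfst (snd i)) f"
  proof
    fix i assume "i \<in> I"
    then have "snd i \<in> B (fst i)" by (auto simp: I_def)
    then have "snd i \<in> E (fst i)" using B(1)[of "fst i"] by blast
    then show "\<exists>a f F. lead a (vsnd (snd i), fst i) \<and> represents a f \<and> F \<subseteq> S \<and> finite F \<and> germ.graded_span F (vfst (snd i)) f"
      unfolding E_def M_def by blast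
  qed
  then have "\<exists>a. \<forall>i\<in>I. \<exists>f F. lead (a i) (vsnd (snd i), fst i) \<and> represents (a i) f \<and> F \<subseteq> S \<and> finite F \<and> germ.graded_span F (vfst (snd i)) f"
    by (rule bchoice)
  then obtain a where "\<forall>i\<in>I. \<exists>f F. lead (a i) (vsnd (snd i), fst i) \<and> represents (a i) f \<and> F \<subseteq> S \<and> finite F \<and> germ.graded_span F (vfst (snd i)) f" ..
  then have "\<exists>fi. \<forall>i\<in>I. \<exists>F. lead (a i) (vsnd (snd i), fst i) \<and> represents (a i) (fi i) \<and> F \<subseteq> S \<and> finite F \<and> germ.graded_span F (vfst (snd i)) (fi i)"
    by (rule bchoice)
  then obtain fi where "\<forall>i\<in>I. \<exists>F. lead (a i) (vsnd (snd i), fst i) \<and> represents (a i) (fi i) \<and> F \<subseteq> S \<and> finite F \<and> germ.graded_span F (vfst (snd i)) (fi i)" ..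
  then have "\<exists>Fi. \<forall>i\<in>I. lead (a i) (vsnd (snd i), fst i) \<and> represents (a i) (fi i) \<and> Fi i \<subseteq> S \<and> finite (Fi i) \<and> germ.graded_span (Fi i) (vfst (snd i)) (fi i)"
    by (rule bchoice)
  then obtain Fi where i: "\<And>i. i \<in> I \<Longrightarrow> lead (a i) (vsnd (snd i), fst i)"
    "\<And>i. i \<in> I \<Longrightarrow> represents (a i) (fi i)" "\<And>i. i \<in> I \<Longrightarrow> Fi i \<subseteq> S" "\<And>i. i \<in> I \<Longrightarrow> finite (Fi i)"
    "\<And>i. i \<in> I \<Longrightarrow> germ.graded_span (Fi i) (vfst (snd i)) (fi i)"
    by blast
  define F where "F = (\<Union>i\<in>I. Fi i)"
  have F: "F \<subseteq> S" "finite F" unfolding F_def using i(3,4) finI by auto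
  have "germ.graded_span F (snd y) (fst y)" if y: "y \<in> S" for y
  proof -
    define d where "d = snd y"
    \<comment> \<open>Only divisors whose module degree is at most \<open>d\<close> take part;
      otherwise the quotients would use generators not permitted for \<open>d\<close>.\<close>
    define J where "J = {i \<in> I. vfst (snd i) \<le> d}"
    have J: "finite J" "\<And>i. i \<in> J \<Longrightarrow> i \<in> I" using finI by (auto simp: J_def)
    obtain h where h: "represents h (fst y)"
      using analytic_represents[of "fst y"] S[OF y] unfolding analytic_field_def by blast
    have "\<exists>c R. (\<forall>i\<in>J. analytic_germ (c i)) \<and> represents R (\<lambda>x. fst y x - (\<Sum>i\<in>J. c i x *\<^sub>R fi i x)) \<and>
        (\<forall>q. (\<exists>i\<in>J. covers (vsnd (snd i), fst i) q) \<longrightarrow> R q = 0)"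
    proof (rule germ_division[OF J(1) _ _ h])
      show "lead (a k) (vsnd (snd k), fst k)" "represents (a k) (fi k)" if "k \<in> J" for k
        using i(1,2)[OF J(2)[OF that]] by auto
    qed
    then obtain c R where c: "\<forall>i\<in>J. analytic_germ (c i)"
      and R: "represents R (\<lambda>x. fst y x - (\<Sum>i\<in>J. c i x *\<^sub>R fi i x))"
        "\<forall>q. (\<exists>i\<in>J. covers (vsnd (snd i), fst i) q) \<longrightarrow> R q = 0"
      by blast
    let ?r = "\<lambda>x. fst y x - (\<Sum>i\<in>J. c i x *\<^sub>R fi i x)"
    have span_sum: "germ.graded_span F d (\<lambda>x. \<Sum>i\<in>J. c i x *\<^sub>R fi i x)"
    proof (intro germ.graded_span_sum germ.graded_span_scale)
      fix k assume k: "k \<in> J"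
      have "Fi k \<subseteq> F" using J(2)[OF k] by (auto simp: F_def)
      then show "germ.graded_span F d (fi k)"
        using k by (intro germ.graded_span_mono[OF i(5)[OF J(2)[OF k]] F(2)]) (auto simp: J_def)
      show "analytic_germ (c k)" using c k by blast
    qed
    \<comment> \<open>The remainder stays in the module of degree \<open>d\<close>; here
      \<open>y\<close> itself may serve as a generator, since this set is not the final
      \<open>F\<close>.\<close>
    have "M d ?r"
      unfolding M_def
    proof (intro exI conjI)
      let ?F = "insert y F"
      show "?F \<subseteq> S" "finite ?F" using F y by auto
      have 1: "germ.graded_span ?F d (fst y)" by (rule germ.graded_span_member) (use F in \<open>auto simp: d_def\<close>)
      have 2: "germ.graded_span ?F d (\<lambda>x. \<Sum>i\<in>J. c i x *\<^sub>R fi i x)"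
        by (rule germ.graded_span_mono[OF span_sum]) (use F in auto)
      show "germ.graded_span ?F d ?r"
        using germ.graded_span_add[OF 1 germ.graded_span_scale[OF 2 analytic_germ_const[of "-1"]]] by simp
    qed
    \<comment> \<open>A nonzero remainder would have a leading monomial recorded in
      \<open>E\<close>, hence divisible by one belonging to \<open>J\<close>, where the remainder
      has no coefficients.\<close>
    have R0: "R q = 0" for q
    proof (rule ccontr)
      assume "R q \<noteq> 0"
      then obtain q0 where q0: "lead R q0" using ex_lead by blast
      let ?z = "vjoin d (fst q0)"
      have "?z \<in> E (snd q0)"
        unfolding E_def using q0 R(1) \<open>M d ?r\<close> by auto
      then obtain z where z: "z \<in> B (snd q0)" "z \<le> ?z" using B(3) by blast
      have "vfst z \<le> d" "vsnd z \<le> fst q0"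
      proof -
        have "z $ k \<le> ?z $ k" for k using z(2) by (simp add: less_eq_vec_def)
        from this[of "Inl k" for k] this[of "Inr k" for k]
        show "vfst z \<le> d" "vsnd z \<le> fst q0" by (simp_all add: less_eq_vec_def vfst_def vsnd_def)
      qed
      then have "(snd q0, z) \<in> J" "covers (vsnd (snd (snd q0, z)), fst (snd q0, z)) q0"
        using z(1) by (auto simp: J_def I_def covers_def)
      then have "R q0 = 0" using R(2) by blast
      then show False using q0 by (simp add: lead_def)
    qed
    have "\<forall>\<^sub>F x in nhds 0. \<forall>j. ?r x $ j = ps_eval (\<lambda>\<beta>. R (\<beta>, j)) x"
      using R(1) unfolding represents_def by blast
    then have "\<forall>\<^sub>F x in nhds 0. (\<Sum>i\<in>J. c i x *\<^sub>R fi i x) = fst y x"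
    proof eventually_elim
      case (elim x)
      then have "?r x = 0" by (simp add: R0 ps_eval_zero vec_eq_iff)
      then show ?case by simp
    qed
    then have "germ.graded_span F d (fst y)" by (rule germ.graded_span_cong[OF _ span_sum])
    then show ?thesis by (simp add: d_def)
  qed
  with F show ?thesis by blast
qed

section \<open>From germs to a common neighborhood\<close>

lemma eventually_at_right_ball:
  assumes "\<forall>\<^sub>F x in nhds (0 :: 'a::real_normed_vector). P x"
  shows "\<forall>\<^sub>F r in at_right (0::real). \<forall>x\<in>ball 0 r. P x"
proof -
  obtain e where e: "0 < e" "\<And>x. dist x 0 < e \<Longrightarrow> P x"
    using assms unfolding eventually_nhds_metric by blast
  show ?thesis
    using eventually_at_right_real[OF e(1)] by eventually_elim (auto intro!: e(2))
qed

lemma eventually_smooth_on_ball: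
  assumes "analytic_germ f"
  shows "\<forall>\<^sub>F r in at_right (0::real). smooth_on f (ball 0 r)"
proof -
  obtain e where e: "0 < e" "smooth_on f (ball 0 e)" using analytic_germ_smooth[OF assms] by blast
  show ?thesis
    using eventually_at_right_real[OF e(1)] by eventually_elim (rule smooth_on_subset[OF e(2)], auto)
qed

lemma coefficient_class_smooth: "open U \<Longrightarrow> coefficient_class (\<lambda>f. smooth_on f U)"
  by unfold_locales (auto intro: smooth_on_const smooth_on_add smooth_on_mult)

abbreviation smooth_span :: "(real ^ 'n) set \<Rightarrow> ((real ^ 'n \<Rightarrow> real ^ 'n) \<times> (nat ^ 'v)) set \<Rightarrow> nat ^ 'v \<Rightarrow>
    (real ^ 'n \<Rightarrow> real ^ 'n) \<Rightarrow> bool" where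
  "smooth_span U \<equiv> coefficient_class.graded_span (\<lambda>f. smooth_on f U) (principal U)"

context
  fixes U :: "(real ^ 'n) set" and F :: "((real ^ 'n \<Rightarrow> real ^ 'n) \<times> (nat ^ 'v)) set"
  assumes U: "open U" and F: "finite F"
begin

interpretation smooth: coefficient_class "\<lambda>f. smooth_on f U" "principal U"
  by (rule coefficient_class_smooth[OF U])

lemma smooth_span_has_derivative:
  assumes c: "\<And>y. y \<in> F \<Longrightarrow> smooth_on (c y) U" and sm: "\<And>y. y \<in> F \<Longrightarrow> smooth_on (fst y) U"
    and f: "\<And>x. x \<in> U \<Longrightarrow> f x = (\<Sum>y | y \<in> F \<and> snd y \<le> d. c y x *\<^sub>R fst y x)" and x: "x \<in> U"
  shows "frechet_derivative f (at x) h = (\<Sum>y | y \<in> F \<and> snd y \<le> d.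
    c y x *\<^sub>R frechet_derivative (fst y) (at x) h + frechet_derivative (c y) (at x) h *\<^sub>R fst y x)"
proof -
  have "((\<lambda>x. \<Sum>y | y \<in> F \<and> snd y \<le> d. c y x *\<^sub>R fst y x) has_derivative (\<lambda>h. \<Sum>y | y \<in> F \<and> snd y \<le> d.
    c y x *\<^sub>R frechet_derivative (fst y) (at x) h + frechet_derivative (c y) (at x) h *\<^sub>R fst y x)) (at x)"
    by (rule has_derivative_sum, rule has_derivative_scaleR)
       (auto intro: smooth_on_has_derivative[OF c x] smooth_on_has_derivative[OF sm x])
  then have "(f has_derivative (\<lambda>h. \<Sum>y | y \<in> F \<and> snd y \<le> d.
    c y x *\<^sub>R frechet_derivative (fst y) (at x) h + frechet_derivative (c y) (at x) h *\<^sub>R fst y x)) (at x)"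
    by (rule has_derivative_transform_within_open[OF _ U x]) (simp add: f)
  from fun_cong[OF frechet_derivative_at[OF this], of h, symmetric] show ?thesis .
qed

text \<open>Once the finitely many brackets of generators lie in the span over \<open>U\<close>, the Leibniz rule puts
  all brackets into the span over the same \<open>U\<close>.\<close>

lemma smooth_span_lie_bracket:
  assumes sm: "\<And>y. y \<in> F \<Longrightarrow> smooth_on (fst y) U"
    and rel: "\<And>y z. y \<in> F \<Longrightarrow> z \<in> F \<Longrightarrow> smooth_span U F (snd y + snd z) (lie_bracket (fst y) (fst z))"
    and X: "smooth_span U F d X" "smooth_on X U" and Y: "smooth_span U F e Y" "smooth_on Y U"
  shows "smooth_span U F (d + e) (lie_bracket X Y)"
proof -
  obtain a where a: "\<And>y. y \<in> F \<Longrightarrow> smooth_on (a y) U"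
    "\<And>x. x \<in> U \<Longrightarrow> X x = (\<Sum>y | y \<in> F \<and> snd y \<le> d. a y x *\<^sub>R fst y x)"
    using X(1) by (auto simp: smooth.graded_span_def eventually_principal)
  obtain b where b: "\<And>y. y \<in> F \<Longrightarrow> smooth_on (b y) U"
    "\<And>x. x \<in> U \<Longrightarrow> Y x = (\<Sum>y | y \<in> F \<and> snd y \<le> e. b y x *\<^sub>R fst y x)"
    using Y(1) by (auto simp: smooth.graded_span_def eventually_principal)
  let ?A = "{y \<in> F. snd y \<le> d}" and ?B = "{z \<in> F. snd z \<le> e}"
  \<comment> \<open>The Leibniz expansion: products of coefficients times brackets of generators,
    plus derivatives of the \<open>b z\<close> along \<open>X\<close> and minus derivatives of the
    \<open>a y\<close> along \<open>Y\<close>. The degrees are at most \<open>d + e\<close> in all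
    three sums.\<close>
  let ?f = "\<lambda>x. (\<Sum>y\<in>?A. \<Sum>z\<in>?B. (a y x * b z x) *\<^sub>R lie_bracket (fst y) (fst z) x)
    + ((\<Sum>z\<in>?B. frechet_derivative (b z) (at x) (X x) *\<^sub>R fst z x)
    + (\<Sum>y\<in>?A. - frechet_derivative (a y) (at x) (Y x) *\<^sub>R fst y x))"
  have span: "smooth_span U F (d + e) ?f"
  proof (intro smooth.graded_span_add smooth.graded_span_sum smooth.graded_span_scale smooth_on_mult[OF U] smooth_on_minus[OF U]
      smooth_on_frechet_field[OF U])
    have le: "d \<le> d + e" "e \<le> d + e" by (auto simp: less_eq_vec_def)
    fix y assume y: "y \<in> ?A"
    show "smooth_on (a y) U" "smooth_on (a y) U" using a y by auto
    show "smooth_span U F (d + e) (fst y)"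
      using y le(1) by (intro smooth.graded_span_member[OF F]) (auto intro: order_trans)
    fix z assume z: "z \<in> ?B"
    show "smooth_on (b z) U" using b z by auto
    show "smooth_span U F (d + e) (lie_bracket (fst y) (fst z))"
      using y z by (intro smooth.graded_span_mono[OF rel F]) (auto simp: less_eq_vec_def intro: add_mono)
  next
    fix z assume z: "z \<in> ?B"
    show "smooth_on (b z) U" using b z by auto
    have "e \<le> d + e" by (auto simp: less_eq_vec_def)
    then show "smooth_span U F (d + e) (fst z)"
      using z by (intro smooth.graded_span_member[OF F]) (auto intro: order_trans)
  qed (use X Y in auto)
  have eq: "?f x = lie_bracket X Y x" if x: "x \<in> U" for x
  proof -
    have lin: "linear (frechet_derivative (fst y) (at x))" if "y \<in> F" for y
      using smooth_on_has_derivative[OF sm[OF that] x] has_derivative_linear by blast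
    have 1: "frechet_derivative (fst z) (at x) (X x) = (\<Sum>y\<in>?A. a y x *\<^sub>R frechet_derivative (fst z) (at x) (fst y x))"
      if "z \<in> F" for z
      unfolding a(2)[OF x] linear_sum[OF lin[OF that]] linear_scale[OF lin[OF that]] ..
    have 2: "frechet_derivative (fst y) (at x) (Y x) = (\<Sum>z\<in>?B. b z x *\<^sub>R frechet_derivative (fst y) (at x) (fst z x))"
      if "y \<in> F" for y
      unfolding b(2)[OF x] linear_sum[OF lin[OF that]] linear_scale[OF lin[OF that]] ..
    have DY0: "frechet_derivative Y (at x) (X x) = (\<Sum>z\<in>?B.
        b z x *\<^sub>R frechet_derivative (fst z) (at x) (X x) + frechet_derivative (b z) (at x) (X x) *\<^sub>R fst z x)"
      by (rule smooth_span_has_derivative) (fact b(1) sm b(2) x)+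
    have DX0: "frechet_derivative X (at x) (Y x) = (\<Sum>y\<in>?A.
        a y x *\<^sub>R frechet_derivative (fst y) (at x) (Y x) + frechet_derivative (a y) (at x) (Y x) *\<^sub>R fst y x)"
      by (rule smooth_span_has_derivative) (fact a(1) sm a(2) x)+
    have DY: "frechet_derivative Y (at x) (X x)
        = (\<Sum>z\<in>?B. b z x *\<^sub>R (\<Sum>y\<in>?A. a y x *\<^sub>R frechet_derivative (fst z) (at x) (fst y x)))
          + (\<Sum>z\<in>?B. frechet_derivative (b z) (at x) (X x) *\<^sub>R fst z x)"
      unfolding DY0 sum.distrib by (simp add: 1)
    have DX: "frechet_derivative X (at x) (Y x)
        = (\<Sum>y\<in>?A. a y x *\<^sub>R (\<Sum>z\<in>?B. b z x *\<^sub>R frechet_derivative (fst y) (at x) (fst z x)))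
          + (\<Sum>y\<in>?A. frechet_derivative (a y) (at x) (Y x) *\<^sub>R fst y x)"
      unfolding DX0 sum.distrib by (simp add: 2)
    have DY': "(\<Sum>z\<in>?B. b z x *\<^sub>R (\<Sum>y\<in>?A. a y x *\<^sub>R frechet_derivative (fst z) (at x) (fst y x)))
        = (\<Sum>y\<in>?A. \<Sum>z\<in>?B. (a y x * b z x) *\<^sub>R frechet_derivative (fst z) (at x) (fst y x))"
      by (subst sum.swap) (simp add: scaleR_sum_right mult.commute)
    have "(\<Sum>y\<in>?A. \<Sum>z\<in>?B. (a y x * b z x) *\<^sub>R lie_bracket (fst y) (fst z) x)
        = (\<Sum>y\<in>?A. \<Sum>z\<in>?B. (a y x * b z x) *\<^sub>R frechet_derivative (fst z) (at x) (fst y x))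
        - (\<Sum>y\<in>?A. \<Sum>z\<in>?B. (a y x * b z x) *\<^sub>R frechet_derivative (fst y) (at x) (fst z x))"
      by (simp add: lie_bracket_def scaleR_diff_right sum_subtractf)
    then show ?thesis
      unfolding lie_bracket_def[of X Y] DX DY DY' by (simp add: scaleR_sum_right sum_negf algebra_simps)
  qed
  have "\<forall>\<^sub>F x in principal U. ?f x = lie_bracket X Y x"
    unfolding eventually_principal by (rule ballI) (rule eq)
  then show ?thesis by (rule smooth.graded_span_cong[OF _ span])
qed

end

theorem finite_type_of_analytic:
  fixes P :: "((real ^ 'n \<Rightarrow> real ^ 'n) \<times> (nat ^ 'v)) set"
  assumes W: "open W" "0 \<in> W" and P: "finite P" "\<And>y. y \<in> P \<Longrightarrow> smooth_on (fst y) W"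
    "\<And>y. y \<in> P \<Longrightarrow> analytic_field (fst y)"
  shows "finite_type_condition W (bracket_closure P)"
proof -
  let ?S = "bracket_closure P"
  have sm: "smooth_on (fst y) W" and an: "analytic_field (fst y)" if "y \<in> ?S" for y
    using that
  proof (induction rule: bracket_closure.induct)
    case (base y)
    { case 1 show ?case by (rule P(2)[OF base]) }
    { case 2 show ?case by (rule P(3)[OF base]) }
  next
    case (bracket X d Y e)
    { case 1 show ?case using bracket.IH by (simp add: smooth_on_lie_bracket[OF W(1)]) }
    { case 2 show ?case using bracket.IH by (simp add: analytic_field_lie_bracket) }
  qed
  obtain F0 where F0: "F0 \<subseteq> ?S" "finite F0" "\<forall>y\<in>?S. germ.graded_span F0 (snd y) (fst y)"
    using germ_finite_generation[of ?S] an by blast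
  \<comment> \<open>Adjoining the finite set \<open>P\<close> makes the base case plain membership,
    valid on every ball, so only brackets of members of \<open>F\<close> impose conditions on the
    radius.\<close>
  define F where "F = F0 \<union> P"
  have F: "F \<subseteq> ?S" "finite F" "P \<subseteq> F"
    using F0 P(1) by (auto simp: F_def intro: bracket_closure.base)
  have "\<forall>\<^sub>F r in at_right 0. smooth_span (ball 0 r) F (snd y + snd z) (lie_bracket (fst y) (fst z))"
    if "y \<in> F" "z \<in> F" for y z
  proof -
    have "(lie_bracket (fst y) (fst z), snd y + snd z) \<in> ?S"
      using that F(1) by (intro bracket_closure.bracket) auto
    then have "germ.graded_span F0 (snd y + snd z) (lie_bracket (fst y) (fst z))" using F0(3) by force
    then have "germ.graded_span F (snd y + snd z) (lie_bracket (fst y) (fst z))"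
      by (rule germ.graded_span_mono) (use F(2) in \<open>auto simp: F_def\<close>)
    then obtain c where c: "\<And>v. v \<in> F \<Longrightarrow> analytic_germ (c v)"
      "\<forall>\<^sub>F x in nhds 0. lie_bracket (fst y) (fst z) x = (\<Sum>v | v \<in> F \<and> snd v \<le> snd y + snd z. c v x *\<^sub>R fst v x)"
      unfolding germ.graded_span_def by blast
    have "\<forall>\<^sub>F r in at_right 0. \<forall>v\<in>F. smooth_on (c v) (ball 0 r)"
      using F(2) c(1) by (simp add: eventually_ball_finite eventually_smooth_on_ball)
    with eventually_at_right_ball[OF c(2)] show ?thesis
      unfolding coefficient_class.graded_span_def[OF coefficient_class_smooth[OF open_ball]] eventually_principal
      by eventually_elim blast
  qed
  then have "\<forall>\<^sub>F r in at_right 0. \<forall>y\<in>F. \<forall>z\<in>F.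
      smooth_span (ball 0 r) F (snd y + snd z) (lie_bracket (fst y) (fst z))"
    using F(2) by (simp add: eventually_ball_finite)
  moreover have "\<forall>\<^sub>F r in at_right 0. \<forall>x\<in>ball 0 r. x \<in> W"
    using W by (intro eventually_at_right_ball eventually_nhds_in_open)
  moreover have "\<forall>\<^sub>F r in at_right (0::real). 0 < r" by (rule eventually_at_right_less)
  ultimately have "\<forall>\<^sub>F r in at_right 0. (\<forall>y\<in>F. \<forall>z\<in>F.
      smooth_span (ball 0 r) F (snd y + snd z) (lie_bracket (fst y) (fst z))) \<and> (\<forall>x\<in>ball 0 r. x \<in> W) \<and> 0 < r"
    by eventually_elim blast
  then obtain r where r: "\<forall>y\<in>F. \<forall>z\<in>F. smooth_span (ball 0 r) F (snd y + snd z) (lie_bracket (fst y) (fst z))"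
    "\<forall>x\<in>ball 0 r. x \<in> W" "0 < r"
    using eventually_happens'[OF trivial_limit_at_right_real] by blast
  let ?U = "ball (0 :: real ^ 'n) r"
  have UW: "?U \<subseteq> W" using r(2) by blast
  have smU: "smooth_on (fst y) ?U" if "y \<in> ?S" for y
    by (rule smooth_on_subset[OF sm[OF that] UW])
  \<comment> \<open>The radius is already fixed here, so the induction over arbitrarily long
    brackets never shrinks the neighborhood.\<close>
  have span: "smooth_span ?U F (snd y) (fst y)" if "y \<in> ?S" for y
    using that
  proof (induction rule: bracket_closure.induct)
    case (base y)
    then show ?case using F(3) by (intro coefficient_class.graded_span_member[OF coefficient_class_smooth] F(2) open_ball) auto
  next
    case (bracket X d Y e)
    have "smooth_span ?U F (d + e) (lie_bracket X Y)"
    proof (rule smooth_span_lie_bracket[OF open_ball F(2)])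
      show "smooth_on (fst y) ?U" if "y \<in> F" for y using smU F(1) that by blast
      show "smooth_on X ?U" "smooth_on Y ?U" using smU[OF bracket.hyps(1)] smU[OF bracket.hyps(2)] by simp_all
    qed (use r(1) bracket.IH in auto)
    then show ?case by simp
  qed
  show ?thesis
    unfolding finite_type_condition_def
  proof (intro exI[of _ ?U] exI[of _ F] conjI ballI)
    show "F \<subseteq> ?S" "finite F" "?U \<subseteq> W" "open ?U" "0 \<in> ?U" using F UW r(3) by auto
    fix y assume "y \<in> ?S"
    from span[OF this] obtain c where c: "\<And>z. z \<in> F \<Longrightarrow> smooth_on (c z) ?U"
      "\<And>x. x \<in> ?U \<Longrightarrow> fst y x = (\<Sum>z | z \<in> F \<and> snd z \<le> snd y. c z x *\<^sub>R fst z x)"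
      unfolding coefficient_class.graded_span_def[OF coefficient_class_smooth[OF open_ball]] eventually_principal by blast
    have set: "{(Y, e). (Y, e) \<in> F \<and> e \<le> d} = {z. z \<in> F \<and> snd z \<le> d}" for d by auto
    show "case y of (X, d) \<Rightarrow> \<exists>c :: (real ^ 'n \<Rightarrow> real ^ 'n) \<times> (nat ^ 'v) \<Rightarrow> real ^ 'n \<Rightarrow> real.
        (\<forall>(Y, e)\<in>F. e \<le> d \<longrightarrow> smooth_on (c (Y, e)) ?U) \<and>
        (\<forall>x\<in>?U. X x = (\<Sum>(Y, e)\<in>{(Y, e). (Y, e) \<in> F \<and> e \<le> d}. c (Y, e) x *\<^sub>R Y x))"
      unfolding set using c by (auto simp: case_prod_unfold intro!: exI[of _ c])
  qed
qed

theorem proposition2p1: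
  fixes blk :: "'m::finite \<Rightarrow> 'v::finite"
    and L :: nat
    and W :: "(real ^ 'n::finite) set"
    and X :: "nat ^ 'm \<Rightarrow> real ^ 'n \<Rightarrow> real ^ 'n"
  assumes "open W" and "0 \<in> W"
    and "\<And>\<alpha>. \<alpha> \<in> multi_indices L \<Longrightarrow> smooth_on (X \<alpha>) W"
  shows "(real_analytic_near (\<lambda>(t, x). gamma_map W L X t x) (0, 0) \<longleftrightarrow>
            (\<forall>\<alpha>\<in>multi_indices L. real_analytic_near (X \<alpha>) 0)) \<and>
         (real_analytic_near (\<lambda>(t, x). gamma_map W L X t x) (0, 0) \<longrightarrow>
            finite_type_condition W (bracket_closure (pure_pairs blk L X)))"
proof -
  have iff: "real_analytic_near (\<lambda>(t, x). gamma_map W L X t x) (0, 0) \<longleftrightarrow>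
      (\<forall>\<alpha>\<in>multi_indices L. real_analytic_near (X \<alpha>) 0)"
  proof
    show "\<forall>\<alpha>\<in>multi_indices L. real_analytic_near (X \<alpha>) 0"
      if "real_analytic_near (\<lambda>(t, x). gamma_map W L X t x) (0, 0)"
      by (rule ballI, rule fields_analytic_of_gamma_map[OF assms(1,2) _ that order_refl]) (rule assms(3))
    show "real_analytic_near (\<lambda>(t, x). gamma_map W L X t x) (0, 0)"
      if "\<forall>\<alpha>\<in>multi_indices L. real_analytic_near (X \<alpha>) 0"
      by (rule gamma_map_analytic[OF assms(1,2)]) (use assms(3) that in auto)
  qed
  moreover have "finite_type_condition W (bracket_closure (pure_pairs blk L X))"
    if "\<forall>\<alpha>\<in>multi_indices L. real_analytic_near (X \<alpha>) 0"
  proof (rule finite_type_of_analytic[OF assms(1,2)])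
    have "pure_pairs blk L X \<subseteq> (\<lambda>\<alpha>. (X \<alpha>, mi_deg blk \<alpha>)) ` multi_indices L"
      by (auto simp: pure_pairs_def)
    then show "finite (pure_pairs blk L X)"
      using finite_multi_indices finite_surj by blast
    fix y assume "y \<in> pure_pairs blk L X"
    then obtain \<alpha> where \<alpha>: "\<alpha> \<in> multi_indices L" "fst y = X \<alpha>" by (auto simp: pure_pairs_def)
    then show "smooth_on (fst y) W" using assms(3) by simp
    show "analytic_field (fst y)"
      using that \<alpha> by (simp add: analytic_field_def real_analytic_near_vec_iff)
  qed
  ultimately show ?thesis by blast
qed

end
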